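(* Let $E$ be a purely unrectifiable self-similar $1$-set with finite iterations $E_n$, as defined in the context. Let $I\subset\mathbb{R}$ be an open bounded interval, $U\subset\mathbb{R}^2$ an open set, and $\Phi\in C^2(I\times U)$ a real-valued function; write $\Phi_\alpha(x)=\Phi(\alpha,x)$. Assume there is a constant $C_0\ge 1$ such that for all $\alpha\in I$ and $x\in U$: (1) $C_0^{-1}\le |\nabla\Phi_\alpha(x)|\le C_0$; (2) $|\partial_i\partial_j\Phi_\alpha(x)|\le C_0$ for all $i,j\in\{1,2\}$; (3) $C_0^{-1}\le\left|\det\begin{pmatrix}\partial_1\Phi_\alpha(x)&\partial_\alpha\partial_1\Phi_\alpha(x)\\ \partial_2\Phi_\alpha(x)&\partial_\alpha\partial_2\Phi_\alpha(x)\end{pmatrix}\right|\le C_0$. Assume that there is a compact set $V\subset U$ with $E_n\subset V$ for all $n$. Then there are constants $c,C>0$, independent of $n$, such that for all $n\ge 1$ $$\frac{c}{n}\le \mathrm{Fav}_\Phi(E_n)\le C\,\mathrm{Fav}(E_{\lfloor n/2\rfloor}).$$ Thus asymptotic upper bounds on $\mathrm{Fav}(E_n)$ also hold for $\mathrm{Fav}_\Phi(E_n)$: for example, from the known bound $\mathrm{Fav}(E_n)\le C_1\exp(-c_0\sqrt{\log n})$ one gets $\mathrm{Fav}_\Phi(E_n)\le C_2\exp(-c_0\sqrt{\log n})$ for all $n\geq 1$, and, when $E_n=K_n$ are the iterations of the four-corner Cantor set, from the known bound $\mathrm{Fav}(K_n)\le C_\varepsilon n^{-1/6+\varepsilon}$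 for every $\varepsilon>0$ one gets $\mathrm{Fav}_\Phi(K_n)\le C'_\varepsilon n^{-1/6+\varepsilon}$ for every $\varepsilon>0$.
   Context: Self-similar set: let $L\in\mathbb{N}$, $L\ge 3$, let $b_1,\dots,b_L\in\mathbb{R}^2$ be not all collinear, and let $\Lambda_i(x)=L^{-1}x+b_i$. $E\subset\mathbb{R}^2$ is the unique non-empty compact set with $E=\bigcup_{i=1}^L\Lambda_i(E)$. It is assumed that the Strong Separation Condition holds: $\Lambda_i(E)\cap\Lambda_j(E)=\emptyset$ for $i\ne j$. (Such an $E$ has Hausdorff dimension 1 and is purely unrectifiable.) The finite iterations are $E_0=[0,1]^2$, $E_n=\bigcup_{i=1}^L\Lambda_i(E_{n-1})$ for $n\ge1$. The four-corner Cantor set corresponds to $L=4$ and $\{b_i\}=\{0,3/4\}^2$, so that $K_n$ is a union of $4^n$ squares of side $4^{-n}$. Favard lengths: $\mathrm{Fav}_\Phi(F)=\int_I|\Phi_\alpha(F)|\,d\alpha$ for $F\subset U$, and $\mathrm{Fav}(F)=\int_0^\pi|\pi_\theta(F)|\,d\theta$ with $\pi_\theta(x)=x_1\cos\theta+x_2\sin\theta$; $|\cdot|$ of a subset of $\mathbb{R}$ is Lebesgue measure. $\nabla,\partial_1,\partial_2$ are derivatives in $x$. Known results from the literature referred to in the claim: for every self-similar set $E=\bigcup_{i=1}^L\Lambda_i(E)$ with $\Lambda_i(x)=L^{-1}x+b_i$, $L\ge3$, $b_1,\dots,b_L\in\mathbb{R}^2$ not all collinear, satisfying the Strong Separation Condition,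 with finite iterations $E_n$, there are $C_1,c_0>0$ with $\mathrm{Fav}(E_n)\le C_1\exp(-c_0\sqrt{\log n})$ (Bond–Volberg); for the four-corner set, $\mathrm{Fav}(K_n)\le C_\varepsilon n^{-1/6+\varepsilon}$ for all $\varepsilon>0$ (Nazarov–Peres–Volberg). *)

theory Defs
  imports "HOL-Analysis.Analysis"
begin

definition ss_map :: "nat \<Rightarrow> (nat \<Rightarrow> real^2) \<Rightarrow> nat \<Rightarrow> real^2 \<Rightarrow> real^2" where
  "ss_map L b i x = (1 / real L) *\<^sub>R x + b i"

primrec fin_iter :: "nat \<Rightarrow> (nat \<Rightarrow> real^2) \<Rightarrow> nat \<Rightarrow> (real^2) set" where
  "fin_iter L b 0 = cbox 0 1"
| "fin_iter L b (Suc n) = (\<Union>i\<in>{1..L}. ss_map L b i ` fin_iter L b n)"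

definition self_similar_ssc :: "nat \<Rightarrow> (nat \<Rightarrow> real^2) \<Rightarrow> (real^2) set \<Rightarrow> bool" where
  "self_similar_ssc L b E \<longleftrightarrow>
     3 \<le> L \<and> \<not> collinear (b ` {1..L}) \<and>
     compact E \<and> E \<noteq> {} \<and> E = (\<Union>i\<in>{1..L}. ss_map L b i ` E) \<and>
     (\<forall>i\<in>{1..L}. \<forall>j\<in>{1..L}. i \<noteq> j \<longrightarrow> ss_map L b i ` E \<inter> ss_map L b j ` E = {})"

text \<open>The four translations exhaust the four points, so any enumeration of them is allowed.\<close>

definition four_corner :: "nat \<Rightarrow> (nat \<Rightarrow> real^2) \<Rightarrow> bool" where
  "four_corner L b \<longleftrightarrow> L = 4 \<and> b ` {1..L} = {x. \<forall>k. x $ k \<in> {0, 3/4}}"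

text \<open>Meant for open \<open>S\<close> only: the derivatives are taken at full neighbourhoods of points.\<close>

definition C2_on :: "'a::real_normed_vector set \<Rightarrow> ('a \<Rightarrow> 'b::real_normed_vector) \<Rightarrow> bool" where
  "C2_on S f \<longleftrightarrow>
     (\<exists>(f' :: 'a \<Rightarrow> 'a \<Rightarrow>\<^sub>L 'b) (f'' :: 'a \<Rightarrow> 'a \<Rightarrow>\<^sub>L ('a \<Rightarrow>\<^sub>L 'b)).
        (\<forall>z\<in>S. (f has_derivative blinfun_apply (f' z)) (at z)) \<and>
        (\<forall>z\<in>S. (f' has_derivative blinfun_apply (f'' z)) (at z)) \<and>
        continuous_on S f'')"

definition pderiv_at :: "2 \<Rightarrow> (real^2 \<Rightarrow> real) \<Rightarrow> real^2 \<Rightarrow> real" where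
  "pderiv_at i f x = deriv (\<lambda>t. f (x + t *\<^sub>R axis i 1)) 0"

definition grad :: "(real^2 \<Rightarrow> real) \<Rightarrow> real^2 \<Rightarrow> real^2" where
  "grad f x = (\<chi> i. pderiv_at i f x)"

definition transversality_matrix :: "(real \<Rightarrow> real^2 \<Rightarrow> real) \<Rightarrow> real \<Rightarrow> real^2 \<Rightarrow> real^2^2" where
  "transversality_matrix \<Phi> \<alpha> x =
     vector [vector [pderiv_at 1 (\<Phi> \<alpha>) x, deriv (\<lambda>\<beta>. pderiv_at 1 (\<Phi> \<beta>) x) \<alpha>],
             vector [pderiv_at 2 (\<Phi> \<alpha>) x, deriv (\<lambda>\<beta>. pderiv_at 2 (\<Phi> \<beta>) x) \<alpha>]]"

text \<open>Favard lengths are extended nonnegative reals, so that no integrability side condition is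
  hidden in the value. The sets of interest are compact, hence their images are measurable.\<close>

definition Fav_gen :: "real set \<Rightarrow> (real \<Rightarrow> real^2 \<Rightarrow> real) \<Rightarrow> (real^2) set \<Rightarrow> ennreal" where
  "Fav_gen I \<Phi> F = (\<integral>\<^sup>+\<alpha>\<in>I. emeasure lebesgue (\<Phi> \<alpha> ` F) \<partial>lebesgue)"

definition lin_proj :: "real \<Rightarrow> real^2 \<Rightarrow> real" where
  "lin_proj \<theta> x = x $ 1 * cos \<theta> + x $ 2 * sin \<theta>"

definition Fav :: "(real^2) set \<Rightarrow> ennreal" where
  "Fav F = Fav_gen {0..pi} lin_proj F"

end

theory Submission
  imports Defs
begin

text \<open>
  Upper bound. Cut \<open>E\<^sub>n\<close> into \<open>L^k\<close> copies of \<open>E\<^sub>m\<close> of size \<open>L^-k\<close>, with \<open>m = n div 2\<close> and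
  \<open>k = n - m\<close>. On a copy, \<open>\<Phi>\<^sub>\<alpha>\<close> differs from its affine part by \<open>O(L^-2k) = O(L^-n)\<close>, the size of
  the squares, so the length of the image is comparable to that of a linear projection of the copy.
  By the determinant condition the angle of the gradient is a bi-Lipschitz function of \<open>\<alpha>\<close>, and a
  change of variables gives the Favard length of \<open>E\<^sub>m\<close>, scaled by \<open>L^-k\<close>, for each of the \<open>L^k\<close> copies.

  Lower bound. Near a point, the set of \<open>\<alpha>\<close> with \<open>|\<Phi>\<^sub>\<alpha>(x) - \<Phi>\<^sub>\<alpha>(y)| \<le> d\<close> has measure \<open>O(d / |x - y|)\<close>.
  If \<open>N\<close> counts the squares of \<open>E\<^sub>n\<close> over a point of the line, the integral of \<open>N\<close> is of order \<open>1\<close>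
  and strong separation bounds that of \<open>N\<^sup>2\<close> by \<open>O(n)\<close>, so \<open>N > 0\<close> on a set of measure at least \<open>c / n\<close>.
\<close>

section \<open>Words and separation\<close>

text \<open>The unit square is not adapted to the maps: squares of one generation may overlap and
  need not meet \<open>E\<close>. Strong separation speaks of \<open>E\<close> alone, so distances
  are read off from the images of one fixed point of \<open>E\<close> and passed on to the centres
  with an error of order \<open>L^-n\<close>. Where this error dominates, two words agree up to
  boundedly many letters and a trivial bound suffices. \<open>U\<close> need not be convex and
  transversality is available only near a point, so the lower bound uses only squares whose words
  begin with one fixed long word; these lie in a small ball. The cost is a factor independent of
  \<open>n\<close>. The factor \<open>n\<close> in the second moment comes from common prefixes: a
  fraction \<open>L^-i\<close> of all pairs agrees in the first \<open>i\<close> letters, while the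
  bound for the measure of parameters at which such a pair overlaps grows like \<open>L^i\<close>.
  All levels up to \<open>n\<close> contribute equally. In the upper bound the Taylor error,
  relative to a piece of size \<open>L^-k\<close>, is \<open>O(L^-k)\<close>. It must not exceed the
  order \<open>L^-m\<close> of the squares of \<open>E_m\<close>, so the method allows
  \<open>m\<close> up to \<open>k\<close>, and halving \<open>n\<close> is the best split.\<close>

definition words :: "nat \<Rightarrow> nat \<Rightarrow> nat list set" where
  "words L n = {w. set w \<subseteq> {1..L} \<and> length w = n}"

primrec word_map :: "nat \<Rightarrow> (nat \<Rightarrow> real^2) \<Rightarrow> nat list \<Rightarrow> real^2 \<Rightarrow> real^2" where
  "word_map L b [] x = x"
| "word_map L b (i # w) x = ss_map L b i (word_map L b w x)"

text \<open>Length of the longest common prefix. Distinct words of equal length index pieces of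
  \<open>E\<close> whose distance is at least a constant times \<open>L^-lcp\<close>.\<close>

fun lcp :: "'a list \<Rightarrow> 'a list \<Rightarrow> nat" where
  "lcp (x # xs) (y # ys) = (if x = y then Suc (lcp xs ys) else 0)"
| "lcp _ _ = 0"

lemma finite_words [simp]: "finite (words L n)"
  unfolding words_def by (rule finite_lists_length_eq) simp

lemma card_words: "card (words L n) = L ^ n"
  unfolding words_def by (subst card_lists_length_eq) auto

lemma words_0 [simp]: "words L 0 = {[]}"
  by (auto simp: words_def)

lemma words_Suc: "words L (Suc n) = (\<Union>i\<in>{1..L}. (#) i ` words L n)"
  by (auto simp: words_def length_Suc_conv image_iff)

lemma sum_words_Suc: "sum f (words L (Suc n)) = (\<Sum>i=1..L. \<Sum>w\<in>words L n. f (i # w))"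
  unfolding words_Suc by (subst sum.UNION_disjoint) (auto simp: sum.reindex)

lemma word_map_affine: "word_map L b w x = (1 / real L) ^ length w *\<^sub>R x + word_map L b w 0"
  by (induction w) (auto simp: ss_map_def algebra_simps)

lemma word_map_diff: "word_map L b w x - word_map L b w y = (1 / real L) ^ length w *\<^sub>R (x - y)"
  by (subst (1 2) word_map_affine) (simp add: algebra_simps)

lemma continuous_on_word_map [continuous_intros]: "continuous_on S (word_map L b w)"
  by (subst continuous_on_cong[OF refl word_map_affine]) (intro continuous_intros)

lemma fin_iter_add: "fin_iter L b (k + m) = (\<Union>w\<in>words L k. word_map L b w ` fin_iter L b m)"
  by (induction k) (auto simp: words_Suc)

lemma fin_iter_words: "fin_iter L b n = (\<Union>w\<in>words L n. word_map L b w ` cbox 0 1)"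
  using fin_iter_add[of L b n 0] by simp

lemma compact_fin_iter: "compact (fin_iter L b n)"
  unfolding fin_iter_words by (intro compact_UN finite_words compact_continuous_image continuous_intros) auto

lemma lcp_same [simp]: "lcp w w = length w"
  by (induction w) auto

text \<open>A fraction \<open>L^-i\<close> of all pairs agrees in the first \<open>i\<close>
  letters, so each of the \<open>n + 1\<close> levels contributes at most \<open>L^(2n)\<close>.
  Splitting off the first letter makes this a recursion: the \<open>L\<close> pairs of equal letters
  reproduce the previous sum with a factor \<open>L\<close>, all other pairs have \<open>lcp\<close>
  equal to 0.\<close>

lemma sum_lcp_le:
  assumes "L \<ge> 1"
  shows "(\<Sum>v\<in>words L n. \<Sum>w\<in>words L n. real L ^ lcp v w) \<le> real (n + 1) * real L ^ (2 * n)"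
proof (induction n)
  case 0
  then show ?case by simp
next
  case (Suc n)
  let ?S = "\<Sum>v\<in>words L n. \<Sum>w\<in>words L n. real L ^ lcp v w"
  \<comment> \<open>The summand \<open>L^(2n)\<close> is the contribution of distinct first letters.
    Granting it to equal letters as well only weakens the bound and keeps the double sum
    uniform.\<close>
  have inner: "(\<Sum>v\<in>words L n. \<Sum>w\<in>words L n. real L ^ lcp (i # v) (j # w))
      \<le> (if i = j then real L * ?S else 0) + real L ^ (2 * n)" for i j
    by (auto simp: sum_distrib_left card_words power_add mult_2)
  have "(\<Sum>v\<in>words L (Suc n). \<Sum>w\<in>words L (Suc n). real L ^ lcp v w)
      = (\<Sum>i=1..L. \<Sum>j=1..L. \<Sum>v\<in>words L n. \<Sum>w\<in>words L n. real L ^ lcp (i # v) (j # w))"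
    unfolding sum_words_Suc by (intro sum.cong refl) (rule sum.swap)
  also have "\<dots> \<le> (\<Sum>i=1..L. \<Sum>j=1..L. (if i = j then real L * ?S else 0) + real L ^ (2 * n))"
    by (intro sum_mono inner)
  also have "\<dots> = real L ^ 2 * ?S + real L ^ (2 * Suc n)"
    by (simp add: sum.distrib power2_eq_square distrib_left mult.assoc)
  also have "\<dots> \<le> real L ^ 2 * (real (n + 1) * real L ^ (2 * n)) + real L ^ (2 * Suc n)"
    by (intro add_mono mult_left_mono Suc.IH) auto
  also have "\<dots> = real (Suc n + 1) * real L ^ (2 * Suc n)"
    by (simp add: algebra_simps power2_eq_square)
  finally show ?case .
qed

locale self_similar =
  fixes L :: nat and b :: "nat \<Rightarrow> real^2" and E :: "(real^2) set"
  assumes ssc: "self_similar_ssc L b E"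
begin

lemma L_ge_3: "L \<ge> 3" and L_pos: "L > 0"
  using ssc by (auto simp: self_similar_ssc_def)

lemma word_map_in_E: "e \<in> E \<Longrightarrow> w \<in> words L n \<Longrightarrow> word_map L b w e \<in> E"
proof (induction w arbitrary: n)
  case Nil
  then show ?case by simp
next
  case (Cons i w)
  then have "word_map L b w e \<in> E" "i \<in> {1..L}"
    by (auto simp: words_def)
  moreover have "E = (\<Union>i\<in>{1..L}. ss_map L b i ` E)"
    using ssc unfolding self_similar_ssc_def by blast
  ultimately show ?case
    by (metis UN_I imageI word_map.simps(2))
qed

lemma pieces_separated:
  obtains d where "d > 0"
    "\<And>i j x y. i \<in> {1..L} \<Longrightarrow> j \<in> {1..L} \<Longrightarrow> i \<noteq> j \<Longrightarrow> x \<in> E \<Longrightarrow> y \<in> E \<Longrightarrow>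
       d \<le> dist (ss_map L b i x) (ss_map L b j y)"
proof -
  let ?P = "{(i, j). i \<in> {1..L} \<and> j \<in> {1..L} \<and> i \<noteq> j}"
  have "\<exists>d>0. \<forall>x\<in>E. \<forall>y\<in>E. d \<le> dist (ss_map L b (fst p) x) (ss_map L b (snd p) y)" if "p \<in> ?P" for p
  proof -
    have c: "compact (ss_map L b i ` E)" for i
      using ssc unfolding self_similar_ssc_def
      by (auto simp: ss_map_def intro!: compact_continuous_image continuous_intros)
    have "ss_map L b (fst p) ` E \<inter> ss_map L b (snd p) ` E = {}"
      using ssc that unfolding self_similar_ssc_def mem_Collect_eq case_prod_unfold by presburger
    from separate_compact_closed[OF c compact_imp_closed[OF c] this] show ?thesis
      by auto
  qed
  then have "\<exists>D. \<forall>p\<in>?P. D p > 0 \<and>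
      (\<forall>x\<in>E. \<forall>y\<in>E. D p \<le> dist (ss_map L b (fst p) x) (ss_map L b (snd p) y))"
    by (intro bchoice ballI)
  then obtain D where D: "\<forall>p\<in>?P. D p > 0 \<and>
      (\<forall>x\<in>E. \<forall>y\<in>E. D p \<le> dist (ss_map L b (fst p) x) (ss_map L b (snd p) y))" ..
  have fin: "finite ?P"
    by (rule finite_subset[of _ "{1..L} \<times> {1..L}"]) auto
  show ?thesis
  \<comment> \<open>The element 1 keeps the finite set visibly nonempty, so that \<open>Min\<close>
    is a genuine minimum.\<close>
  proof (rule that[of "Min (insert 1 (D ` ?P))"])
    show "Min (insert 1 (D ` ?P)) > 0"
      using fin D by (subst Min_gr_iff) auto
  next
    fix i j x y assume *: "i \<in> {1..L}" "j \<in> {1..L}" "i \<noteq> j" "x \<in> E" "y \<in> E"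
    then have "Min (insert 1 (D ` ?P)) \<le> D (i, j)"
      using fin by (intro Min_le) auto
    also have "\<dots> \<le> dist (ss_map L b i x) (ss_map L b j y)"
      using bspec[OF D, of "(i, j)"] * by auto
    finally show "Min (insert 1 (D ` ?P)) \<le> dist (ss_map L b i x) (ss_map L b j y)" .
  qed
qed

text \<open>Stripping the common prefix rescales distances by exactly \<open>L^-lcp\<close>, and the
  first differing letters put the two points into different first-generation pieces of
  \<open>E\<close>. Equal lengths exclude that one word is a proper prefix of the other.\<close>

lemma word_map_separated:
  obtains d where "d > 0"
    "\<And>n v w e. v \<in> words L n \<Longrightarrow> w \<in> words L n \<Longrightarrow> v \<noteq> w \<Longrightarrow> e \<in> E \<Longrightarrow>
       d * (1 / real L) ^ lcp v w \<le> dist (word_map L b v e) (word_map L b w e)"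
proof -
  obtain d where d: "d > 0"
    "\<And>i j x y. i \<in> {1..L} \<Longrightarrow> j \<in> {1..L} \<Longrightarrow> i \<noteq> j \<Longrightarrow> x \<in> E \<Longrightarrow> y \<in> E \<Longrightarrow>
       d \<le> dist (ss_map L b i x) (ss_map L b j y)"
    using pieces_separated by blast
  have "d * (1 / real L) ^ lcp v w \<le> dist (word_map L b v e) (word_map L b w e)"
    if "v \<in> words L n" "w \<in> words L n" "v \<noteq> w" "e \<in> E" for n v w e
    using that
  proof (induction v w arbitrary: n rule: lcp.induct)
    case (1 i v j w)
    then have vw: "v \<in> words L (n - 1)" "w \<in> words L (n - 1)" "i \<in> {1..L}" "j \<in> {1..L}"
      by (auto simp: words_def)
    show ?case
    proof (cases "i = j")
      case True
      then have "d * (1 / real L) ^ lcp v w \<le> dist (word_map L b v e) (word_map L b w e)"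
        using 1 vw by auto
      moreover have "dist (word_map L b (i # v) e) (word_map L b (j # w) e)
          = (1 / real L) * dist (word_map L b v e) (word_map L b w e)"
        using True by (simp add: ss_map_def dist_norm flip: scaleR_diff_right)
      ultimately show ?thesis
        using True L_pos by (simp add: divide_right_mono)
    next
      case False
      then show ?thesis
        using vw word_map_in_E[OF 1(5)] d(2) by auto
    qed
  qed (auto simp: words_def)
  then show ?thesis
    using d(1) that by blast
qed

end

section \<open>Projections\<close>

text \<open>With \<open>N\<close> the number of intervals over a point,
  \<open>2 N / M - (N / M)^2\<close> is at most 1 because \<open>(1 - N / M)^2\<close> is
  nonnegative, and it vanishes off \<open>A\<close>. This replaces the quotient form of
  Cauchy-Schwarz by an inequality linear in both moments, which can be integrated over a further
  parameter with one common \<open>M\<close> chosen afterwards.\<close>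

lemma measure_ge_second_moment:
  fixes c :: "'i \<Rightarrow> real"
  assumes W: "finite W" and r: "r \<ge> 0" and M: "M > 0" and A: "A \<in> lmeasurable"
    and sub: "\<And>w. w \<in> W \<Longrightarrow> {c w - r..c w + r} \<subseteq> A"
  shows "2 / M * (2 * r * card W)
      - 1 / M\<^sup>2 * (2 * r * (\<Sum>v\<in>W. \<Sum>w\<in>W. of_bool (\<bar>c v - c w\<bar> \<le> 2 * r)))
    \<le> measure lebesgue A"
proof -
  define J where "J w = {c w - r..c w + r}" for w
  have J: "J w \<in> lmeasurable" "J v \<inter> J w \<in> lmeasurable" for v w
    by (auto simp: J_def)
  have mJ: "measure lebesgue (J w) = 2 * r" for w
    using r by (simp add: J_def)
  have mJJ: "measure lebesgue (J v \<inter> J w) \<le> 2 * r * of_bool (\<bar>c v - c w\<bar> \<le> 2 * r)" for v w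
  proof (cases "\<bar>c v - c w\<bar> \<le> 2 * r")
    case True
    have "measure lebesgue (J v \<inter> J w) \<le> measure lebesgue (J w)"
      using J by (intro measure_mono_fmeasurable) auto
    then show ?thesis
      using True mJ by simp
  next
    case False
    then have "J v \<inter> J w = {}"
      by (auto simp: J_def)
    then show ?thesis
      using False by simp
  qed
  define N where "N y = (\<Sum>w\<in>W. indicat_real (J w) y)" for y
  have pt: "2 / M * N y - 1 / M\<^sup>2 * (\<Sum>v\<in>W. \<Sum>w\<in>W. indicat_real (J v \<inter> J w) y) \<le> indicat_real A y" for y
  proof -
    have N2: "(\<Sum>v\<in>W. \<Sum>w\<in>W. indicat_real (J v \<inter> J w) y) = (N y)\<^sup>2"
      by (simp add: N_def power2_eq_square sum_product indicator_inter_arith)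
    show ?thesis
    proof (cases "y \<in> A")
      case True
      have "0 \<le> (1 - N y / M)\<^sup>2"
        by simp
      then show ?thesis
        using True unfolding N2 by (simp add: power2_eq_square algebra_simps)
    next
      case False
      then have "N y = 0"
        using sub unfolding N_def by (intro sum.neutral) (fastforce simp: J_def indicator_def simp del: atLeastatMost_subset_iff)
      then show ?thesis
        using False unfolding N2 by simp
    qed
  qed
  have int: "integrable lebesgue (indicat_real (J w))" "integrable lebesgue (indicat_real (J v \<inter> J w))"
      "integrable lebesgue (indicat_real A)" for v w
    using J A by (simp_all add: lmeasurable_iff_integrable)
  have iN: "integrable lebesgue N"
    unfolding N_def by (intro Bochner_Integration.integrable_sum int)
  have iNN: "integrable lebesgue (\<lambda>y. \<Sum>v\<in>W. \<Sum>w\<in>W. indicat_real (J v \<inter> J w) y)"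
    by (intro Bochner_Integration.integrable_sum int)
  have "(\<integral>y. 2 / M * N y - 1 / M\<^sup>2 * (\<Sum>v\<in>W. \<Sum>w\<in>W. indicat_real (J v \<inter> J w) y) \<partial>lebesgue)
      \<le> (\<integral>y. indicat_real A y \<partial>lebesgue)"
    by (intro integral_mono Bochner_Integration.integrable_diff integrable_mult_right iN iNN int pt)
  also have "(\<integral>y. indicat_real A y \<partial>lebesgue) = measure lebesgue A"
    by simp
  also have "(\<integral>y. 2 / M * N y - 1 / M\<^sup>2 * (\<Sum>v\<in>W. \<Sum>w\<in>W. indicat_real (J v \<inter> J w) y) \<partial>lebesgue)
      = 2 / M * (\<integral>y. N y \<partial>lebesgue)
        - 1 / M\<^sup>2 * (\<integral>y. (\<Sum>v\<in>W. \<Sum>w\<in>W. indicat_real (J v \<inter> J w) y) \<partial>lebesgue)"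
    using iN iNN by (subst Bochner_Integration.integral_diff) auto
  also have "(\<integral>y. N y \<partial>lebesgue) = 2 * r * card W"
    unfolding N_def by (subst Bochner_Integration.integral_sum) (simp_all add: int mJ)
  also have "(\<integral>y. (\<Sum>v\<in>W. \<Sum>w\<in>W. indicat_real (J v \<inter> J w) y) \<partial>lebesgue)
      = (\<Sum>v\<in>W. \<Sum>w\<in>W. measure lebesgue (J v \<inter> J w))"
    by (subst Bochner_Integration.integral_sum, intro Bochner_Integration.integrable_sum int)
       (intro sum.cong refl, subst Bochner_Integration.integral_sum, simp_all add: int)
  finally have "2 / M * (2 * r * card W) - 1 / M\<^sup>2 * (\<Sum>v\<in>W. \<Sum>w\<in>W. measure lebesgue (J v \<inter> J w))
      \<le> measure lebesgue A" .
  moreover have "1 / M\<^sup>2 * (\<Sum>v\<in>W. \<Sum>w\<in>W. measure lebesgue (J v \<inter> J w))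
      \<le> 1 / M\<^sup>2 * (2 * r * (\<Sum>v\<in>W. \<Sum>w\<in>W. of_bool (\<bar>c v - c w\<bar> \<le> 2 * r)))"
    unfolding sum_distrib_left[of "2 * r"] by (intro mult_left_mono sum_mono mJJ) auto
  ultimately show ?thesis by linarith
qed

section \<open>Length of linear projections as a function of the direction vector\<close>

definition proj_length :: "(real^2) set \<Rightarrow> real^2 \<Rightarrow> ennreal" where
  "proj_length K v = emeasure lborel ((\<lambda>z. v \<bullet> z) ` K)"

definition unit_vec :: "real \<Rightarrow> real^2" where
  "unit_vec \<theta> = vector [cos \<theta>, sin \<theta>]"

lemma lin_proj_inner: "lin_proj \<theta> z = unit_vec \<theta> \<bullet> z"
  by (simp add: lin_proj_def unit_vec_def inner_vec_def sum_2 mult.commute)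

text \<open>The value at \<open>v\<close> is the measure of the section over \<open>v\<close> of the
  set of pairs \<open>(v, v \<bullet> z)\<close> with \<open>z\<close> in \<open>K\<close>. That set
  is sigma-compact (the balls of radius \<open>n\<close> make the range of \<open>v\<close>
  compact), so the measurability of section measures applies.\<close>

lemma measurable_proj_length [measurable]:
  assumes K: "compact K"
  shows "proj_length K \<in> borel_measurable borel"
proof -
  define S where "S = (\<Union>n. (\<lambda>(v, z). (v, v \<bullet> z)) ` (cball (0::real^2) (real n) \<times> K))"
  have "compact ((\<lambda>(v, z). (v, v \<bullet> z)) ` (cball (0::real^2) (real n) \<times> K))" for n
    unfolding case_prod_unfold using K
    by (intro compact_continuous_image compact_Times continuous_intros) auto
  then have "S \<in> sets borel"
    unfolding S_def by (intro sets.countable_UN'') (auto intro: borel_compact)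
  then have "S \<in> sets (borel \<Otimes>\<^sub>M lborel)"
    by (simp add: borel_prod[symmetric] cong: sets_pair_measure_cong)
  then have "(\<lambda>v. emeasure lborel (Pair v -` S)) \<in> borel_measurable borel"
    by (rule lborel.measurable_emeasure_Pair)
  moreover have "Pair v -` S = (\<lambda>z. v \<bullet> z) ` K" for v
  proof -
    have "\<exists>n. norm v \<le> real n"
      by (rule real_arch_simple)
    then show ?thesis
      unfolding S_def by (auto simp: image_iff)
  qed
  ultimately show ?thesis
    by (simp add: proj_length_def[abs_def])
qed

text \<open>Gradients, which are not unit vectors, can therefore be inserted for \<open>v\<close>:
  their length splits off and only the direction matters.\<close>

lemma proj_length_scaleR: "proj_length K (c *\<^sub>R v) = ennreal \<bar>c\<bar> * proj_length K v" if "compact K"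
proof -
  have c: "compact ((\<lambda>z. v \<bullet> z) ` K)" for v
    using that by (intro compact_continuous_image continuous_intros)
  have eq: "proj_length K v = emeasure lebesgue ((\<lambda>z. v \<bullet> z) ` K)" for v
    unfolding proj_length_def using c[of v] by (simp add: emeasure_completion borel_compact)
  have "(\<lambda>z. (c *\<^sub>R v) \<bullet> z) ` K = (\<lambda>x. c *\<^sub>R x + 0) ` (\<lambda>z. v \<bullet> z) ` K"
    by (simp add: image_image)
  then show ?thesis
    unfolding eq by (simp only: emeasure_lebesgue_affine) simp
qed

lemma continuous_unit_vec: "continuous_on S unit_vec"
  unfolding unit_vec_def[abs_def] continuous_on_vec_lambda vector_def
  by (subst continuous_on_componentwise) (auto simp: Basis_vec_def inner_axis forall_2 intro!: continuous_intros)

lemma measurable_unit_vec [measurable]: "unit_vec \<in> borel_measurable borel"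
  using continuous_unit_vec by (rule borel_measurable_continuous_onI)

lemma Fav_eq: "Fav K = (\<integral>\<^sup>+\<theta>\<in>{0..pi}. proj_length K (unit_vec \<theta>) \<partial>lborel)" if "compact K"
proof -
  have "emeasure lebesgue (lin_proj \<theta> ` K) = proj_length K (unit_vec \<theta>)" for \<theta>
  proof -
    have "compact ((\<lambda>z. unit_vec \<theta> \<bullet> z) ` K)"
      using that by (intro compact_continuous_image continuous_intros)
    then show ?thesis
      unfolding proj_length_def lin_proj_inner[abs_def] by (simp add: borel_compact)
  qed
  then show ?thesis
    by (simp add: Fav_def Fav_gen_def nn_integral_completion)
qed

text \<open>The interval is covered by the cells \<open>[j T, j T + T]\<close> with \<open>j\<close>
  between the floors of \<open>p / T\<close> and \<open>q / T\<close>; the summand 2 pays for the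
  incomplete cells at both ends.\<close>

lemma nn_integral_periodic_le:
  fixes F :: "real \<Rightarrow> ennreal"
  assumes F [measurable]: "F \<in> borel_measurable borel" and T: "T > 0"
    and per: "\<And>x. F (x + T) = F x" and pq: "p \<le> q"
  shows "(\<integral>\<^sup>+x\<in>{p..q}. F x \<partial>lborel) \<le> ennreal ((q - p) / T + 2) * (\<integral>\<^sup>+x\<in>{0..T}. F x \<partial>lborel)"
proof -
  have per_nat: "F (x + real n * T) = F x" for x n
  proof (induction n)
    case (Suc n)
    then show ?case
      using per[of "x + real n * T"] by (simp add: algebra_simps)
  qed auto
  have per_int: "F (x + of_int j * T) = F x" for x j
  proof (cases "j \<ge> 0")
    case True
    then show ?thesis using per_nat[of x "nat j"] by simp
  next
    case False
    then show ?thesis using per_nat[of "x + of_int j * T" "nat (-j)"] by simp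
  qed
  define Js where "Js = {\<lfloor>p / T\<rfloor>..\<lfloor>q / T\<rfloor>}"
  have shift: "(\<integral>\<^sup>+x\<in>{of_int j * T..of_int j * T + T}. F x \<partial>lborel) = (\<integral>\<^sup>+x\<in>{0..T}. F x \<partial>lborel)" for j :: int
  proof -
    have "(\<integral>\<^sup>+x\<in>{of_int j * T..of_int j * T + T}. F x \<partial>lborel)
        = (\<integral>\<^sup>+x. F (of_int j * T + x) * indicator {of_int j * T..of_int j * T + T} (of_int j * T + x) \<partial>lborel)"
      by (subst nn_integral_real_affine[where c = 1 and t = "of_int j * T"]) auto
    also have "\<dots> = (\<integral>\<^sup>+x\<in>{0..T}. F x \<partial>lborel)"
      using per_int by (intro nn_integral_cong) (auto simp: indicator_def add.commute)
    finally show ?thesis .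
  qed
  have "(\<integral>\<^sup>+x\<in>{p..q}. F x \<partial>lborel) \<le> (\<integral>\<^sup>+x. (\<Sum>j\<in>Js. F x * indicator {of_int j * T..of_int j * T + T} x) \<partial>lborel)"
  proof (intro nn_integral_mono)
    fix x
    show "F x * indicator {p..q} x \<le> (\<Sum>j\<in>Js. F x * indicator {of_int j * T..of_int j * T + T} x)"
    proof (cases "x \<in> {p..q}")
      case True
      define j where "j = \<lfloor>x / T\<rfloor>"
      have "j \<in> Js"
        using True T by (auto simp: j_def Js_def intro!: floor_mono divide_right_mono)
      moreover have "of_int j \<le> x / T" "x / T < of_int j + 1"
        unfolding j_def by linarith+
      then have "x \<in> {of_int j * T..of_int j * T + T}"
        using T by (auto simp: field_simps)
      ultimately have "F x \<le> (\<Sum>j\<in>{j}. F x * indicator {of_int j * T..of_int j * T + T} x)"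
        by simp
      also have "\<dots> \<le> (\<Sum>j\<in>Js. F x * indicator {of_int j * T..of_int j * T + T} x)"
        using \<open>j \<in> Js\<close> by (intro sum_mono2) (auto simp: Js_def)
      finally show ?thesis
        using True by simp
    qed simp
  qed
  also have "\<dots> = of_nat (card Js) * (\<integral>\<^sup>+x\<in>{0..T}. F x \<partial>lborel)"
    by (subst nn_integral_sum) (simp_all add: shift)
  also have "of_nat (card Js) \<le> ennreal ((q - p) / T + 2)"
  proof -
    have "\<lfloor>p / T\<rfloor> \<le> \<lfloor>q / T\<rfloor>"
      using pq T by (intro floor_mono divide_right_mono) auto
    then have "real (card Js) = of_int \<lfloor>q / T\<rfloor> - of_int \<lfloor>p / T\<rfloor> + 1"
      by (simp add: Js_def)
    also have "\<dots> \<le> q / T - p / T + 2"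
      by linarith
    finally have "real (card Js) \<le> (q - p) / T + 2"
      by (simp add: diff_divide_distrib)
    then show ?thesis
      by (metis ennreal_leI ennreal_of_nat_eq_real_of_nat)
  qed
  finally show ?thesis
    by (simp add: mult_right_mono)
qed

text \<open>If \<open>\<theta>\<close> is a primitive of the angular velocity of \<open>g\<close>, then the component of \<open>g\<close>
  orthogonal to \<open>unit_vec \<theta>\<close> divided by \<open>norm g\<close> has derivative \<open>0\<close>.\<close>

lemma polar_angle:
  fixes g g' :: "real \<Rightarrow> real^2"
  assumes deriv: "\<And>x. x \<in> {s<..<t} \<Longrightarrow> (g has_vector_derivative g' x) (at x)"
    and nz: "\<And>x. x \<in> {s<..<t} \<Longrightarrow> g x \<noteq> 0"
    and cont: "continuous_on {s<..<t} g'"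
    and ab: "s < a" "a < b" "b < t"
  obtains \<theta> p where
    "\<And>x. x \<in> {a..b} \<Longrightarrow>
       (\<theta> has_real_derivative ((g x $ 1 * g' x $ 2 - g x $ 2 * g' x $ 1) / (norm (g x))\<^sup>2)) (at x)"
    "\<And>x. x \<in> {a..b} \<Longrightarrow> g x = p x *\<^sub>R unit_vec (\<theta> x)"
proof -
  define R where "R x = (g x $ 1)\<^sup>2 + (g x $ 2)\<^sup>2" for x
  define w where "w x = (g x $ 1 * g' x $ 2 - g x $ 2 * g' x $ 1) / R x" for x
  have R_norm: "R x = (norm (g x))\<^sup>2" for x
    by (simp add: R_def norm_vec_def L2_set_def sum_2)
  have R_pos: "R x > 0" if "x \<in> {s<..<t}" for x
    using nz[OF that] by (simp add: R_norm)
  \<comment> \<open>Enlarging \<open>{a..b}\<close> inside the open interval makes the derivatives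
    at \<open>a\<close> and \<open>b\<close> two-sided.\<close>
  define a' b' where "a' = (s + a) / 2" and "b' = (t + b) / 2"
  have a'b': "s < a'" "a' < a" "b < b'" "b' < t" "a' \<le> b'"
    using ab by (auto simp: a'_def b'_def)
  have sub: "{a'..b'} \<subseteq> {s<..<t}"
    using a'b' by auto
  have cg: "continuous_on {a'..b'} g"
    by (intro continuous_at_imp_continuous_on ballI has_vector_derivative_continuous[OF deriv]) (use sub in blast)
  have cg': "continuous_on {a'..b'} g'"
    using cont sub continuous_on_subset by blast
  have "continuous_on {a'..b'} w"
    unfolding w_def R_def using R_pos sub
    by (intro continuous_intros cg cg') (fastforce simp: R_def)
  then obtain \<theta>0 where \<theta>0: "\<And>x. x \<in> {a'..b'} \<Longrightarrow> (\<theta>0 has_vector_derivative w x) (at x within {a'..b'})"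
    using antiderivative_continuous by blast
  \<comment> \<open>The constant of integration is fixed by making \<open>\<theta> a\<close> the
    argument of \<open>g a\<close>, which gives \<open>Q a = 0\<close>.\<close>
  define z where "z = complex_of_real (g a $ 1) + \<i> * complex_of_real (g a $ 2)"
  define \<theta> where "\<theta> x = \<theta>0 x - \<theta>0 a + Arg z" for x
  have d\<theta>: "(\<theta> has_real_derivative w x) (at x)" if "x \<in> {a'<..<b'}" for x
  proof -
    have "(\<theta>0 has_real_derivative w x) (at x)"
      using \<theta>0[of x] that by (simp add: at_within_Icc_at has_real_derivative_iff_has_vector_derivative)
    then show ?thesis
      unfolding \<theta>_def by (auto intro!: derivative_eq_intros)
  qed
  have dg: "((\<lambda>x. g x $ i) has_real_derivative g' x $ i) (at x)" if "x \<in> {s<..<t}" for x i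
    using bounded_linear.has_vector_derivative[OF bounded_linear_vec_nth deriv[OF that]]
    by (simp add: has_real_derivative_iff_has_vector_derivative)
  define Q where "Q x = g x $ 1 * sin (\<theta> x) - g x $ 2 * cos (\<theta> x)" for x
  define p where "p x = g x $ 1 * cos (\<theta> x) + g x $ 2 * sin (\<theta> x)" for x
  define A where "A x = (g x $ 1 * g' x $ 1 + g x $ 2 * g' x $ 2) / R x" for x
  \<comment> \<open>The quotient is squared so that the polynomial \<open>R\<close> can replace the
    norm and no square root is differentiated.\<close>
  have zero: "((\<lambda>x. (Q x)\<^sup>2 / R x) has_real_derivative 0) (at x)" if x: "x \<in> {a'<..<b'}" for x
  proof -
    have xs: "x \<in> {s<..<t}"
      using x a'b' by auto
    note Rx = R_pos[OF xs]
    \<comment> \<open>Decomposition of \<open>g'\<close> along \<open>g\<close> and its rotation by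
      a right angle: \<open>A\<close> is the logarithmic growth rate of the norm, \<open>w\<close>
      the angular velocity. Hence \<open>Q' = A Q\<close> and \<open>R' = 2 A R\<close>, and the
      derivatives of \<open>Q^2\<close> and \<open>R\<close> cancel in the quotient.\<close>
    have g': "g' x $ 1 = A x * g x $ 1 - w x * g x $ 2" "g' x $ 2 = A x * g x $ 2 + w x * g x $ 1"
      using Rx unfolding A_def w_def by (simp_all add: divide_simps) (simp_all add: R_def power2_eq_square algebra_simps)
    have dQ: "(Q has_real_derivative A x * Q x) (at x)"
      unfolding Q_def by (rule derivative_eq_intros dg[OF xs] d\<theta>[OF x] refl)+ (simp add: g' algebra_simps)
    have dR: "(R has_real_derivative 2 * A x * R x) (at x)"
      unfolding R_def by (rule derivative_eq_intros dg[OF xs] refl)+ (simp add: g' algebra_simps power2_eq_square)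
    show ?thesis
      by (rule derivative_eq_intros dQ dR refl)+ (use Rx in \<open>auto simp: power2_eq_square\<close>)
  qed
  have aI: "a \<in> {a'<..<b'}"
    using a'b' ab by auto
  have "Q a = 0"
  proof -
    have "Re z = cmod z * cos (Arg z)" "Im z = cmod z * sin (Arg z)"
      using arg_cong[OF rcis_cmod_Arg[of z], of Re] arg_cong[OF rcis_cmod_Arg[of z], of Im] by simp_all
    then have "g a $ 1 = cmod z * cos (\<theta> a)" "g a $ 2 = cmod z * sin (\<theta> a)"
      by (simp_all add: z_def \<theta>_def)
    then show ?thesis
      by (simp add: Q_def)
  qed
  have Q0: "Q x = 0" if x: "x \<in> {a'<..<b'}" for x
  proof -
    have "(Q x)\<^sup>2 / R x = (Q a)\<^sup>2 / R a"
      by (rule DERIV_isconst3[of a' b']) (use a'b' ab x aI zero in auto)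
    then show ?thesis
      using \<open>Q a = 0\<close> R_pos[of x] x a'b' by auto
  qed
  have polar: "g x = p x *\<^sub>R unit_vec (\<theta> x)" if "x \<in> {a'<..<b'}" for x
  proof -
    have Qx: "g x $ 1 * sin (\<theta> x) = g x $ 2 * cos (\<theta> x)"
      using Q0[OF that] by (simp add: Q_def)
    have sc: "sin (\<theta> x) * sin (\<theta> x) + cos (\<theta> x) * cos (\<theta> x) = 1"
      using sin_cos_squared_add[of "\<theta> x"] by (simp add: power2_eq_square)
    have "p x * cos (\<theta> x) = g x $ 1 * (sin (\<theta> x) * sin (\<theta> x) + cos (\<theta> x) * cos (\<theta> x))"
      using Qx unfolding p_def by algebra
    moreover have "p x * sin (\<theta> x) = g x $ 2 * (sin (\<theta> x) * sin (\<theta> x) + cos (\<theta> x) * cos (\<theta> x))"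
      using Qx unfolding p_def by algebra
    ultimately show ?thesis
      using sc by (simp add: vec_eq_iff forall_2 unit_vec_def)
  qed
  show ?thesis
    by (rule that[of \<theta> p]) (use d\<theta> polar a'b' in \<open>auto simp: w_def R_norm\<close>)
qed

section \<open>Change of variables from the parameter to the angle\<close>

lemma measurable_compose_continuous_on:
  fixes F :: "'b::real_normed_vector \<Rightarrow> ennreal" and h :: "real \<Rightarrow> 'b"
  assumes [measurable]: "F \<in> borel_measurable borel" and h: "continuous_on S h" and S [measurable]: "S \<in> sets borel"
  shows "(\<lambda>x. F (h x) * indicator S x) \<in> borel_measurable lborel"
proof -
  have "(\<lambda>x. indicator S x *\<^sub>R h x) \<in> borel_measurable borel"
    by (rule borel_measurable_continuous_on_indicator[OF S h])
  then have "(\<lambda>x. F (indicator S x *\<^sub>R h x) * indicator S x) \<in> borel_measurable lborel"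
    by measurable
  moreover have "(\<lambda>x. F (indicator S x *\<^sub>R h x) * indicator S x) = (\<lambda>x. F (h x) * indicator S x)"
    by (auto simp: fun_eq_iff indicator_def)
  ultimately show ?thesis by simp
qed

text \<open>Substituting \<open>y = \<theta> x\<close> costs a factor \<open>1 / k\<close>, and
  \<open>y\<close> runs over an interval of length at most \<open>K (b - a)\<close>, which is
  covered by at most \<open>K (b - a) / pi + 2\<close> periods.\<close>

lemma nn_integral_angle_le_pos:
  fixes F :: "real \<Rightarrow> ennreal" and \<theta> w :: "real \<Rightarrow> real"
  assumes F [measurable]: "F \<in> borel_measurable borel" and per: "\<And>x. F (x + pi) = F x"
    and deriv: "\<And>x. x \<in> {a..b} \<Longrightarrow> (\<theta> has_real_derivative w x) (at x)"
    and cont: "continuous_on {a..b} w" and ab: "a < b" and k: "k > 0"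
    and w: "\<And>x. x \<in> {a..b} \<Longrightarrow> k \<le> w x \<and> w x \<le> K"
  shows "(\<integral>\<^sup>+x\<in>{a..b}. F (\<theta> x) \<partial>lborel)
    \<le> ennreal (1 / k * (K * (b - a) / pi + 2)) * (\<integral>\<^sup>+x\<in>{0..pi}. F x \<partial>lborel)"
proof -
  have K: "K \<ge> 0"
    using w[of a] ab k by auto
  obtain \<xi> where \<xi>: "a < \<xi>" "\<xi> < b" "\<theta> b - \<theta> a = (b - a) * w \<xi>"
    using MVT2[OF ab, of \<theta> w] deriv by auto
  have len: "0 \<le> \<theta> b - \<theta> a" "\<theta> b - \<theta> a \<le> K * (b - a)"
    using w[of \<xi>] \<xi> ab k by (auto intro!: mult_nonneg_nonneg simp: mult.commute)
  have c\<theta>: "continuous_on {a..b} \<theta>"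
    using deriv by (intro continuous_at_imp_continuous_on ballI DERIV_isCont)
  have mF: "(\<lambda>x. F (\<theta> x) * indicator {a..b} x) \<in> borel_measurable lborel"
    by (rule measurable_compose_continuous_on[OF F c\<theta>]) simp
  have "(\<integral>\<^sup>+x\<in>{a..b}. F (\<theta> x) \<partial>lborel)
      \<le> (\<integral>\<^sup>+x. ennreal (1 / k) * (F (\<theta> x) * ennreal (w x) * indicator {a..b} x) \<partial>lborel)"
  proof (intro nn_integral_mono)
    fix x
    have "1 \<le> ennreal (1 / k) * ennreal (w x)" if "x \<in> {a..b}"
      using w[OF that] k by (subst ennreal_mult[symmetric]) (auto simp: field_simps)
    then have "1 * F (\<theta> x) \<le> (ennreal (1 / k) * ennreal (w x)) * F (\<theta> x)" if "x \<in> {a..b}"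
      using that by (intro mult_right_mono) auto
    then show "F (\<theta> x) * indicator {a..b} x \<le> ennreal (1 / k) * (F (\<theta> x) * ennreal (w x) * indicator {a..b} x)"
      by (auto simp: indicator_def mult_ac)
  qed
  also have "\<dots> = ennreal (1 / k) * (\<integral>\<^sup>+x. F (\<theta> x) * ennreal (w x) * indicator {a..b} x \<partial>lborel)"
  proof (rule nn_integral_cmult)
    have "(\<lambda>x. indicator {a..b} x *\<^sub>R w x) \<in> borel_measurable borel"
      using cont by (intro borel_measurable_continuous_on_indicator) auto
    then have "(\<lambda>x. (F (\<theta> x) * indicator {a..b} x) * ennreal (indicator {a..b} x *\<^sub>R w x)) \<in> borel_measurable lborel"
      using mF by measurable
    moreover have "(\<lambda>x. (F (\<theta> x) * indicator {a..b} x) * ennreal (indicator {a..b} x *\<^sub>R w x))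
        = (\<lambda>x. F (\<theta> x) * ennreal (w x) * indicator {a..b} x)"
      by (auto simp: fun_eq_iff indicator_def)
    ultimately show "(\<lambda>x. F (\<theta> x) * ennreal (w x) * indicator {a..b} x) \<in> borel_measurable lborel"
      by simp
  qed
  also have "(\<integral>\<^sup>+x. F (\<theta> x) * ennreal (w x) * indicator {a..b} x \<partial>lborel)
      = (\<integral>\<^sup>+x\<in>{\<theta> a..\<theta> b}. F x \<partial>lborel)"
    using w k by (intro nn_integral_substitution_aux[symmetric] F deriv cont ab) force+
  also have "\<dots> \<le> ennreal ((\<theta> b - \<theta> a) / pi + 2) * (\<integral>\<^sup>+x\<in>{0..pi}. F x \<partial>lborel)"
    using len by (intro nn_integral_periodic_le F per) auto
  also have "\<dots> \<le> ennreal (K * (b - a) / pi + 2) * (\<integral>\<^sup>+x\<in>{0..pi}. F x \<partial>lborel)"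
    using len by (intro mult_right_mono ennreal_leI add_mono divide_right_mono) auto
  finally have "(\<integral>\<^sup>+x\<in>{a..b}. F (\<theta> x) \<partial>lborel)
      \<le> ennreal (1 / k) * (ennreal (K * (b - a) / pi + 2) * (\<integral>\<^sup>+x\<in>{0..pi}. F x \<partial>lborel))"
    by (simp add: mult_left_mono)
  also have "\<dots> = ennreal (1 / k * (K * (b - a) / pi + 2)) * (\<integral>\<^sup>+x\<in>{0..pi}. F x \<partial>lborel)"
    using k K ab by (subst ennreal_mult) (auto simp: mult.assoc)
  finally show ?thesis .
qed

text \<open>The increasing case is applied to \<open>- \<theta>\<close> and to the reflected
  function; the substitution of \<open>pi - x\<close> for \<open>x\<close>, together with the period
  \<open>pi\<close>, brings back the integral of \<open>F\<close>.\<close>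

lemma nn_integral_angle_le_neg:
  fixes F :: "real \<Rightarrow> ennreal" and \<theta> w :: "real \<Rightarrow> real"
  assumes F [measurable]: "F \<in> borel_measurable borel" and per: "\<And>x. F (x + pi) = F x"
    and deriv: "\<And>x. x \<in> {a..b} \<Longrightarrow> (\<theta> has_real_derivative w x) (at x)"
    and cont: "continuous_on {a..b} w" and ab: "a < b" and k: "k > 0"
    and w: "\<And>x. x \<in> {a..b} \<Longrightarrow> k \<le> - w x \<and> - w x \<le> K"
  shows "(\<integral>\<^sup>+x\<in>{a..b}. F (\<theta> x) \<partial>lborel)
    \<le> ennreal (1 / k * (K * (b - a) / pi + 2)) * (\<integral>\<^sup>+x\<in>{0..pi}. F x \<partial>lborel)"
proof -
  have "(\<integral>\<^sup>+x\<in>{a..b}. F (- (- \<theta> x)) \<partial>lborel)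
      \<le> ennreal (1 / k * (K * (b - a) / pi + 2)) * (\<integral>\<^sup>+x\<in>{0..pi}. F (- x) \<partial>lborel)"
  proof (rule nn_integral_angle_le_pos[where w = "\<lambda>x. - w x" and \<theta> = "\<lambda>x. - \<theta> x" and F = "\<lambda>x. F (- x)"])
    show "F (- (x + pi)) = F (- x)" for x
      using per[of "- x - pi"] by simp
    show "((\<lambda>x. - \<theta> x) has_real_derivative - w x) (at x)" if "x \<in> {a..b}" for x
      using deriv[OF that] by (rule DERIV_minus)
  qed (use assms in \<open>auto intro!: continuous_intros\<close>)
  also have "(\<integral>\<^sup>+x\<in>{0..pi}. F (- x) \<partial>lborel) = (\<integral>\<^sup>+x. F (- (pi - x)) * indicator {0..pi} (pi - x) \<partial>lborel)"
    by (subst nn_integral_real_affine[where c = "-1" and t = pi]) auto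
  also have "\<dots> = (\<integral>\<^sup>+x\<in>{0..pi}. F x \<partial>lborel)"
  proof (intro nn_integral_cong)
    fix x
    show "F (- (pi - x)) * indicator {0..pi} (pi - x) = F x * indicator {0..pi} x"
      using per[of "x - pi"] by (auto simp: indicator_def)
  qed
  finally show ?thesis by simp
qed

lemma nonzero_constant_sign:
  fixes w :: "real \<Rightarrow> real"
  assumes "continuous_on {a..b} w" "\<And>x. x \<in> {a..b} \<Longrightarrow> w x \<noteq> 0"
  shows "(\<forall>x\<in>{a..b}. w x > 0) \<or> (\<forall>x\<in>{a..b}. w x < 0)"
proof (rule ccontr)
  assume "\<not> ?thesis"
  then obtain x y where xy: "x \<in> {a..b}" "y \<in> {a..b}" "w x \<le> 0" "w y \<ge> 0"
    by (meson linorder_not_less)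
  have "connected (w ` {a..b})"
    using assms(1) by (rule connected_continuous_image) simp
  then have "0 \<in> w ` {a..b}"
    using xy connectedD_interval[of "w ` {a..b}" "w x" "w y" 0] by blast
  then show False
    using assms(2) by force
qed

text \<open>The angular velocity \<open>w\<close> is the determinant divided by
  \<open>(norm g)^2\<close>, so its absolute value lies between \<open>C^-3\<close> and
  \<open>C^3\<close>, and by continuity its sign is constant on compact subintervals. The factor
  \<open>C^4\<close> is \<open>C\<close> from the length of \<open>g\<close> times
  \<open>C^3\<close> from the reciprocal of the angular velocity. Since \<open>polar_angle\<close>
  gives an angle only on compact subintervals, the open interval is exhausted by them, with a bound
  that does not depend on the subinterval.\<close>

lemma proj_length_along_curve:
  fixes g g' :: "real \<Rightarrow> real^2"
  assumes K: "compact K" and C: "C \<ge> 1"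
    and deriv: "\<And>x. x \<in> {s<..<t} \<Longrightarrow> (g has_vector_derivative g' x) (at x)"
    and cont: "continuous_on {s<..<t} g'" and st: "s < t"
    and norm: "\<And>x. x \<in> {s<..<t} \<Longrightarrow> 1 / C \<le> norm (g x) \<and> norm (g x) \<le> C"
    and det: "\<And>x. x \<in> {s<..<t} \<Longrightarrow> 1 / C \<le> \<bar>g x $ 1 * g' x $ 2 - g x $ 2 * g' x $ 1\<bar> \<and>
        \<bar>g x $ 1 * g' x $ 2 - g x $ 2 * g' x $ 1\<bar> \<le> C"
  shows "(\<integral>\<^sup>+x\<in>{s<..<t}. proj_length K (g x) \<partial>lborel)
    \<le> ennreal (C ^ 4 * (C ^ 3 * (t - s) / pi + 2)) * Fav K" (is "_ \<le> ?rhs")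
proof -
  note [measurable] = measurable_proj_length[OF K]
  define F where "F \<theta> = proj_length K (unit_vec \<theta>)" for \<theta>
  have F [measurable]: "F \<in> borel_measurable borel"
    unfolding F_def[abs_def] by measurable
  \<comment> \<open>Opposite directions give reflected projections. Hence the period is
    \<open>pi\<close>, and \<open>Fav K\<close> is the integral over exactly one period.\<close>
  have per: "F (x + pi) = F x" for x
  proof -
    have "unit_vec (x + pi) = (-1) *\<^sub>R unit_vec x"
      by (simp add: unit_vec_def vec_eq_iff forall_2)
    then show ?thesis
      by (simp only: F_def proj_length_scaleR[OF K]) simp
  qed
  have FavF: "Fav K = (\<integral>\<^sup>+x\<in>{0..pi}. F x \<partial>lborel)"
    by (simp add: F_def Fav_eq[OF K])
  have nz: "g x \<noteq> 0" if "x \<in> {s<..<t}" for x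
    using norm[OF that] C by (auto simp: divide_le_0_iff)
  have cg: "continuous_on {s<..<t} g"
    by (intro continuous_at_imp_continuous_on ballI has_vector_derivative_continuous[OF deriv])
  define w where "w x = (g x $ 1 * g' x $ 2 - g x $ 2 * g' x $ 1) / (norm (g x))\<^sup>2" for x
  have cw: "continuous_on {s<..<t} w"
    unfolding w_def using nz by (intro continuous_intros cg cont) auto
  have bw: "1 / C ^ 3 \<le> \<bar>w x\<bar> \<and> \<bar>w x\<bar> \<le> C ^ 3" if "x \<in> {s<..<t}" for x
  proof -
    let ?d = "\<bar>g x $ 1 * g' x $ 2 - g x $ 2 * g' x $ 1\<bar>"
    have n: "(1 / C)\<^sup>2 \<le> (norm (g x))\<^sup>2" "(norm (g x))\<^sup>2 \<le> C\<^sup>2" "(norm (g x))\<^sup>2 > 0"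
      using norm[OF that] nz[OF that] C by (auto intro!: power_mono)
    have "1 / C / C\<^sup>2 \<le> ?d / (norm (g x))\<^sup>2" "?d / (norm (g x))\<^sup>2 \<le> C / (1 / C)\<^sup>2"
      using det[OF that] n C by (intro frac_le; simp)+
    then show ?thesis
      by (simp add: w_def power2_eq_square power3_eq_cube mult.assoc)
  qed
  have compact_bound: "(\<integral>\<^sup>+x\<in>{a..b}. proj_length K (g x) \<partial>lborel) \<le> ?rhs"
    if ab: "s < a" "a < b" "b < t" for a b
  proof -
    have sub: "{a..b} \<subseteq> {s<..<t}"
      using ab by auto
    obtain \<theta> p where \<theta>: "\<And>x. x \<in> {a..b} \<Longrightarrow> (\<theta> has_real_derivative w x) (at x)"
      and p: "\<And>x. x \<in> {a..b} \<Longrightarrow> g x = p x *\<^sub>R unit_vec (\<theta> x)"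
      using polar_angle[OF deriv nz cont ab] unfolding w_def by blast
    have abs_p: "\<bar>p x\<bar> \<le> C" if "x \<in> {a..b}" for x
    proof -
      have "norm (unit_vec (\<theta> x)) = 1"
        by (simp add: unit_vec_def norm_vec_def L2_set_def sum_2)
      then have "norm (g x) = \<bar>p x\<bar>"
        by (subst p[OF that]) simp
      then show ?thesis
        using norm[of x] that sub by auto
    qed
    have cw': "continuous_on {a..b} w"
      using cw sub continuous_on_subset by blast
    have C3: "1 / C ^ 3 > 0"
      using C by simp
    have "w x \<noteq> 0" if "x \<in> {a..b}" for x
      using bw[of x] that sub C3 by auto
    then consider "\<forall>x\<in>{a..b}. w x > 0" | "\<forall>x\<in>{a..b}. w x < 0"
      using nonzero_constant_sign[OF cw'] by blast
    then have main: "(\<integral>\<^sup>+x\<in>{a..b}. F (\<theta> x) \<partial>lborel)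
        \<le> ennreal (1 / (1 / C ^ 3) * (C ^ 3 * (b - a) / pi + 2)) * (\<integral>\<^sup>+x\<in>{0..pi}. F x \<partial>lborel)"
    proof cases
      case 1
      show ?thesis
      proof (rule nn_integral_angle_le_pos[OF F per \<theta> cw' ab(2) C3])
        show "1 / C ^ 3 \<le> w x \<and> w x \<le> C ^ 3" if "x \<in> {a..b}" for x
          using bw[of x] 1[rule_format, OF that] that sub by auto
      qed
    next
      case 2
      show ?thesis
      proof (rule nn_integral_angle_le_neg[OF F per \<theta> cw' ab(2) C3])
        show "1 / C ^ 3 \<le> - w x \<and> - w x \<le> C ^ 3" if "x \<in> {a..b}" for x
          using bw[of x] 2[rule_format, OF that] that sub by auto
      qed
    qed
    have c\<theta>: "continuous_on {a..b} \<theta>"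
      using \<theta> by (intro continuous_at_imp_continuous_on ballI DERIV_isCont)
    have mF: "(\<lambda>x. F (\<theta> x) * indicator {a..b} x) \<in> borel_measurable lborel"
      by (rule measurable_compose_continuous_on[OF F c\<theta>]) simp
    have "(\<integral>\<^sup>+x\<in>{a..b}. proj_length K (g x) \<partial>lborel)
        \<le> (\<integral>\<^sup>+x. ennreal C * (F (\<theta> x) * indicator {a..b} x) \<partial>lborel)"
    proof (intro nn_integral_mono)
      fix x
      have "proj_length K (g x) \<le> ennreal C * F (\<theta> x)" if "x \<in> {a..b}"
        unfolding p[OF that] proj_length_scaleR[OF K] F_def
        using abs_p[OF that] by (intro mult_right_mono ennreal_leI) auto
      then show "proj_length K (g x) * indicator {a..b} x \<le> ennreal C * (F (\<theta> x) * indicator {a..b} x)"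
        by (auto simp: indicator_def)
    qed
    also have "\<dots> = ennreal C * (\<integral>\<^sup>+x\<in>{a..b}. F (\<theta> x) \<partial>lborel)"
      by (rule nn_integral_cmult[OF mF])
    also have "\<dots> \<le> ennreal C * (ennreal (C ^ 3 * (C ^ 3 * (b - a) / pi + 2)) * Fav K)"
      using main unfolding FavF by (intro mult_left_mono) auto
    also have "\<dots> \<le> ennreal C * (ennreal (C ^ 3 * (C ^ 3 * (t - s) / pi + 2)) * Fav K)"
      using C ab by (intro mult_left_mono mult_right_mono ennreal_leI add_right_mono divide_right_mono) auto
    also have "\<dots> = ennreal (C * (C ^ 3 * (C ^ 3 * (t - s) / pi + 2))) * Fav K"
      using C st by (subst ennreal_mult) (auto simp: mult.assoc)
    also have "C * (C ^ 3 * (C ^ 3 * (t - s) / pi + 2)) = C ^ 4 * (C ^ 3 * (t - s) / pi + 2)"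
      by (simp add: eval_nat_numeral)
    finally show ?thesis .
  qed
  define d where "d = (t - s) / 2"
  have d: "d > 0"
    using st by (simp add: d_def)
  \<comment> \<open>With \<open>n + 1\<close> in place of \<open>n + 2\<close> the first interval
    would shrink to a point, whereas \<open>compact_bound\<close> needs
    \<open>a < b\<close>.\<close>
  define A where "A n = {s + d / real (n + 2)..t - d / real (n + 2)}" for n
  have small: "0 < d / real (n + 2)" "d / real (n + 2) < d" for n
  proof -
    show "0 < d / real (n + 2)"
      using d by simp
    have "d * 1 < d * real (n + 2)"
      using d by (intro mult_strict_left_mono) auto
    then show "d / real (n + 2) < d"
      by (simp add: divide_less_eq)
  qed
  have td: "t - s = 2 * d"
    by (simp add: d_def)
  have ends: "s < s + d / real (n + 2)" "s + d / real (n + 2) < t - d / real (n + 2)" "t - d / real (n + 2) < t" for n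
    using small[of n] td by linarith+
  have UN: "{s<..<t} = (\<Union>n. A n)"
  proof
    show "(\<Union>n. A n) \<subseteq> {s<..<t}"
    proof
      fix x assume "x \<in> (\<Union>n. A n)"
      then obtain n where "s + d / real (n + 2) \<le> x" "x \<le> t - d / real (n + 2)"
        by (auto simp: A_def)
      then show "x \<in> {s<..<t}"
        using ends[of n] unfolding greaterThanLessThan_iff by linarith
    qed
    show "{s<..<t} \<subseteq> (\<Union>n. A n)"
    proof
      fix x assume x: "x \<in> {s<..<t}"
      then have "min (x - s) (t - x) > 0" by simp
      then obtain n where n: "d / min (x - s) (t - x) < real n"
        using reals_Archimedean2 by blast
      then have "d < real n * min (x - s) (t - x)"
        using \<open>min (x - s) (t - x) > 0\<close> by (simp only: divide_less_eq if_True)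
      also have "\<dots> \<le> min (x - s) (t - x) * real (n + 2)"
        using \<open>min (x - s) (t - x) > 0\<close> by (subst mult.commute, intro mult_left_mono) auto
      finally have "d / real (n + 2) \<le> min (x - s) (t - x)"
        by (simp only: divide_le_eq of_nat_0_less_iff) simp
      then show "x \<in> (\<Union>n. A n)"
        by (intro UN_I[of n]) (auto simp: A_def)
    qed
  qed
  have inc: "incseq A"
  proof (rule incseq_SucI)
    fix n
    have "d / real (Suc n + 2) \<le> d / real (n + 2)"
      using d by (intro divide_left_mono) auto
    then show "A n \<subseteq> A (Suc n)"
      by (auto simp: A_def)
  qed
  have mg: "(\<lambda>x. proj_length K (g x) * indicator (A n) x) \<in> borel_measurable lborel" for n
  proof (rule measurable_compose_continuous_on)
    show "continuous_on (A n) g"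
      using cg UN by (auto intro: continuous_on_subset)
  qed (auto simp: A_def)
  have "(\<integral>\<^sup>+x\<in>{s<..<t}. proj_length K (g x) \<partial>lborel)
      \<le> (\<integral>\<^sup>+x. (SUP n. proj_length K (g x) * indicator (A n) x) \<partial>lborel)"
    unfolding UN by (intro nn_integral_mono) (auto simp: indicator_def intro: SUP_upper2)
  also have "\<dots> = (SUP n. (\<integral>\<^sup>+x\<in>A n. proj_length K (g x) \<partial>lborel))"
  proof (rule nn_integral_monotone_convergence_SUP[OF _ mg])
    show "incseq (\<lambda>n x. proj_length K (g x) * indicator (A n) x)"
      using inc by (auto simp: incseq_def le_fun_def indicator_def)
  qed
  also have "\<dots> \<le> ?rhs"
    unfolding A_def by (intro SUP_least compact_bound ends)
  finally show ?thesis .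
qed

section \<open>Transversality\<close>

lemma pderiv_at_eq:
  assumes "(f has_derivative f') (at x)"
  shows "pderiv_at i f x = f' (axis i 1)"
proof -
  interpret f': bounded_linear f'
    using assms by (rule has_derivative_bounded_linear)
  have "((\<lambda>t. f (x + t *\<^sub>R axis i 1)) has_derivative (\<lambda>t. f' (t *\<^sub>R axis i 1))) (at 0)"
  proof (rule has_derivative_compose[where g = f and f = "\<lambda>t. x + t *\<^sub>R axis i 1" and f' = "\<lambda>t. t *\<^sub>R axis i 1"])
    show "((\<lambda>t. x + t *\<^sub>R axis i 1) has_derivative (\<lambda>t. t *\<^sub>R axis i 1)) (at 0)"
      by (auto intro!: derivative_eq_intros)
  qed (use assms in simp)
  moreover have "(\<lambda>t. f' (t *\<^sub>R axis i 1)) = (*) (f' (axis i 1))"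
    by (auto simp: f'.scaleR)
  ultimately have "((\<lambda>t. f (x + t *\<^sub>R axis i 1)) has_field_derivative f' (axis i 1)) (at 0)"
    by (simp add: has_field_derivative_def)
  then show ?thesis
    unfolding pderiv_at_def by (rule DERIV_imp_deriv)
qed

lemma vec2_expand: "(v :: real^2) = v $ 1 *\<^sub>R axis 1 1 + v $ 2 *\<^sub>R axis 2 1"
  by (simp add: vec_eq_iff forall_2 axis_def)

lemma norm_le_sum2: "norm (v :: real^2) \<le> \<bar>v $ 1\<bar> + \<bar>v $ 2\<bar>"
  using norm_le_l1_cart[of v] by (simp add: sum_2)

lemma mvt_inner:
  fixes f :: "'a::real_inner \<Rightarrow> real"
  assumes "\<And>z. z \<in> closed_segment y x \<Longrightarrow> (f has_derivative (\<lambda>v. g z \<bullet> v)) (at z)"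
  obtains \<xi> where "\<xi> \<in> closed_segment y x" "f x - f y = g \<xi> \<bullet> (x - y)"
proof -
  have seg: "y + \<tau> *\<^sub>R (x - y) \<in> closed_segment y x" if "0 \<le> \<tau>" "\<tau> \<le> 1" for \<tau>
    using that by (auto simp: in_segment algebra_simps intro!: exI[of _ \<tau>])
  have "\<exists>\<tau>\<in>{0<..<1}. f (y + 1 *\<^sub>R (x - y)) - f (y + 0 *\<^sub>R (x - y))
      = (\<lambda>h. g (y + \<tau> *\<^sub>R (x - y)) \<bullet> (h *\<^sub>R (x - y))) (1 - 0)"
  proof (rule mvt_simple)
    fix \<tau> :: real assume "0 \<le> \<tau>" "\<tau> \<le> 1"
    have "((\<lambda>\<tau>. y + \<tau> *\<^sub>R (x - y)) has_derivative (\<lambda>h. h *\<^sub>R (x - y))) (at \<tau>)"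
      by (auto intro!: derivative_eq_intros)
    from has_derivative_compose[OF this assms[OF seg[OF \<open>0 \<le> \<tau>\<close> \<open>\<tau> \<le> 1\<close>]]]
    show "((\<lambda>\<tau>. f (y + \<tau> *\<^sub>R (x - y))) has_derivative (\<lambda>h. g (y + \<tau> *\<^sub>R (x - y)) \<bullet> (h *\<^sub>R (x - y))))
        (at \<tau> within {0..1})"
      by (rule has_derivative_at_withinI)
  qed simp
  then obtain \<tau> where "\<tau> \<in> {0<..<1}" "f x - f y = g (y + \<tau> *\<^sub>R (x - y)) \<bullet> (x - y)"
    by auto
  then show ?thesis
    using that[of "y + \<tau> *\<^sub>R (x - y)"] seg[of \<tau>] by auto
qed

text \<open>The geometric content of the hypotheses, freed from iterated \<open>deriv\<close>:
  \<open>G\<close> is the spatial gradient and \<open>G'\<close> its derivative in the parameter.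
  Second spatial derivatives enter only through \<open>G_lipschitz\<close>, stated for segments
  inside \<open>U\<close> because \<open>U\<close> need not be convex.\<close>

locale transversal_family =
  fixes s t C :: real and U :: "(real^2) set" and \<Phi> :: "real \<Rightarrow> real^2 \<Rightarrow> real"
    and G G' :: "real \<Rightarrow> real^2 \<Rightarrow> real^2"
  assumes st: "s < t" and open_U: "open U" and C: "C \<ge> 1"
    and Phi_cont: "continuous_on ({s<..<t} \<times> U) (\<lambda>(\<alpha>, x). \<Phi> \<alpha> x)"
    and Phi_deriv: "\<And>\<alpha> x. \<alpha> \<in> {s<..<t} \<Longrightarrow> x \<in> U \<Longrightarrow> (\<Phi> \<alpha> has_derivative (\<lambda>v. G \<alpha> x \<bullet> v)) (at x)"
    and G_norm: "\<And>\<alpha> x. \<alpha> \<in> {s<..<t} \<Longrightarrow> x \<in> U \<Longrightarrow> 1 / C \<le> norm (G \<alpha> x) \<and> norm (G \<alpha> x) \<le> C"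
    and G_lipschitz: "\<And>\<alpha> x y. \<alpha> \<in> {s<..<t} \<Longrightarrow> closed_segment y x \<subseteq> U \<Longrightarrow>
          norm (G \<alpha> x - G \<alpha> y) \<le> 4 * C * norm (x - y)"
    and G_deriv: "\<And>\<alpha> x. \<alpha> \<in> {s<..<t} \<Longrightarrow> x \<in> U \<Longrightarrow>
          ((\<lambda>\<beta>. G \<beta> x) has_vector_derivative G' \<alpha> x) (at \<alpha>)"
    and G_cont: "continuous_on ({s<..<t} \<times> U) (\<lambda>(\<alpha>, x). G \<alpha> x)"
    and G'_cont: "continuous_on ({s<..<t} \<times> U) (\<lambda>(\<alpha>, x). G' \<alpha> x)"
    and det: "\<And>\<alpha> x. \<alpha> \<in> {s<..<t} \<Longrightarrow> x \<in> U \<Longrightarrow>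
          1 / C \<le> \<bar>G \<alpha> x $ 1 * G' \<alpha> x $ 2 - G \<alpha> x $ 2 * G' \<alpha> x $ 1\<bar> \<and>
          \<bar>G \<alpha> x $ 1 * G' \<alpha> x $ 2 - G \<alpha> x $ 2 * G' \<alpha> x $ 1\<bar> \<le> C"

text \<open>The second derivative on the product space contains both the Hessian in \<open>x\<close>
  and the mixed derivatives; they are extracted by inserting the directions \<open>(0, v)\<close>
  and \<open>(1, 0)\<close>. The constant \<open>4 * C\<close> is \<open>2 * C\<close> for each of
  the two gradient components, as a row of the Hessian has two entries bounded by
  \<open>C\<close>.\<close>

lemma transversal_family_of_C2:
  fixes \<Phi> :: "real \<Rightarrow> real^2 \<Rightarrow> real"
  assumes st: "s < t" and U: "open U"
    and C2: "C2_on ({s<..<t} \<times> U) (\<lambda>(\<alpha>, x). \<Phi> \<alpha> x)"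
    and C: "C \<ge> 1"
    and grad: "\<And>\<alpha> x. \<alpha> \<in> {s<..<t} \<Longrightarrow> x \<in> U \<Longrightarrow>
          1 / C \<le> norm (grad (\<Phi> \<alpha>) x) \<and> norm (grad (\<Phi> \<alpha>) x) \<le> C"
    and hess: "\<And>\<alpha> x i j. \<alpha> \<in> {s<..<t} \<Longrightarrow> x \<in> U \<Longrightarrow> \<bar>pderiv_at i (pderiv_at j (\<Phi> \<alpha>)) x\<bar> \<le> C"
    and det: "\<And>\<alpha> x. \<alpha> \<in> {s<..<t} \<Longrightarrow> x \<in> U \<Longrightarrow>
          1 / C \<le> \<bar>det (transversality_matrix \<Phi> \<alpha> x)\<bar> \<and> \<bar>det (transversality_matrix \<Phi> \<alpha> x)\<bar> \<le> C"
  obtains G' where "transversal_family s t C U \<Phi> (\<lambda>\<alpha>. grad (\<Phi> \<alpha>)) G'"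
proof -
  let ?I = "{s<..<t}"
  obtain f' :: "real \<times> (real^2) \<Rightarrow> (real \<times> (real^2)) \<Rightarrow>\<^sub>L real" and f''
    where f': "\<And>z. z \<in> ?I \<times> U \<Longrightarrow> ((\<lambda>(\<alpha>, x). \<Phi> \<alpha> x) has_derivative blinfun_apply (f' z)) (at z)"
      and f'': "\<And>z. z \<in> ?I \<times> U \<Longrightarrow> (f' has_derivative blinfun_apply (f'' z)) (at z)"
      and cf'': "continuous_on (?I \<times> U) f''"
    using C2 unfolding C2_on_def by blast
  define P where "P j z = blinfun_apply (f' z) (0, axis j 1)" for j z
  define P' where "P' j z h = blinfun_apply (blinfun_apply (f'' z) h) (0, axis j 1)" for j z h
  have P': "(P j has_derivative P' j z) (at z)" if "z \<in> ?I \<times> U" for j z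
    unfolding P_def[abs_def] P'_def[abs_def]
    by (rule bounded_linear.has_derivative[OF blinfun.bounded_linear_left f''[OF that]])
  have lin: "linear (P' j z)" if "z \<in> ?I \<times> U" for j z
    using P'[OF that] has_derivative_linear by blast
  have dx: "(\<Phi> \<alpha> has_derivative (\<lambda>v. blinfun_apply (f' (\<alpha>, x)) (0, v))) (at x)"
    if "\<alpha> \<in> ?I" "x \<in> U" for \<alpha> x
  proof -
    have "((\<lambda>x. (\<alpha>, x)) has_derivative (\<lambda>v. (0, v))) (at x)"
      by (auto intro!: derivative_eq_intros)
    from has_derivative_compose[OF this f'[of "(\<alpha>, x)"]] that show ?thesis
      by simp
  qed
  have pd: "pderiv_at j (\<Phi> \<alpha>) x = P j (\<alpha>, x)" if "\<alpha> \<in> ?I" "x \<in> U" for j \<alpha> x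
    using pderiv_at_eq[OF dx[OF that]] by (simp add: P_def)
  have G: "grad (\<Phi> \<alpha>) x $ j = P j (\<alpha>, x)" if "\<alpha> \<in> ?I" "x \<in> U" for j \<alpha> x
    using pd[OF that] by (simp add: grad_def)
  have Px: "((\<lambda>x. P j (\<alpha>, x)) has_derivative (\<lambda>v. P' j (\<alpha>, x) (0, v))) (at x)"
    if "\<alpha> \<in> ?I" "x \<in> U" for j \<alpha> x
  proof -
    have "((\<lambda>x. (\<alpha>, x)) has_derivative (\<lambda>v. (0, v))) (at x)"
      by (auto intro!: derivative_eq_intros)
    from has_derivative_compose[OF this P'[of "(\<alpha>, x)"]] that show ?thesis
      by simp
  qed
  have P\<alpha>: "((\<lambda>\<beta>. P j (\<beta>, x)) has_real_derivative P' j (\<alpha>, x) (1, 0)) (at \<alpha>)"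
    if "\<alpha> \<in> ?I" "x \<in> U" for j \<alpha> x
  proof -
    have "((\<lambda>\<beta>. (\<beta>, x)) has_derivative (\<lambda>h. (h, 0))) (at \<alpha>)"
      by (auto intro!: derivative_eq_intros)
    from has_derivative_compose[OF this P'[of "(\<alpha>, x)"]] that
    have "((\<lambda>\<beta>. P j (\<beta>, x)) has_derivative (\<lambda>h. P' j (\<alpha>, x) (h, 0))) (at \<alpha>)"
      by simp
    moreover have "(\<lambda>h. P' j (\<alpha>, x) (h, 0)) = (*) (P' j (\<alpha>, x) (1, 0))"
    proof
      show "P' j (\<alpha>, x) (h, 0) = P' j (\<alpha>, x) (1, 0) * h" for h
        using linear_scale[OF lin, of "(\<alpha>, x)" j h "(1, 0)"] that by (simp add: mult.commute)
    qed
    ultimately show ?thesis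
      by (simp only: has_field_derivative_def)
  qed
  have gd: "((\<lambda>x. grad (\<Phi> \<alpha>) x $ j) has_derivative (\<lambda>v. P' j (\<alpha>, x) (0, v))) (at x)"
    if "\<alpha> \<in> ?I" "x \<in> U" for j \<alpha> x
    by (rule has_derivative_transform_within_open[OF Px[OF that] U]) (use that G in auto)
  have hess': "\<bar>P' j (\<alpha>, x) (0, axis i 1)\<bar> \<le> C" if "\<alpha> \<in> ?I" "x \<in> U" for i j \<alpha> x
  proof -
    have "(pderiv_at j (\<Phi> \<alpha>) has_derivative (\<lambda>v. P' j (\<alpha>, x) (0, v))) (at x)"
      using gd[OF that, of j] by (simp add: grad_def)
    from pderiv_at_eq[OF this, of i] show ?thesis
      using hess[OF that, of i j] by simp
  qed
  have hess_v: "\<bar>P' j (\<alpha>, x) (0, v)\<bar> \<le> 2 * C * norm v" if "\<alpha> \<in> ?I" "x \<in> U" for j \<alpha> x v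
  proof -
    have "(0, v) = v $ 1 *\<^sub>R (0, axis 1 1) + v $ 2 *\<^sub>R (0 :: real, axis 2 1 :: real^2)"
      by (simp add: vec_eq_iff forall_2 axis_def)
    then have "P' j (\<alpha>, x) (0, v) = v $ 1 * P' j (\<alpha>, x) (0, axis 1 1) + v $ 2 * P' j (\<alpha>, x) (0, axis 2 1)"
      using lin[of "(\<alpha>, x)" j] that by (simp only: linear_add linear_scale mem_Sigma_iff) simp
    also have "\<bar>\<dots>\<bar> \<le> \<bar>v $ 1\<bar> * \<bar>P' j (\<alpha>, x) (0, axis 1 1)\<bar> + \<bar>v $ 2\<bar> * \<bar>P' j (\<alpha>, x) (0, axis 2 1)\<bar>"
      by (rule order_trans[OF abs_triangle_ineq]) (simp add: abs_mult)
    also have "\<dots> \<le> norm v * C + norm v * C"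
      by (intro add_mono mult_mono hess' that component_le_norm_cart) auto
    finally show ?thesis by simp
  qed
  define G' where "G' \<alpha> x = P' 1 (\<alpha>, x) (1, 0) *\<^sub>R axis 1 1 + P' 2 (\<alpha>, x) (1, 0) *\<^sub>R (axis 2 1 :: real^2)" for \<alpha> x
  have G'12: "G' \<alpha> x $ 1 = P' 1 (\<alpha>, x) (1, 0)" "G' \<alpha> x $ 2 = P' 2 (\<alpha>, x) (1, 0)" for \<alpha> x
    by (simp_all add: G'_def axis_def)
  have G_expand: "grad (\<Phi> \<alpha>) x = P 1 (\<alpha>, x) *\<^sub>R axis 1 1 + P 2 (\<alpha>, x) *\<^sub>R axis 2 1"
    if "\<alpha> \<in> ?I" "x \<in> U" for \<alpha> x
    using vec2_expand[of "grad (\<Phi> \<alpha>) x"] G[OF that] by simp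
  have cP: "continuous_on (?I \<times> U) (P j)" for j
    using P' by (intro continuous_at_imp_continuous_on ballI has_derivative_continuous)
  have cP': "continuous_on (?I \<times> U) (\<lambda>z. P' j z h)" for j h
    unfolding P'_def by (intro continuous_intros cf'')
  have "transversal_family s t C U \<Phi> (\<lambda>\<alpha>. grad (\<Phi> \<alpha>)) G'"
  proof
    show "continuous_on (?I \<times> U) (\<lambda>(\<alpha>, x). \<Phi> \<alpha> x)"
      using f' by (intro continuous_at_imp_continuous_on ballI has_derivative_continuous)
    show "continuous_on (?I \<times> U) (\<lambda>(\<alpha>, x). grad (\<Phi> \<alpha>) x)"
    proof (rule continuous_on_eq)
      show "continuous_on (?I \<times> U) (\<lambda>z. P 1 z *\<^sub>R axis 1 1 + P 2 z *\<^sub>R (axis 2 1 :: real^2))"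
        by (intro continuous_intros cP)
    qed (auto simp: G_expand)
    show "continuous_on (?I \<times> U) (\<lambda>(\<alpha>, x). G' \<alpha> x)"
    proof (rule continuous_on_eq)
      show "continuous_on (?I \<times> U) (\<lambda>z. P' 1 z (1, 0) *\<^sub>R axis 1 1 + P' 2 z (1, 0) *\<^sub>R (axis 2 1 :: real^2))"
        by (intro continuous_intros cP')
    qed (auto simp: G'_def)
  next
    fix \<alpha> x assume ax: "\<alpha> \<in> ?I" "x \<in> U"
    show "(\<Phi> \<alpha> has_derivative (\<lambda>v. grad (\<Phi> \<alpha>) x \<bullet> v)) (at x)"
    proof -
      have "blinfun_apply (f' (\<alpha>, x)) (0, v) = grad (\<Phi> \<alpha>) x \<bullet> v" for v
      proof -
        have "(0, v) = v $ 1 *\<^sub>R (0, axis 1 1) + v $ 2 *\<^sub>R (0 :: real, axis 2 1 :: real^2)"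
          by (simp add: vec_eq_iff forall_2 axis_def)
        then have "blinfun_apply (f' (\<alpha>, x)) (0, v) = v $ 1 * P 1 (\<alpha>, x) + v $ 2 * P 2 (\<alpha>, x)"
          unfolding P_def by (simp only: blinfun.add_right blinfun.scaleR_right) simp
        then show ?thesis
          using G[OF ax] by (simp add: inner_vec_def sum_2 mult.commute)
      qed
      then show ?thesis
        using dx[OF ax] by simp
    qed
    show "((\<lambda>\<beta>. grad (\<Phi> \<beta>) x) has_vector_derivative G' \<alpha> x) (at \<alpha>)"
    proof (rule has_vector_derivative_transform_within_open)
      have scale: "((\<lambda>\<beta>. P j (\<beta>, x) *\<^sub>R c) has_vector_derivative P' j (\<alpha>, x) (1, 0) *\<^sub>R c) (at \<alpha>)"
        for j and c :: "real^2"
        using bounded_linear.has_vector_derivative[OF bounded_linear_scaleR_left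
            P\<alpha>[OF ax, unfolded has_real_derivative_iff_has_vector_derivative]] .
      show "((\<lambda>\<beta>. P 1 (\<beta>, x) *\<^sub>R axis 1 1 + P 2 (\<beta>, x) *\<^sub>R axis 2 1) has_vector_derivative G' \<alpha> x) (at \<alpha>)"
        unfolding G'_def by (intro has_vector_derivative_add scale)
      show "open ?I" by simp
    qed (use ax G_expand in auto)
    have "det (transversality_matrix \<Phi> \<alpha> x)
        = grad (\<Phi> \<alpha>) x $ 1 * G' \<alpha> x $ 2 - grad (\<Phi> \<alpha>) x $ 2 * G' \<alpha> x $ 1"
    proof -
      have "deriv (\<lambda>\<beta>. pderiv_at j (\<Phi> \<beta>) x) \<alpha> = P' j (\<alpha>, x) (1, 0)" for j
      proof (rule DERIV_imp_deriv)
        show "((\<lambda>\<beta>. pderiv_at j (\<Phi> \<beta>) x) has_real_derivative P' j (\<alpha>, x) (1, 0)) (at \<alpha>)"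
          by (rule has_field_derivative_transform_within_open[OF P\<alpha>[OF ax], where S = ?I]) (use ax pd in auto)
      qed
      then show ?thesis
        by (simp add: transversality_matrix_def det_2 G'12 G[OF ax] pd[OF ax] mult.commute)
    qed
    then show "1 / C \<le> \<bar>grad (\<Phi> \<alpha>) x $ 1 * G' \<alpha> x $ 2 - grad (\<Phi> \<alpha>) x $ 2 * G' \<alpha> x $ 1\<bar> \<and>
          \<bar>grad (\<Phi> \<alpha>) x $ 1 * G' \<alpha> x $ 2 - grad (\<Phi> \<alpha>) x $ 2 * G' \<alpha> x $ 1\<bar> \<le> C"
      using det[OF ax] by simp
  next
    fix \<alpha> x y assume a: "\<alpha> \<in> ?I" and seg: "closed_segment y x \<subseteq> U"
    have comp: "\<bar>grad (\<Phi> \<alpha>) x $ j - grad (\<Phi> \<alpha>) y $ j\<bar> \<le> 2 * C * norm (x - y)" for j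
      unfolding real_norm_def[symmetric]
    proof (rule differentiable_bound[where S = "closed_segment y x"])
      show "((\<lambda>x. grad (\<Phi> \<alpha>) x $ j) has_derivative (\<lambda>v. P' j (\<alpha>, z) (0, v))) (at z within closed_segment y x)"
        if "z \<in> closed_segment y x" for z
        by (rule has_derivative_at_withinI[OF gd[OF a]]) (use that seg in blast)
      show "onorm (\<lambda>v. P' j (\<alpha>, z) (0, v)) \<le> 2 * C" if "z \<in> closed_segment y x" for z
        using that seg by (intro onorm_le) (auto intro!: hess_v a)
    qed auto
    have "norm (grad (\<Phi> \<alpha>) x - grad (\<Phi> \<alpha>) y)
        \<le> \<bar>grad (\<Phi> \<alpha>) x $ 1 - grad (\<Phi> \<alpha>) y $ 1\<bar> + \<bar>grad (\<Phi> \<alpha>) x $ 2 - grad (\<Phi> \<alpha>) y $ 2\<bar>"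
      using norm_le_sum2[of "grad (\<Phi> \<alpha>) x - grad (\<Phi> \<alpha>) y"] by simp
    also have "\<dots> \<le> 2 * C * norm (x - y) + 2 * C * norm (x - y)"
      by (intro add_mono comp)
    finally show "norm (grad (\<Phi> \<alpha>) x - grad (\<Phi> \<alpha>) y) \<le> 4 * C * norm (x - y)"
      by simp
  qed (use st U C grad in auto)
  then show ?thesis
    using that by blast
qed

section \<open>Mean value estimates and transversality near a point\<close>

context transversal_family
begin

lemma Phi_mvt:
  assumes "\<alpha> \<in> {s<..<t}" "closed_segment y x \<subseteq> U"
  obtains \<xi> where "\<xi> \<in> closed_segment y x" "\<Phi> \<alpha> x - \<Phi> \<alpha> y = G \<alpha> \<xi> \<bullet> (x - y)"
  using mvt_inner[of y x "\<Phi> \<alpha>" "G \<alpha>"] Phi_deriv[OF assms(1)] assms(2) by blast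

lemma Phi_lipschitz:
  assumes "\<alpha> \<in> {s<..<t}" "closed_segment y x \<subseteq> U"
  shows "\<bar>\<Phi> \<alpha> x - \<Phi> \<alpha> y\<bar> \<le> C * norm (x - y)"
proof -
  obtain \<xi> where \<xi>: "\<xi> \<in> closed_segment y x" "\<Phi> \<alpha> x - \<Phi> \<alpha> y = G \<alpha> \<xi> \<bullet> (x - y)"
    using Phi_mvt[OF assms] .
  have "\<bar>G \<alpha> \<xi> \<bullet> (x - y)\<bar> \<le> norm (G \<alpha> \<xi>) * norm (x - y)"
    by (rule Cauchy_Schwarz_ineq2)
  also have "\<dots> \<le> C * norm (x - y)"
    using G_norm[OF assms(1), of \<xi>] \<xi> assms(2) by (intro mult_right_mono) auto
  finally show ?thesis
    using \<xi> by simp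
qed

lemma Phi_taylor:
  assumes a: "\<alpha> \<in> {s<..<t}" and seg: "closed_segment y x \<subseteq> U"
  shows "\<bar>\<Phi> \<alpha> x - \<Phi> \<alpha> y - G \<alpha> y \<bullet> (x - y)\<bar> \<le> 4 * C * (norm (x - y))\<^sup>2"
proof -
  obtain \<xi> where \<xi>: "\<xi> \<in> closed_segment y x" "\<Phi> \<alpha> x - \<Phi> \<alpha> y = G \<alpha> \<xi> \<bullet> (x - y)"
    using Phi_mvt[OF a seg] .
  have "closed_segment y \<xi> \<subseteq> U"
    using \<xi>(1) seg by (meson closed_segment_subset convex_closed_segment ends_in_segment(1) order_trans)
  then have "norm (G \<alpha> \<xi> - G \<alpha> y) \<le> 4 * C * norm (\<xi> - y)"
    using G_lipschitz[OF a] by blast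
  also have "\<dots> \<le> 4 * C * norm (x - y)"
    using C segment_bound(1)[OF \<xi>(1)] by (intro mult_left_mono) auto
  finally have "norm (G \<alpha> \<xi> - G \<alpha> y) * norm (x - y) \<le> 4 * C * norm (x - y) * norm (x - y)"
    by (intro mult_right_mono) auto
  moreover have "\<bar>(G \<alpha> \<xi> - G \<alpha> y) \<bullet> (x - y)\<bar> \<le> norm (G \<alpha> \<xi> - G \<alpha> y) * norm (x - y)"
    by (rule Cauchy_Schwarz_ineq2)
  ultimately show ?thesis
    using \<xi>(2) by (simp add: inner_diff_left power2_eq_square)
qed

text \<open>The mean value theorem is used first in space, for the difference of the two functions,
  and then in the parameter at the point found. Separate applications to
  \<open>\<Phi> \<alpha>\<close> and \<open>\<Phi> \<beta>\<close> would give two unrelated points,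
  and their gradients could not be compared through \<open>G'\<close>.\<close>

lemma Phi_diff_mvt:
  assumes a: "\<alpha> \<in> {s<..<t}" "\<beta> \<in> {s<..<t}" "\<beta> < \<alpha>" and seg: "closed_segment y x \<subseteq> U"
  obtains \<gamma> \<xi> where "\<gamma> \<in> {\<beta>..\<alpha>}" "\<xi> \<in> closed_segment y x"
    "(\<Phi> \<alpha> x - \<Phi> \<alpha> y) - (\<Phi> \<beta> x - \<Phi> \<beta> y) = (\<alpha> - \<beta>) * (G' \<gamma> \<xi> \<bullet> (x - y))"
proof -
  have "((\<lambda>z. \<Phi> \<alpha> z - \<Phi> \<beta> z) has_derivative (\<lambda>v. (G \<alpha> z - G \<beta> z) \<bullet> v)) (at z)"
    if "z \<in> closed_segment y x" for z
    unfolding inner_diff_left using that seg a by (intro has_derivative_diff Phi_deriv) auto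
  from mvt_inner[of y x "\<lambda>z. \<Phi> \<alpha> z - \<Phi> \<beta> z" "\<lambda>z. G \<alpha> z - G \<beta> z", OF this]
  obtain \<xi> where \<xi>: "\<xi> \<in> closed_segment y x"
    "(\<Phi> \<alpha> x - \<Phi> \<beta> x) - (\<Phi> \<alpha> y - \<Phi> \<beta> y) = (G \<alpha> \<xi> - G \<beta> \<xi>) \<bullet> (x - y)"
    by blast
  have "((\<lambda>\<gamma>. G \<gamma> \<xi> \<bullet> (x - y)) has_real_derivative G' \<gamma> \<xi> \<bullet> (x - y)) (at \<gamma>)"
    if "\<beta> \<le> \<gamma>" "\<gamma> \<le> \<alpha>" for \<gamma>
  proof -
    have "((\<lambda>\<gamma>. G \<gamma> \<xi>) has_vector_derivative G' \<gamma> \<xi>) (at \<gamma>)"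
      using that a \<xi> seg by (intro G_deriv) auto
    from bounded_linear.has_vector_derivative[OF bounded_linear_inner_left this, of "x - y"] show ?thesis
      by (simp add: has_real_derivative_iff_has_vector_derivative)
  qed
  from MVT2[OF a(3), of "\<lambda>\<gamma>. G \<gamma> \<xi> \<bullet> (x - y)" "\<lambda>\<gamma>. G' \<gamma> \<xi> \<bullet> (x - y)", OF this]
  obtain \<gamma> where "\<beta> < \<gamma>" "\<gamma> < \<alpha>"
    "G \<alpha> \<xi> \<bullet> (x - y) - G \<beta> \<xi> \<bullet> (x - y) = (\<alpha> - \<beta>) * (G' \<gamma> \<xi> \<bullet> (x - y))"
    by blast
  then show ?thesis
    using \<xi> by (intro that[of \<gamma> \<xi>]) (auto simp: inner_diff_left)
qed

lemma lmeasurable_level_strip: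
  assumes "{a..b} \<subseteq> {s<..<t}" "x \<in> U" "y \<in> U"
  shows "{\<alpha> \<in> {a..b}. \<bar>\<Phi> \<alpha> x - \<Phi> \<alpha> y\<bar> \<le> d} \<in> lmeasurable"
proof -
  have c: "continuous_on {a..b} (\<lambda>\<alpha>. \<Phi> \<alpha> x)" if "x \<in> U" for x
  proof -
    have "continuous_on {a..b} (\<lambda>\<alpha>. (\<lambda>(\<alpha>, x). \<Phi> \<alpha> x) (\<alpha>, x))"
      by (rule continuous_on_compose2[OF Phi_cont]) (use assms(1) that in \<open>auto intro!: continuous_intros\<close>)
    then show ?thesis by simp
  qed
  have "closed {\<alpha> \<in> {a..b}. \<bar>\<Phi> \<alpha> x - \<Phi> \<alpha> y\<bar> \<le> d}"
    by (intro continuous_on_closed_Collect_le continuous_intros c assms)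
  moreover have "bounded {\<alpha> \<in> {a..b}. \<bar>\<Phi> \<alpha> x - \<Phi> \<alpha> y\<bar> \<le> d}"
    by (rule bounded_subset[of "{a..b}"]) auto
  ultimately show ?thesis
    by (intro lmeasurable_compact) (auto simp: compact_eq_bounded_closed)
qed

text \<open>Since the gradient and its \<open>\<alpha>\<close>-derivative are linearly independent, for every direction
  one of them has a component bounded away from \<open>0\<close>: then either the difference
  \<open>\<Phi> \<alpha> x - \<Phi> \<alpha> y\<close> is large for all \<open>\<alpha>\<close>, or it moves with speed comparable to \<open>norm (x - y)\<close>.\<close>

lemma local_transversality:
  assumes \<alpha>0: "\<alpha>0 \<in> {s<..<t}" and x0: "x0 \<in> U"
  obtains a b r M where "a < b" "{a..b} \<subseteq> {s<..<t}" "r > 0" "ball x0 r \<subseteq> U" "M > 0"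
    "\<And>x y d. x \<in> ball x0 r \<Longrightarrow> y \<in> ball x0 r \<Longrightarrow> d \<ge> 0 \<Longrightarrow>
       measure lebesgue {\<alpha> \<in> {a..b}. \<bar>\<Phi> \<alpha> x - \<Phi> \<alpha> y\<bar> \<le> d} * norm (x - y) \<le> M * d"
proof -
  define g0 h0 where "g0 = G \<alpha>0 x0" and "h0 = G' \<alpha>0 x0"
  define D where "D = g0 $ 1 * h0 $ 2 - g0 $ 2 * h0 $ 1"
  have D: "\<bar>D\<bar> > 0"
    using det[OF \<alpha>0 x0] C by (auto simp: D_def g0_def h0_def divide_le_0_iff)
  then have g0: "norm g0 > 0"
    by (auto simp: D_def)
  define S where "S = norm g0 + norm h0"
  have S: "S > 0"
    using add_pos_nonneg[OF g0 norm_ge_zero[of h0]] by (simp add: S_def)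
  \<comment> \<open>Chosen so that \<open>2 * \<epsilon> * S = \<bar>D\<bar>\<close>, which is what
    the expansion of \<open>D\<close> times \<open>v\<close> below requires. Of the
    \<open>2 * \<epsilon>\<close> gained there, one \<open>\<epsilon>\<close> is later spent on the
    variation of \<open>G\<close> and \<open>G'\<close> near the base point.\<close>
  define \<epsilon> where "\<epsilon> = \<bar>D\<bar> / (2 * S)"
  have \<epsilon>: "\<epsilon> > 0"
    using D S by (simp add: \<epsilon>_def)
  have alt: "2 * \<epsilon> * norm v \<le> \<bar>g0 \<bullet> v\<bar> \<or> 2 * \<epsilon> * norm v \<le> \<bar>h0 \<bullet> v\<bar>" for v
  proof (rule ccontr)
    assume neg: "\<not> ?thesis"
    \<comment> \<open>Right-angle rotations of \<open>g0\<close> and \<open>h0\<close>, which form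
      their dual basis up to the factor \<open>D\<close>; expanding \<open>v\<close> in them is
      Cramer's rule.\<close>
    define gp hp :: "real^2" where "gp = vector [- g0 $ 2, g0 $ 1]" and "hp = vector [h0 $ 2, - h0 $ 1]"
    have n: "norm gp = norm g0" "norm hp = norm h0"
      by (simp_all add: gp_def hp_def norm_vec_def L2_set_def sum_2 add.commute)
    have "D *\<^sub>R v = (g0 \<bullet> v) *\<^sub>R hp + (h0 \<bullet> v) *\<^sub>R gp"
      by (simp add: vec_eq_iff forall_2 D_def gp_def hp_def inner_vec_def sum_2 algebra_simps)
    then have "\<bar>D\<bar> * norm v \<le> \<bar>g0 \<bullet> v\<bar> * norm h0 + \<bar>h0 \<bullet> v\<bar> * norm g0"
      using norm_triangle_ineq[of "(g0 \<bullet> v) *\<^sub>R hp" "(h0 \<bullet> v) *\<^sub>R gp"] n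
      by (metis norm_scaleR)
    also have "\<dots> < (2 * \<epsilon> * norm v) * norm h0 + (2 * \<epsilon> * norm v) * norm g0"
      using neg g0 by (intro add_le_less_mono mult_right_mono mult_strict_right_mono) auto
    also have "\<dots> = \<bar>D\<bar> * norm v"
    proof -
      have "2 * \<epsilon> * S = \<bar>D\<bar>"
        using S by (simp add: \<epsilon>_def)
      moreover have "(2 * \<epsilon> * norm v) * norm h0 + (2 * \<epsilon> * norm v) * norm g0 = (2 * \<epsilon> * S) * norm v"
        by (simp add: S_def algebra_simps)
      ultimately show ?thesis
        by (simp only:)
    qed
    finally show False by simp
  qed
  have opS: "open ({s<..<t} \<times> U)"
    using open_U by (intro open_Times) auto
  have z0: "(\<alpha>0, x0) \<in> {s<..<t} \<times> U"
    using \<alpha>0 x0 by simp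
  obtain e1 where e1: "e1 > 0" "ball (\<alpha>0, x0) e1 \<subseteq> {s<..<t} \<times> U"
    using opS z0 open_contains_ball by blast
  obtain e2 where e2: "e2 > 0"
    "\<And>\<alpha> x. \<alpha> \<in> {s<..<t} \<Longrightarrow> x \<in> U \<Longrightarrow> dist (\<alpha>, x) (\<alpha>0, x0) < e2 \<Longrightarrow> dist (G \<alpha> x) g0 < \<epsilon>"
    using G_cont z0 \<epsilon> unfolding continuous_on_iff g0_def by fastforce
  obtain e3 where e3: "e3 > 0"
    "\<And>\<alpha> x. \<alpha> \<in> {s<..<t} \<Longrightarrow> x \<in> U \<Longrightarrow> dist (\<alpha>, x) (\<alpha>0, x0) < e3 \<Longrightarrow> dist (G' \<alpha> x) h0 < \<epsilon>"
    using G'_cont z0 \<epsilon> unfolding continuous_on_iff h0_def by fastforce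
  define r where "r = min e1 (min e2 e3) / 2"
  have r: "r > 0"
    using e1 e2 e3 by (simp add: r_def)
  define a b where "a = \<alpha>0 - r / 2" and "b = \<alpha>0 + r / 2"
  have ab: "a < b"
    using r by (simp add: a_def b_def)
  have near: "\<alpha> \<in> {s<..<t}" "x \<in> U" "dist (G \<alpha> x) g0 < \<epsilon>" "dist (G' \<alpha> x) h0 < \<epsilon>"
    if "\<alpha> \<in> {a..b}" "x \<in> ball x0 r" for \<alpha> x
  proof -
    have "dist (\<alpha>, x) (\<alpha>0, x0) \<le> dist \<alpha> \<alpha>0 + dist x x0"
      by (simp add: dist_prod_def sqrt_sum_squares_le_sum)
    also have "\<dots> < r + r"
      using that r by (intro add_strict_mono) (auto simp: a_def b_def dist_real_def dist_commute)
    finally have d: "dist (\<alpha>, x) (\<alpha>0, x0) < min e1 (min e2 e3)"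
      by (simp add: r_def)
    then have "(\<alpha>, x) \<in> ball (\<alpha>0, x0) e1"
      by (simp add: dist_commute)
    then show *: "\<alpha> \<in> {s<..<t}" "x \<in> U"
      using e1 by blast+
    show "dist (G \<alpha> x) g0 < \<epsilon>" "dist (G' \<alpha> x) h0 < \<epsilon>"
      using d e2(2)[OF *] e3(2)[OF *] by simp_all
  qed
  have ab_sub: "{a..b} \<subseteq> {s<..<t}"
    using near(1)[of _ x0] r by auto
  have ball_sub: "ball x0 r \<subseteq> U"
    using near(2)[of \<alpha>0] r by (auto simp: a_def b_def)
  \<comment> \<open>The part \<open>(b - a) / \<epsilon>\<close> serves the case of a difference
    that stays large, the part \<open>4 / \<epsilon>\<close> the case of a moving one, where the
    strip lies in an interval of length \<open>2 * \<rho>\<close>.\<close>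
  define M where "M = (4 + (b - a)) / \<epsilon>"
  have bound: "measure lebesgue {\<alpha> \<in> {a..b}. \<bar>\<Phi> \<alpha> x - \<Phi> \<alpha> y\<bar> \<le> d} * norm (x - y) \<le> M * d"
    if x: "x \<in> ball x0 r" and y: "y \<in> ball x0 r" and d: "d \<ge> 0" for x y d
  proof -
    define T where "T = {\<alpha> \<in> {a..b}. \<bar>\<Phi> \<alpha> x - \<Phi> \<alpha> y\<bar> \<le> d}"
    have T: "T \<in> lmeasurable"
      unfolding T_def using x y ball_sub by (intro lmeasurable_level_strip ab_sub) auto
    have seg: "closed_segment y x \<subseteq> ball x0 r"
      using x y by (simp add: closed_segment_subset)
    then have segU: "closed_segment y x \<subseteq> U"
      using ball_sub by blast
    show ?thesis
    proof (cases "T = {} \<or> x = y")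
      case True
      then show ?thesis
        using d ab \<epsilon> unfolding T_def[symmetric] by (auto simp: M_def)
    next
      case False
      then obtain \<alpha>1 where \<alpha>1: "\<alpha>1 \<in> T" and xy: "norm (x - y) > 0"
        by auto
      consider "2 * \<epsilon> * norm (x - y) \<le> \<bar>g0 \<bullet> (x - y)\<bar>" | "2 * \<epsilon> * norm (x - y) \<le> \<bar>h0 \<bullet> (x - y)\<bar>"
        using alt by blast
      then show ?thesis
      proof cases
        \<comment> \<open>A single parameter in \<open>T\<close> already forces
          \<open>\<epsilon> * norm (x - y) \<le> d\<close>, so the trivial bound
          \<open>b - a\<close> for the measure is enough.\<close>
        case 1
        have a1: "\<alpha>1 \<in> {a..b}" "\<bar>\<Phi> \<alpha>1 x - \<Phi> \<alpha>1 y\<bar> \<le> d"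
          using \<alpha>1 by (auto simp: T_def)
        obtain \<xi> where \<xi>: "\<xi> \<in> closed_segment y x" "\<Phi> \<alpha>1 x - \<Phi> \<alpha>1 y = G \<alpha>1 \<xi> \<bullet> (x - y)"
          using Phi_mvt[OF _ segU] a1 ab_sub by blast
        have "\<bar>(G \<alpha>1 \<xi> - g0) \<bullet> (x - y)\<bar> \<le> norm (G \<alpha>1 \<xi> - g0) * norm (x - y)"
          by (rule Cauchy_Schwarz_ineq2)
        also have "\<dots> \<le> \<epsilon> * norm (x - y)"
          using near(3)[OF a1(1), of \<xi>] \<xi> seg by (intro mult_right_mono) (auto simp: dist_norm)
        finally have "\<epsilon> * norm (x - y) \<le> d"
          using 1 \<xi> a1 by (simp add: inner_diff_left)
        moreover have "measure lebesgue T \<le> measure lebesgue {a..b}"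
          using T by (intro measure_mono_fmeasurable) (auto simp: T_def)
        ultimately have "measure lebesgue T * (\<epsilon> * norm (x - y)) \<le> (b - a) * d"
          using ab \<epsilon> by (intro mult_mono) auto
        then show ?thesis
          using \<epsilon> d unfolding T_def[symmetric] M_def by (simp add: field_simps)
      next
        case 2
        have close: "\<bar>\<alpha> - \<beta>\<bar> * (\<epsilon> * norm (x - y)) \<le> 2 * d" if "\<alpha> \<in> T" "\<beta> \<in> T" "\<beta> < \<alpha>" for \<alpha> \<beta>
        proof -
          have lt: "\<beta> < \<alpha>" and ab': "\<alpha> \<in> {a..b}" "\<beta> \<in> {a..b}" "\<bar>\<Phi> \<alpha> x - \<Phi> \<alpha> y\<bar> \<le> d" "\<bar>\<Phi> \<beta> x - \<Phi> \<beta> y\<bar> \<le> d"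
            using that by (auto simp: T_def)
          then obtain \<gamma> \<xi> where \<gamma>: "\<gamma> \<in> {\<beta>..\<alpha>}" "\<xi> \<in> closed_segment y x"
            "(\<Phi> \<alpha> x - \<Phi> \<alpha> y) - (\<Phi> \<beta> x - \<Phi> \<beta> y) = (\<alpha> - \<beta>) * (G' \<gamma> \<xi> \<bullet> (x - y))"
            using Phi_diff_mvt[OF _ _ lt segU, of thesis] ab_sub by blast
          have "\<bar>(G' \<gamma> \<xi> - h0) \<bullet> (x - y)\<bar> \<le> norm (G' \<gamma> \<xi> - h0) * norm (x - y)"
            by (rule Cauchy_Schwarz_ineq2)
          also have "\<dots> \<le> \<epsilon> * norm (x - y)"
            using near(4)[of \<gamma> \<xi>] \<gamma> ab' seg by (intro mult_right_mono) (auto simp: dist_norm)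
          finally have "\<epsilon> * norm (x - y) \<le> \<bar>G' \<gamma> \<xi> \<bullet> (x - y)\<bar>"
            using 2 by (simp add: inner_diff_left)
          then have "\<bar>\<alpha> - \<beta>\<bar> * (\<epsilon> * norm (x - y)) \<le> \<bar>\<alpha> - \<beta>\<bar> * \<bar>G' \<gamma> \<xi> \<bullet> (x - y)\<bar>"
            by (intro mult_left_mono) auto
          also have "\<dots> = \<bar>(\<Phi> \<alpha> x - \<Phi> \<alpha> y) - (\<Phi> \<beta> x - \<Phi> \<beta> y)\<bar>"
            by (simp add: \<gamma>(3) abs_mult)
          also have "\<dots> \<le> 2 * d"
            using ab' by linarith
          finally show ?thesis .
        qed
        define \<rho> where "\<rho> = 2 * d / (\<epsilon> * norm (x - y))"
        have \<rho>: "\<rho> \<ge> 0"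
          using d \<epsilon> by (simp add: \<rho>_def)
        have "\<bar>\<alpha> - \<alpha>1\<bar> \<le> \<rho>" if "\<alpha> \<in> T" for \<alpha>
        proof -
          have "\<bar>\<alpha> - \<alpha>1\<bar> * (\<epsilon> * norm (x - y)) \<le> 2 * d"
            using close[OF that \<alpha>1] close[OF \<alpha>1 that] d by (cases \<alpha> \<alpha>1 rule: linorder_cases) (auto simp: abs_minus_commute)
          then show ?thesis
            using \<epsilon> xy by (simp add: \<rho>_def pos_le_divide_eq)
        qed
        then have "T \<subseteq> {\<alpha>1 - \<rho>..\<alpha>1 + \<rho>}"
          by (auto simp: abs_le_iff algebra_simps)
        then have "measure lebesgue T \<le> measure lebesgue {\<alpha>1 - \<rho>..\<alpha>1 + \<rho>}"
          using T by (intro measure_mono_fmeasurable) auto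
        also have "\<dots> = 2 * \<rho>"
          using \<rho> by simp
        finally have "measure lebesgue T * norm (x - y) \<le> 2 * \<rho> * norm (x - y)"
          by (intro mult_right_mono) auto
        also have "\<dots> = 4 / \<epsilon> * d"
          using xy by (simp add: \<rho>_def)
        also have "\<dots> \<le> M * d"
          unfolding M_def using d \<epsilon> ab by (intro mult_right_mono divide_right_mono) auto
        finally show ?thesis
          unfolding T_def .
      qed
    qed
  qed
  have "M > 0"
    using \<epsilon> ab by (simp add: M_def)
  then show ?thesis
    using that[OF ab ab_sub r ball_sub _ bound] by blast
qed

end

section \<open>Lower bound\<close>

lemma nn_integral_const_interval:
  assumes "c \<ge> 0" "s \<le> t"
  shows "(\<integral>\<^sup>+x\<in>{s<..<t}. ennreal c \<partial>lebesgue) = ennreal ((t - s) * c)"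
    "(\<integral>\<^sup>+x\<in>{s..t}. ennreal c \<partial>lebesgue) = ennreal ((t - s) * c)"
proof -
  have "ennreal c * ennreal (t - s) = ennreal ((t - s) * c)"
    using assms by (simp add: ennreal_mult mult.commute)
  then show "(\<integral>\<^sup>+x\<in>{s<..<t}. ennreal c \<partial>lebesgue) = ennreal ((t - s) * c)"
    "(\<integral>\<^sup>+x\<in>{s..t}. ennreal c \<partial>lebesgue) = ennreal ((t - s) * c)"
    using assms by (subst nn_integral_cmult_indicator; simp)+
qed

lemma word_map_append: "word_map L b (u @ v) x = word_map L b u (word_map L b v x)"
  by (induction u) auto

lemma cball_subset_word_square:
  assumes "L > 0" "w \<in> words L n"
  shows "cball (word_map L b w (\<chi> i. 1 / 2)) ((1 / real L) ^ n / 2) \<subseteq> word_map L b w ` cbox 0 1"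
proof
  fix y assume y: "y \<in> cball (word_map L b w (\<chi> i. 1 / 2)) ((1 / real L) ^ n / 2)"
  define c :: "real^2" where "c = (\<chi> i. 1 / 2)"
  have len: "length w = n"
    using assms(2) by (simp add: words_def)
  define z where "z = c + real L ^ n *\<^sub>R (y - word_map L b w c)"
  have "(1 / real L) ^ n * real L ^ n = 1"
    using assms(1) by (simp add: power_mult_distrib[symmetric])
  then have "word_map L b w z = y"
    using word_map_diff[of L b w z c] len by (simp add: z_def)
  moreover have "z \<in> cbox 0 1"
  proof -
    have "norm (z - c) = real L ^ n * norm (y - word_map L b w c)"
      by (simp add: z_def)
    also have "\<dots> \<le> real L ^ n * ((1 / real L) ^ n / 2)"
      using y by (intro mult_left_mono) (auto simp: c_def dist_norm norm_minus_commute)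
    also have "\<dots> = 1 / 2"
      using assms(1) by (simp add: power_divide)
    finally have "\<bar>(z - c) $ i\<bar> \<le> 1 / 2" for i
      using component_le_norm_cart[of "z - c" i] by linarith
    then have "0 \<le> z $ i \<and> z $ i \<le> 1" for i
      by (simp add: c_def abs_le_iff) (smt (verit) field_sum_of_halves)
    then show ?thesis
      by (simp add: mem_box_cart)
  qed
  ultimately show "y \<in> word_map L b w ` cbox 0 1"
    by blast
qed

locale transversal_self_similar =
  self_similar L b E + transversal_family s t C U \<Phi> G G'
  for L b E s t C U \<Phi> G G' +
  fixes V :: "(real^2) set"
  assumes compact_V: "compact V" and V_sub: "V \<subseteq> U" and fin_iter_sub: "\<And>n. fin_iter L b n \<subseteq> V"
begin

lemma continuous_Phi: "\<alpha> \<in> {s<..<t} \<Longrightarrow> S \<subseteq> U \<Longrightarrow> continuous_on S (\<Phi> \<alpha>)"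
  using Phi_deriv by (blast intro: continuous_at_imp_continuous_on has_derivative_continuous)

lemma compact_Phi_fin_iter: "\<alpha> \<in> {s<..<t} \<Longrightarrow> compact (\<Phi> \<alpha> ` fin_iter L b n)"
  using fin_iter_sub V_sub by (intro compact_continuous_image continuous_Phi compact_fin_iter) auto

text \<open>A step of length \<open>\<tau>\<close> along the normalised gradient, in either sense,
  changes \<open>\<Phi> \<alpha>\<close> by at least half of its linear part, and connectedness of
  the ball fills in all values between the two ends.\<close>

lemma image_contains_interval:
  assumes a: "\<alpha> \<in> {s<..<t}" and \<rho>: "0 \<le> \<rho>" "\<rho> \<le> 1" and sub: "cball x \<rho> \<subseteq> U"
  shows "{\<Phi> \<alpha> x - \<rho> / (16 * C ^ 3)..\<Phi> \<alpha> x + \<rho> / (16 * C ^ 3)} \<subseteq> \<Phi> \<alpha> ` cball x \<rho>"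
proof
  fix v assume v: "v \<in> {\<Phi> \<alpha> x - \<rho> / (16 * C ^ 3)..\<Phi> \<alpha> x + \<rho> / (16 * C ^ 3)}"
  have x: "x \<in> U"
    using sub \<rho> by auto
  define g where "g = G \<alpha> x"
  have g: "norm g \<ge> 1 / C" "norm g > 0"
    using G_norm[OF a x] C by (auto simp: g_def intro: less_le_trans[of 0 "1 / C"])
  \<comment> \<open>As \<open>\<rho> \<le> 1\<close>, this makes the Taylor remainder
    \<open>4 * C * \<tau>\<^sup>2\<close> at most \<open>\<tau> / (2 * C)\<close>, while the linear
    part is at least \<open>\<tau> / C\<close>. The surplus is
    \<open>\<tau> / (2 * C) = \<rho> / (16 * C ^ 3)\<close>.\<close>
  define \<tau> where "\<tau> = \<rho> / (8 * C\<^sup>2)"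
  have C2: "C\<^sup>2 \<ge> 1"
    using C by simp
  have \<tau>: "0 \<le> \<tau>" "\<tau> \<le> \<rho>" "\<tau> \<le> 1 / (8 * C\<^sup>2)"
  proof -
    show "0 \<le> \<tau>"
      using \<rho> by (simp add: \<tau>_def)
    have "\<rho> / (8 * C\<^sup>2) \<le> \<rho> / 1"
      using \<rho> C2 by (intro divide_left_mono) auto
    then show "\<tau> \<le> \<rho>"
      by (simp add: \<tau>_def)
    show "\<tau> \<le> 1 / (8 * C\<^sup>2)"
      unfolding \<tau>_def using \<rho> by (intro divide_right_mono) auto
  qed
  define u where "u = (1 / norm g) *\<^sub>R g"
  have u: "norm u = 1" "g \<bullet> u = norm g"
    using g by (simp_all add: u_def dot_square_norm power2_eq_square)
  have rem: "\<bar>\<Phi> \<alpha> (x + \<sigma> *\<^sub>R u) - \<Phi> \<alpha> x - \<sigma> * norm g\<bar> \<le> \<tau> / (2 * C)" if \<sigma>: "\<bar>\<sigma>\<bar> = \<tau>" for \<sigma>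
  proof -
    have "x + \<sigma> *\<^sub>R u \<in> cball x \<rho>"
      using u \<tau> \<sigma> by (simp add: dist_norm)
    then have "closed_segment x (x + \<sigma> *\<^sub>R u) \<subseteq> U"
      using \<rho> sub by (intro order_trans[OF closed_segment_subset sub]) auto
    from Phi_taylor[OF a this]
    have "\<bar>\<Phi> \<alpha> (x + \<sigma> *\<^sub>R u) - \<Phi> \<alpha> x - \<sigma> * norm g\<bar> \<le> 4 * C * \<bar>\<sigma>\<bar>\<^sup>2"
      using u by (simp add: g_def)
    also have "\<dots> = 4 * C * \<tau> * \<tau>"
      using \<sigma> by (simp add: power2_eq_square)
    also have "\<dots> \<le> 4 * C * \<tau> * (1 / (8 * C\<^sup>2))"
      using C \<tau> by (intro mult_left_mono) auto
    also have "\<dots> = \<tau> / (2 * C)"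
      using C by (simp add: power2_eq_square)
    finally show ?thesis .
  qed
  have eq: "\<tau> / (2 * C) = \<rho> / (16 * C ^ 3)"
    by (simp add: \<tau>_def power2_eq_square power3_eq_cube mult_ac)
  have "\<tau> * norm g \<ge> \<tau> * (1 / C)"
    using g \<tau> by (intro mult_left_mono) auto
  then have slope: "\<tau> * norm g \<ge> 2 * (\<tau> / (2 * C))"
    by simp
  have lo: "\<Phi> \<alpha> (x + (-\<tau>) *\<^sub>R u) \<le> v" and hi: "v \<le> \<Phi> \<alpha> (x + \<tau> *\<^sub>R u)"
    using rem[of \<tau>] rem[of "-\<tau>"] \<tau> v slope unfolding eq by auto
  have mem: "x + (-\<tau>) *\<^sub>R u \<in> cball x \<rho>" "x + \<tau> *\<^sub>R u \<in> cball x \<rho>"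
    using u \<tau> by (simp_all add: dist_norm)
  have "connected (\<Phi> \<alpha> ` cball x \<rho>)"
    using a sub by (intro connected_continuous_image continuous_Phi) auto
  then show "v \<in> \<Phi> \<alpha> ` cball x \<rho>"
    using connectedD_interval[of _ "\<Phi> \<alpha> (x + (-\<tau>) *\<^sub>R u)" "\<Phi> \<alpha> (x + \<tau> *\<^sub>R u)" v] mem lo hi by blast
qed

section \<open>Squares, their centres, and overlaps of their images\<close>

definition center :: "nat list \<Rightarrow> real^2" where
  "center w = word_map L b w (\<chi> i. 1 / 2)"

text \<open>The constant of \<open>image_contains_interval\<close> for the disc of radius
  \<open>L^-n / 2\<close> inscribed in a square of side \<open>L^-n\<close>, measured in units of
  that side.\<close>

definition \<kappa> :: real where "\<kappa> = 1 / (32 * C ^ 3)"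

lemma kappa_pos: "\<kappa> > 0"
  using C by (simp add: \<kappa>_def)

lemma center_in_V: "w \<in> words L n \<Longrightarrow> center w \<in> V"
  using fin_iter_sub[of n] unfolding fin_iter_words center_def by (force simp: mem_box_cart)

lemma word_square_interval:
  assumes a: "\<alpha> \<in> {s<..<t}" and w: "w \<in> words L n"
  shows "{\<Phi> \<alpha> (center w) - \<kappa> * (1 / real L) ^ n..\<Phi> \<alpha> (center w) + \<kappa> * (1 / real L) ^ n}
    \<subseteq> \<Phi> \<alpha> ` fin_iter L b n"
proof -
  let ?\<rho> = "(1 / real L) ^ n / 2"
  have sub: "cball (center w) ?\<rho> \<subseteq> fin_iter L b n"
    using cball_subset_word_square[OF L_pos w] w unfolding fin_iter_words center_def by blast
  have "(1 / real L) ^ n \<le> 1"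
    using L_pos by (intro power_le_one) auto
  then have "{\<Phi> \<alpha> (center w) - ?\<rho> / (16 * C ^ 3)..\<Phi> \<alpha> (center w) + ?\<rho> / (16 * C ^ 3)}
      \<subseteq> \<Phi> \<alpha> ` cball (center w) ?\<rho>"
    using sub fin_iter_sub[of n] V_sub by (intro image_contains_interval a) auto
  also have "\<dots> \<subseteq> \<Phi> \<alpha> ` fin_iter L b n"
    by (rule image_mono[OF sub])
  also have "?\<rho> / (16 * C ^ 3) = \<kappa> * (1 / real L) ^ n"
    by (simp add: \<kappa>_def)
  finally show ?thesis .
qed

text \<open>One square is enough for this crude bound. It serves the finitely many \<open>n\<close>
  below the length of the fixed prefix, for which the second moment gives nothing.\<close>

lemma Fav_gen_ge_single:
  "ennreal ((t - s) * (2 * \<kappa> * (1 / real L) ^ n)) \<le> Fav_gen {s<..<t} \<Phi> (fin_iter L b n)"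
proof -
  let ?r = "\<kappa> * (1 / real L) ^ n"
  define w where "w = replicate n (1 :: nat)"
  have w: "w \<in> words L n"
    using L_ge_3 by (auto simp: words_def w_def)
  have "?r \<ge> 0"
    using kappa_pos by simp
  then have "ennreal ((t - s) * (2 * ?r)) = (\<integral>\<^sup>+\<alpha>\<in>{s<..<t}. ennreal (2 * ?r) \<partial>lebesgue)"
    using st by (intro nn_integral_const_interval(1)[symmetric]) auto
  also have "\<dots> \<le> Fav_gen {s<..<t} \<Phi> (fin_iter L b n)"
    unfolding Fav_gen_def
  proof (intro nn_integral_mono)
    fix \<alpha>
    have "ennreal (2 * ?r) \<le> emeasure lebesgue (\<Phi> \<alpha> ` fin_iter L b n)" if a: "\<alpha> \<in> {s<..<t}"
    proof -
      have "emeasure lebesgue {\<Phi> \<alpha> (center w) - ?r..\<Phi> \<alpha> (center w) + ?r} \<le> emeasure lebesgue (\<Phi> \<alpha> ` fin_iter L b n)"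
        using compact_Phi_fin_iter[OF a, of n] by (intro emeasure_mono word_square_interval a w) (auto simp: borel_compact)
      then show ?thesis
        using \<open>?r \<ge> 0\<close> by simp
    qed
    then show "ennreal (2 * ?r) * indicator {s<..<t} \<alpha> \<le> emeasure lebesgue (\<Phi> \<alpha> ` fin_iter L b n) * indicator {s<..<t} \<alpha>"
      by (auto simp: indicator_def)
  qed
  finally show ?thesis
    by (simp add: mult.assoc)
qed

text \<open>Separation is known only for images of a point \<open>e\<close> of \<open>E\<close>, and
  each centre lies at distance \<open>norm (e - c) * L^-n\<close> from the corresponding image,
  \<open>c\<close> being the centre of the unit square. The error constant is twice that distance,
  plus 1 to make it positive.\<close>

lemma dist_center:
  obtains d c1 where "d > 0" "c1 > 0"
    "\<And>n v w. v \<in> words L n \<Longrightarrow> w \<in> words L n \<Longrightarrow> v \<noteq> w \<Longrightarrow>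
       d * (1 / real L) ^ lcp v w - c1 * (1 / real L) ^ n \<le> norm (center v - center w)"
proof -
  obtain d where d: "d > 0"
    "\<And>n v w e. v \<in> words L n \<Longrightarrow> w \<in> words L n \<Longrightarrow> v \<noteq> w \<Longrightarrow> e \<in> E \<Longrightarrow>
       d * (1 / real L) ^ lcp v w \<le> dist (word_map L b v e) (word_map L b w e)"
    using word_map_separated by blast
  obtain e where e: "e \<in> E"
    using ssc by (auto simp: self_similar_ssc_def)
  define c :: "real^2" where "c = (\<chi> i. 1 / 2)"
  show ?thesis
  proof (rule that[OF d(1), of "2 * norm (e - c) + 1"])
    fix n v w assume vw: "v \<in> words L n" "w \<in> words L n" "v \<noteq> w"
    have near: "norm (word_map L b v e - center v) = (1 / real L) ^ n * norm (e - c)" if "v \<in> words L n" for v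
      using that unfolding center_def c_def[symmetric] word_map_diff by (simp add: words_def)
    have "d * (1 / real L) ^ lcp v w \<le> norm (word_map L b v e - word_map L b w e)"
      using d(2)[OF vw e] by (simp add: dist_norm)
    also have "word_map L b v e - word_map L b w e
        = (word_map L b v e - center v) - (word_map L b w e - center w) + (center v - center w)"
      by simp
    also have "norm \<dots> \<le> (norm (word_map L b v e - center v) + norm (word_map L b w e - center w)) + norm (center v - center w)"
      by (intro order_trans[OF norm_triangle_ineq] add_right_mono norm_triangle_ineq4)
    also have "\<dots> = 2 * norm (e - c) * (1 / real L) ^ n + norm (center v - center w)"
      by (simp add: near vw)
    also have "\<dots> \<le> (2 * norm (e - c) + 1) * (1 / real L) ^ n + norm (center v - center w)"
      by (simp add: distrib_right)
    finally show "d * (1 / real L) ^ lcp v w - (2 * norm (e - c) + 1) * (1 / real L) ^ n \<le> norm (center v - center w)"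
      by simp
  qed (simp add: add_nonneg_pos)
qed

text \<open>The point \<open>p\<close> is the fixed point of the first map, whose powers contract
  \<open>V\<close> towards it. It lies in \<open>V\<close> as a limit of images of the origin, so
  local transversality can be applied at \<open>p\<close>, and long words of ones carry all of
  \<open>V\<close> into the resulting ball. The clause \<open>m \<ge> 1\<close> later gives
  \<open>j + 1 \<le> m + j\<close>.\<close>

lemma small_piece:
  obtains p where "p \<in> V" "\<And>r. r > 0 \<Longrightarrow> \<exists>m\<ge>1. \<exists>u\<in>words L m. \<forall>x\<in>V. word_map L b u x \<in> ball p r"
proof -
  define p where "p = (real L / (real L - 1)) *\<^sub>R b 1"
  have eq: "(1 / real L) * (real L / (real L - 1)) + 1 = real L / (real L - 1)"
    using L_ge_3 by (simp add: field_simps)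
  have fp: "ss_map L b 1 p = p"
  proof -
    have "ss_map L b 1 p = ((1 / real L) * (real L / (real L - 1)) + 1) *\<^sub>R b 1"
      by (simp only: ss_map_def p_def scaleR_add_left scaleR_scaleR scaleR_one)
    also have "\<dots> = p"
      unfolding eq p_def ..
    finally show ?thesis .
  qed
  have fpm: "word_map L b (replicate m 1) p = p" for m
    by (induction m) (simp_all add: fp del: One_nat_def)
  have u: "replicate m 1 \<in> words L m" for m
    using L_ge_3 by (auto simp: words_def)
  have dist_p: "dist (word_map L b (replicate m 1) x) p = (1 / real L) ^ m * norm (x - p)" for m x
    using word_map_diff[of L b "replicate m 1" x p] by (simp add: fpm dist_norm del: One_nat_def)
  have lim: "(\<lambda>m. (1 / real L) ^ m * B) \<longlonglongrightarrow> 0" for B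
    using L_ge_3 by (intro tendsto_mult_left_zero LIMSEQ_realpow_zero) auto
  have "p \<in> V"
  proof (rule closed_sequentially[OF compact_imp_closed[OF compact_V]])
    show "word_map L b (replicate m 1) 0 \<in> V" for m
      using fin_iter_sub[of m] u[of m] unfolding fin_iter_words by (force simp: mem_box_cart)
    show "(\<lambda>m. word_map L b (replicate m 1) 0) \<longlonglongrightarrow> p"
      unfolding tendsto_dist_iff[of _ p] dist_p by (rule lim)
  qed
  moreover have "\<exists>m\<ge>1. \<exists>u\<in>words L m. \<forall>x\<in>V. word_map L b u x \<in> ball p r" if r: "r > 0" for r
  proof -
    obtain B where B: "\<And>x. x \<in> V \<Longrightarrow> dist p x \<le> B"
      using compact_imp_bounded[OF compact_V] unfolding bounded_any_center[of _ p] by blast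
    have "eventually (\<lambda>m. (1 / real L) ^ m * B < r) sequentially"
      using order_tendstoD(2)[OF lim r] .
    then have "eventually (\<lambda>m. 1 \<le> m \<and> (1 / real L) ^ m * B < r) sequentially"
      by (intro eventually_conj eventually_ge_at_top)
    then obtain m where m: "m \<ge> 1" "(1 / real L) ^ m * B < r"
      unfolding eventually_sequentially by blast
    have "word_map L b (replicate m 1) x \<in> ball p r" if "x \<in> V" for x
    proof -
      have "(1 / real L) ^ m * norm (x - p) \<le> (1 / real L) ^ m * B"
        using B[OF that] by (intro mult_left_mono) (auto simp: dist_norm norm_minus_commute)
      then show ?thesis
        using m dist_p[of m x] by (simp add: dist_commute)
    qed
    then show ?thesis
      using m(1) u by blast
  qed
  ultimately show ?thesis
    using that by blast
qed

text \<open>The prefix \<open>u\<close> puts both centres into a ball where transversality holds. It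
  scales their distance and the side of the squares by the same \<open>L^-m\<close>, so only the
  ratio of \<open>L^-j\<close> to \<open>L^-lcp\<close> remains.\<close>

lemma pair_measure_bound:
  obtains a' b' K m u where "a' < b'" "{a'..b'} \<subseteq> {s<..<t}" "K > 0" "m \<ge> 1" "u \<in> words L m"
    "\<And>j v w. v \<in> words L j \<Longrightarrow> w \<in> words L j \<Longrightarrow>
       measure lebesgue {\<alpha>\<in>{a'..b'}. \<bar>\<Phi> \<alpha> (center (u @ v)) - \<Phi> \<alpha> (center (u @ w))\<bar> \<le> 2 * (\<kappa> * (1 / real L) ^ (m + j))}
       \<le> K * (real L ^ lcp v w / real L ^ j)"
proof -
  obtain p where p: "p \<in> V"
    "\<And>r. r > 0 \<Longrightarrow> \<exists>m\<ge>1. \<exists>u\<in>words L m. \<forall>x\<in>V. word_map L b u x \<in> ball p r"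
    using small_piece by blast
  have mid: "(s + t) / 2 \<in> {s<..<t}"
    using st by auto
  obtain a' b' r M where ab: "a' < b'" "{a'..b'} \<subseteq> {s<..<t}" and r: "r > 0" "ball p r \<subseteq> U" and M: "M > 0"
    and trans: "\<And>x y d. x \<in> ball p r \<Longrightarrow> y \<in> ball p r \<Longrightarrow> d \<ge> 0 \<Longrightarrow>
       measure lebesgue {\<alpha> \<in> {a'..b'}. \<bar>\<Phi> \<alpha> x - \<Phi> \<alpha> y\<bar> \<le> d} * norm (x - y) \<le> M * d"
    using local_transversality[OF mid, of p] p(1) V_sub by blast
  obtain m u where m: "m \<ge> 1" and u: "u \<in> words L m" "\<And>x. x \<in> V \<Longrightarrow> word_map L b u x \<in> ball p r"
    using p(2)[OF r(1)] by blast
  obtain d c1 where d: "d > 0" "c1 > 0"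
    "\<And>n v w. v \<in> words L n \<Longrightarrow> w \<in> words L n \<Longrightarrow> v \<noteq> w \<Longrightarrow>
       d * (1 / real L) ^ lcp v w - c1 * (1 / real L) ^ n \<le> norm (center v - center w)"
    using dist_center by blast
  \<comment> \<open>One term for each case: equal words, distinct words whose separation may be lost
    in the error of \<open>dist_center\<close>, and distinct words whose separation survives up to a
    factor 2.\<close>
  define K where "K = (b' - a') + (b' - a') * (2 * c1 / d) + 4 * M * \<kappa> / d"
  have terms: "0 < b' - a'" "0 \<le> (b' - a') * (2 * c1 / d)" "0 \<le> 4 * M * \<kappa> / d"
    using ab d M kappa_pos by auto
  then have K: "K > 0" "K \<ge> b' - a'" "K \<ge> (b' - a') * (2 * c1 / d)" "K \<ge> 4 * M * \<kappa> / d"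
    unfolding K_def by linarith+
  have L: "real L > 0"
    using L_pos by simp
  show ?thesis
  proof (rule that[OF ab K(1) m u(1)])
    fix j v w assume vw: "v \<in> words L j" "w \<in> words L j"
    let ?x = "center (u @ v)" and ?y = "center (u @ w)" and ?\<delta> = "2 * (\<kappa> * (1 / real L) ^ (m + j))"
    define T where "T = {\<alpha>\<in>{a'..b'}. \<bar>\<Phi> \<alpha> ?x - \<Phi> \<alpha> ?y\<bar> \<le> ?\<delta>}"
    define q where "q = real L ^ lcp v w / real L ^ j"
    have q: "q > 0"
      using L by (simp add: q_def)
    have xy_ball: "?x \<in> ball p r" "?y \<in> ball p r"
      using u(2) center_in_V vw unfolding center_def word_map_append by blast+
    then have T: "T \<in> lmeasurable"
      unfolding T_def using r(2) by (intro lmeasurable_level_strip ab) auto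
    have "T \<subseteq> {a'..b'}"
      by (auto simp: T_def)
    then have "measure lebesgue T \<le> measure lebesgue {a'..b'}"
      by (rule measure_mono_fmeasurable[OF _ fmeasurableD[OF T]]) simp
    then have T_le: "measure lebesgue T \<le> b' - a'"
      using ab by simp
    have "measure lebesgue T \<le> K * q"
    proof (cases "v = w")
      case True
      then have "q = 1"
        using vw L by (simp add: q_def words_def)
      then show ?thesis
        using T_le K by simp
    next
      case False
      show ?thesis
      proof (cases "2 * c1 * (1 / real L) ^ j \<le> d * (1 / real L) ^ lcp v w")
        case True
        have "norm (?x - ?y) = (1 / real L) ^ m * norm (center v - center w)"
          using u(1) by (simp add: center_def word_map_append word_map_diff words_def)
        also have "\<dots> \<ge> (1 / real L) ^ m * (d * (1 / real L) ^ lcp v w / 2)"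
          using d(3)[OF vw False] True by (intro mult_left_mono) auto
        finally have low: "(1 / real L) ^ m * (d * (1 / real L) ^ lcp v w / 2) \<le> norm (?x - ?y)" .
        have "measure lebesgue T * ((1 / real L) ^ m * (d * (1 / real L) ^ lcp v w / 2)) \<le> measure lebesgue T * norm (?x - ?y)"
          by (intro mult_left_mono low) auto
        also have "\<dots> \<le> M * ?\<delta>"
          unfolding T_def using kappa_pos by (intro trans xy_ball) auto
        finally have "measure lebesgue T * d \<le> (4 * M * \<kappa>) * q"
          using L by (simp add: q_def power_add power_divide field_simps)
        then have "measure lebesgue T \<le> 4 * M * \<kappa> / d * q"
          using d(1) by (simp add: field_simps)
        also have "\<dots> \<le> K * q"
          using K q by (intro mult_right_mono) auto
        finally show ?thesis .
      next
        \<comment> \<open>Here \<open>j - lcp v w\<close> is bounded, so \<open>q\<close> is bounded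
          below and the full length \<open>b' - a'\<close> is an acceptable bound.\<close>
        case False
        then have "1 \<le> 2 * c1 / d * q"
          using d(1) L by (simp add: q_def power_divide field_simps)
        then have "(b' - a') * 1 \<le> (b' - a') * (2 * c1 / d * q)"
          using ab by (intro mult_left_mono) auto
        also have "\<dots> = (b' - a') * (2 * c1 / d) * q"
          by simp
        also have "\<dots> \<le> K * q"
          using K q by (intro mult_right_mono) auto
        finally show ?thesis
          using T_le by simp
      qed
    qed
    then show "measure lebesgue {\<alpha>\<in>{a'..b'}. \<bar>\<Phi> \<alpha> ?x - \<Phi> \<alpha> ?y\<bar> \<le> ?\<delta>} \<le> K * (real L ^ lcp v w / real L ^ j)"
      unfolding T_def q_def .
  qed
qed

lemma Fav_gen_lower:
  obtains c where "c > 0" "\<And>n. n \<ge> 1 \<Longrightarrow> ennreal (c / real n) \<le> Fav_gen {s<..<t} \<Phi> (fin_iter L b n)"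
proof -
  obtain a' b' K m u where ab: "a' < b'" "{a'..b'} \<subseteq> {s<..<t}" and K: "K > 0" and m: "m \<ge> 1" and u: "u \<in> words L m"
    and pair: "\<And>j v w. v \<in> words L j \<Longrightarrow> w \<in> words L j \<Longrightarrow>
       measure lebesgue {\<alpha>\<in>{a'..b'}. \<bar>\<Phi> \<alpha> (center (u @ v)) - \<Phi> \<alpha> (center (u @ w))\<bar> \<le> 2 * (\<kappa> * (1 / real L) ^ (m + j))}
       \<le> K * (real L ^ lcp v w / real L ^ j)"
    using pair_measure_bound by blast
  have L: "real L > 0"
    using L_pos by simp
  \<comment> \<open>Total length of the image intervals of all words with prefix \<open>u\<close>.
    Their number \<open>L^j\<close> cancels the scale, so it does not depend on
    \<open>j\<close>.\<close>
  define a0 where "a0 = 2 * \<kappa> * (1 / real L) ^ m"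
  have a0: "a0 > 0"
    using kappa_pos L by (simp add: a0_def)
  define l where "l = b' - a'"
  have l: "l > 0"
    using ab by (simp add: l_def)
  have large: "ennreal (a0 * l\<^sup>2 / (K * real (j + 1))) \<le> Fav_gen {s<..<t} \<Phi> (fin_iter L b (m + j))" for j
  proof -
    let ?W = "words L j"
    define \<rho> where "\<rho> = \<kappa> * (1 / real L) ^ (m + j)"
    have \<rho>: "\<rho> \<ge> 0"
      using kappa_pos by (simp add: \<rho>_def)
    have \<rho>_card: "2 * \<rho> * real L ^ j = a0"
      using L by (simp add: \<rho>_def a0_def power_add power_divide)
    define x where "x v = center (u @ v)" for v
    have uv: "u @ v \<in> words L (m + j)" if "v \<in> ?W" for v
      using u that by (auto simp: words_def)
    define T where "T v w = {\<alpha>\<in>{a'..b'}. \<bar>\<Phi> \<alpha> (x v) - \<Phi> \<alpha> (x w)\<bar> \<le> 2 * \<rho>}" for v w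
    have T: "T v w \<in> lmeasurable" if "v \<in> ?W" "w \<in> ?W" for v w
      unfolding T_def x_def using center_in_V[OF uv] that V_sub by (intro lmeasurable_level_strip ab) auto
    have T_int: "integrable lebesgue (indicat_real (T v w))" if "v \<in> ?W" "w \<in> ?W" for v w
      using T[OF that] by (simp add: lmeasurable_iff_integrable)
    have pair_T: "measure lebesgue (T v w) \<le> K * (real L ^ lcp v w / real L ^ j)" if "v \<in> ?W" "w \<in> ?W" for v w
      unfolding T_def x_def \<rho>_def by (rule pair[OF that])
    \<comment> \<open>This value maximises
      \<open>2 * a0 * l / M - a0 * K * (j + 1) / M\<^sup>2\<close>, the lower bound obtained after
      integration over \<open>\<alpha>\<close>; the maximum is \<open>a0 * l / M\<close>.\<close>
    define M where "M = K * real (j + 1) / l"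
    have M: "M > 0"
      using K l by (simp add: M_def)
    define f where "f \<alpha> = 1 / M\<^sup>2 * (2 * \<rho> * (\<Sum>v\<in>?W. \<Sum>w\<in>?W. indicat_real (T v w) \<alpha>))" for \<alpha>
    have f0: "f \<alpha> \<ge> 0" for \<alpha>
      unfolding f_def using \<rho> by (intro mult_nonneg_nonneg sum_nonneg) auto
    have f_int: "integrable lebesgue f"
      unfolding f_def by (intro integrable_mult_right Bochner_Integration.integrable_sum T_int)
    have "(\<integral>\<alpha>. f \<alpha> \<partial>lebesgue) = 1 / M\<^sup>2 * (2 * \<rho> * (\<Sum>v\<in>?W. \<Sum>w\<in>?W. measure lebesgue (T v w)))"
      unfolding f_def
      by (subst integral_mult_right_zero)+
         (simp add: T_int Bochner_Integration.integral_sum Bochner_Integration.integrable_sum cong: sum.cong)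
    also have "\<dots> \<le> 1 / M\<^sup>2 * (2 * \<rho> * (\<Sum>v\<in>?W. \<Sum>w\<in>?W. K * (real L ^ lcp v w / real L ^ j)))"
      by (intro mult_left_mono sum_mono pair_T) (use \<rho> in auto)
    also have "(\<Sum>v\<in>?W. \<Sum>w\<in>?W. K * (real L ^ lcp v w / real L ^ j))
        = K / real L ^ j * (\<Sum>v\<in>?W. \<Sum>w\<in>?W. real L ^ lcp v w)"
      by (simp add: sum_distrib_left mult.commute)
    also have "1 / M\<^sup>2 * (2 * \<rho> * (K / real L ^ j * (\<Sum>v\<in>?W. \<Sum>w\<in>?W. real L ^ lcp v w)))
        \<le> 1 / M\<^sup>2 * (2 * \<rho> * (K / real L ^ j * (real (j + 1) * real L ^ (2 * j))))"
      using \<rho> K L L_pos by (intro mult_left_mono sum_lcp_le) auto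
    also have "\<dots> = 1 / M\<^sup>2 * ((2 * \<rho> * real L ^ j) * (K * real (j + 1)))"
    proof -
      have "K / real L ^ j * (real (j + 1) * real L ^ (2 * j)) = real L ^ j * (K * real (j + 1))"
        using L by (simp add: mult_2 power_add)
      then show ?thesis
        by (simp only: mult.assoc)
    qed
    also have "\<dots> = a0 * l / M"
    proof -
      have "K * real (j + 1) = M * l"
        using l by (simp add: M_def)
      then show ?thesis
        unfolding \<rho>_card using M by (simp add: power2_eq_square)
    qed
    finally have f_le: "(\<integral>\<alpha>. f \<alpha> \<partial>lebesgue) \<le> a0 * l / M" .
    have pt: "ennreal (2 * a0 / M - f \<alpha>) \<le> emeasure lebesgue (\<Phi> \<alpha> ` fin_iter L b (m + j))" if \<alpha>: "\<alpha> \<in> {a'..b'}" for \<alpha>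
    proof -
      have \<alpha>': "\<alpha> \<in> {s<..<t}"
        using \<alpha> ab by blast
      have lm: "\<Phi> \<alpha> ` fin_iter L b (m + j) \<in> lmeasurable"
        using compact_Phi_fin_iter[OF \<alpha>'] by (rule lmeasurable_compact)
      have "2 / M * (2 * \<rho> * card ?W)
          - 1 / M\<^sup>2 * (2 * \<rho> * (\<Sum>v\<in>?W. \<Sum>w\<in>?W. of_bool (\<bar>\<Phi> \<alpha> (x v) - \<Phi> \<alpha> (x w)\<bar> \<le> 2 * \<rho>)))
          \<le> measure lebesgue (\<Phi> \<alpha> ` fin_iter L b (m + j))"
        using word_square_interval[OF \<alpha>' uv] unfolding \<rho>_def[symmetric] x_def[symmetric]
        by (intro measure_ge_second_moment \<rho> M lm) auto
      also have "2 / M * (2 * \<rho> * card ?W) = 2 * a0 / M"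
        using \<rho>_card by (simp add: card_words)
      also have "(\<Sum>v\<in>?W. \<Sum>w\<in>?W. of_bool (\<bar>\<Phi> \<alpha> (x v) - \<Phi> \<alpha> (x w)\<bar> \<le> 2 * \<rho>)) = (\<Sum>v\<in>?W. \<Sum>w\<in>?W. indicat_real (T v w) \<alpha>)"
        using \<alpha> by (intro sum.cong refl) (auto simp: T_def)
      finally have "2 * a0 / M - f \<alpha> \<le> measure lebesgue (\<Phi> \<alpha> ` fin_iter L b (m + j))"
        by (simp only: f_def)
      then show ?thesis
        unfolding emeasure_eq_measure2[OF lm] by (rule ennreal_leI)
    qed
    have "ennreal (2 * a0 / M * l) = (\<integral>\<^sup>+\<alpha>\<in>{a'..b'}. ennreal (2 * a0 / M) \<partial>lebesgue)"
      using ab M a0 by (subst nn_integral_const_interval(2)) (auto simp: l_def mult.commute)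
    \<comment> \<open>Negative values of \<open>2 * a0 / M - f \<alpha>\<close> become 0 under
      \<open>ennreal\<close>. Adding \<open>f\<close> on the larger side, instead of subtracting it,
      keeps all integrals nonnegative and asks for no measurability of the length of the image in
      \<open>\<alpha>\<close>.\<close>
    also have "\<dots> \<le> (\<integral>\<^sup>+\<alpha>. ennreal (2 * a0 / M - f \<alpha>) * indicator {a'..b'} \<alpha> + ennreal (f \<alpha>) \<partial>lebesgue)"
    proof (intro nn_integral_mono)
      fix \<alpha>
      have "ennreal (2 * a0 / M) \<le> ennreal (2 * a0 / M - f \<alpha>) + ennreal (f \<alpha>)"
        using f0[of \<alpha>] M a0 by (cases "f \<alpha> \<le> 2 * a0 / M") (auto simp flip: ennreal_plus intro!: ennreal_leI add_increasing)
      then show "ennreal (2 * a0 / M) * indicator {a'..b'} \<alpha> \<le> ennreal (2 * a0 / M - f \<alpha>) * indicator {a'..b'} \<alpha> + ennreal (f \<alpha>)"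
        by (auto simp: indicator_def)
    qed
    also have "\<dots> = (\<integral>\<^sup>+\<alpha>\<in>{a'..b'}. ennreal (2 * a0 / M - f \<alpha>) \<partial>lebesgue) + (\<integral>\<^sup>+\<alpha>. ennreal (f \<alpha>) \<partial>lebesgue)"
    proof (rule nn_integral_add)
      have [measurable]: "f \<in> borel_measurable lebesgue"
        using f_int by (rule borel_measurable_integrable)
      have [measurable]: "{a'..b'} \<in> sets lebesgue"
        by simp
      show "(\<lambda>\<alpha>. ennreal (2 * a0 / M - f \<alpha>) * indicator {a'..b'} \<alpha>) \<in> borel_measurable lebesgue"
        "(\<lambda>\<alpha>. ennreal (f \<alpha>)) \<in> borel_measurable lebesgue"
        by measurable
    qed
    also have "(\<integral>\<^sup>+\<alpha>. ennreal (f \<alpha>) \<partial>lebesgue) \<le> ennreal (a0 * l / M)"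
      using f_le by (subst nn_integral_eq_integral[OF f_int]) (auto simp: f0 intro: ennreal_leI)
    also have "(\<integral>\<^sup>+\<alpha>\<in>{a'..b'}. ennreal (2 * a0 / M - f \<alpha>) \<partial>lebesgue) \<le> Fav_gen {s<..<t} \<Phi> (fin_iter L b (m + j))"
      unfolding Fav_gen_def using pt ab(2) by (intro nn_integral_mono) (auto simp: indicator_def)
    finally have "ennreal (2 * a0 / M * l) \<le> Fav_gen {s<..<t} \<Phi> (fin_iter L b (m + j)) + ennreal (a0 * l / M)"
      by (simp add: add_mono add_right_mono add_left_mono)
    then have "ennreal (a0 * l / M) \<le> Fav_gen {s<..<t} \<Phi> (fin_iter L b (m + j))"
      using a0 l M
      by (cases "Fav_gen {s<..<t} \<Phi> (fin_iter L b (m + j))" rule: ennreal_cases)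
         (auto simp: ennreal_le_iff simp flip: ennreal_plus)
    also have "a0 * l / M = a0 * l\<^sup>2 / (K * real (j + 1))"
      by (simp add: M_def power2_eq_square)
    finally show ?thesis .
  qed
  define c where "c = min (a0 * l\<^sup>2 / K) ((t - s) * (2 * \<kappa> * (1 / real L) ^ m))"
  have c: "c > 0"
    using a0 l K st kappa_pos L by (simp add: c_def)
  show ?thesis
  proof (rule that[OF c])
    fix n :: nat assume n: "n \<ge> 1"
    show "ennreal (c / real n) \<le> Fav_gen {s<..<t} \<Phi> (fin_iter L b n)"
    proof (cases "n \<ge> m")
      case True
      then obtain j where j: "n = m + j"
        using le_Suc_ex by blast
      have "c / real n \<le> (a0 * l\<^sup>2 / K) / real (j + 1)"
        using a0 l K m j by (intro frac_le) (auto simp: c_def)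
      also have "\<dots> = a0 * l\<^sup>2 / (K * real (j + 1))"
        by simp
      finally show ?thesis
        using large[of j] j by (metis ennreal_leI order_trans)
    next
      case False
      have "c / real n \<le> c / 1"
        using c n by (intro divide_left_mono) auto
      also have "\<dots> \<le> (t - s) * (2 * \<kappa> * (1 / real L) ^ m)"
        by (simp add: c_def)
      also have "\<dots> \<le> (t - s) * (2 * \<kappa> * (1 / real L) ^ n)"
        using st kappa_pos L_pos False by (intro mult_left_mono power_decreasing) auto
      finally show ?thesis
        using Fav_gen_ge_single[of n] by (metis ennreal_leI order_trans)
    qed
  qed
qed

end

section \<open>Upper bound\<close>

text \<open>The corners are picked by the signs of the coordinates of \<open>g\<close>, so the width
  of the projected square is the l1 norm of \<open>g\<close>, which dominates the Euclidean
  one.\<close>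

lemma vec_cube_extremes:
  fixes g q :: "real^2"
  assumes "q \<in> cbox 0 1"
  obtains p p' where "p \<in> cbox 0 1" "p' \<in> cbox 0 1" "g \<bullet> p' \<le> g \<bullet> q" "g \<bullet> q \<le> g \<bullet> p" "norm g \<le> g \<bullet> (p - p')"
proof -
  define p :: "real^2" where "p = (\<chi> i. if g $ i \<ge> 0 then 1 else 0)"
  define p' :: "real^2" where "p' = (\<chi> i. if g $ i \<ge> 0 then 0 else 1)"
  have q: "0 \<le> q $ i" "q $ i \<le> 1" for i
    using assms by (auto simp: mem_box_cart)
  have c: "g $ i * p' $ i \<le> g $ i * q $ i \<and> g $ i * q $ i \<le> g $ i * p $ i" for i
    using q[of i] by (auto simp: p_def p'_def mult_left_le mult_le_0_iff zero_le_mult_iff mult_le_cancel_left1)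
  show ?thesis
  proof (rule that[of p p'])
    show "p \<in> cbox 0 1" "p' \<in> cbox 0 1"
      by (auto simp: mem_box_cart p_def p'_def)
    show "g \<bullet> p' \<le> g \<bullet> q" "g \<bullet> q \<le> g \<bullet> p"
      using c unfolding inner_vec_def by (auto intro!: sum_mono)
    have "g \<bullet> (p - p') = \<bar>g $ 1\<bar> + \<bar>g $ 2\<bar>"
      by (auto simp: inner_vec_def sum_2 p_def p'_def)
    then show "norm g \<le> g \<bullet> (p - p')"
      using norm_le_sum2[of g] by simp
  qed
qed

text \<open>Already the square containing \<open>z\<close> projects onto an interval of length at
  least \<open>L^-m * norm g\<close>, in which any shorter interval can be placed around the
  projection of \<open>z\<close>.\<close>

lemma fin_iter_projection_interval:
  assumes z: "z \<in> fin_iter L b m" and l: "0 \<le> l" "l \<le> (1 / real L) ^ m * norm g"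
  obtains a where "a \<le> g \<bullet> z" "g \<bullet> z \<le> a + l" "{a..a + l} \<subseteq> (\<lambda>z. g \<bullet> z) ` fin_iter L b m"
proof -
  obtain w q where w: "w \<in> words L m" and q: "q \<in> cbox 0 1" "z = word_map L b w q"
    using z unfolding fin_iter_words by blast
  obtain p p' where p: "p \<in> cbox 0 1" "p' \<in> cbox 0 1" "g \<bullet> p' \<le> g \<bullet> q" "g \<bullet> q \<le> g \<bullet> p" "norm g \<le> g \<bullet> (p - p')"
    using vec_cube_extremes[OF q(1)] by blast
  have diff: "g \<bullet> word_map L b w x - g \<bullet> word_map L b w y = (1 / real L) ^ m * (g \<bullet> (x - y))" for x y
    using w by (simp add: word_map_diff words_def flip: inner_diff_right)
  define lo hi where "lo = g \<bullet> word_map L b w p'" and "hi = g \<bullet> word_map L b w p"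
  have "0 \<le> (1 / real L) ^ m * (g \<bullet> (q - p'))" "0 \<le> (1 / real L) ^ m * (g \<bullet> (p - q))"
    using p by (intro mult_nonneg_nonneg; simp add: inner_diff_right)+
  then have "lo \<le> g \<bullet> z" "g \<bullet> z \<le> hi"
    using diff[of q p'] diff[of p q] q by (auto simp: lo_def hi_def)
  moreover have "l \<le> hi - lo"
    unfolding lo_def hi_def diff using l p by (meson mult_left_mono order_trans zero_le_divide_1_iff zero_le_power of_nat_0_le_iff)
  moreover have "{lo..hi} \<subseteq> (\<lambda>z. g \<bullet> z) ` fin_iter L b m"
  proof -
    have "connected ((\<lambda>x. g \<bullet> word_map L b w x) ` cbox 0 1)"
      by (intro connected_continuous_image continuous_intros convex_connected convex_box)
    then have "{lo..hi} \<subseteq> (\<lambda>x. g \<bullet> word_map L b w x) ` cbox 0 1"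
      using p unfolding lo_def hi_def by (intro connected_contains_Icc) auto
    also have "\<dots> \<subseteq> (\<lambda>z. g \<bullet> z) ` fin_iter L b m"
      using w unfolding fin_iter_words by blast
    finally show ?thesis .
  qed
  \<comment> \<open>The interval starts at the projection of \<open>z\<close>, unless it would then
    reach beyond \<open>hi\<close>; in that case it is pushed left to end there.\<close>
  ultimately show ?thesis
    using l by (intro that[of "min (g \<bullet> z) (hi - l)"]) (auto simp: min_def)
qed

lemma fin_iter_nonempty:
  assumes "L > 0" shows "fin_iter L b n \<noteq> {}"
proof -
  have "word_map L b (replicate n 1) 0 \<in> fin_iter L b n"
    using assms unfolding fin_iter_words by (intro UN_I imageI) (auto simp: words_def mem_box_cart)
  then show ?thesis by blast
qed

text \<open>A union of intervals of length at least \<open>l\<close> covers its neighbourhood of radius \<open>N * l\<close>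
  with boundedly many translates by multiples of \<open>l\<close>.\<close>

lemma fin_iter_projection_translate:
  assumes z: "z \<in> fin_iter L b m" and l: "0 < l" "l \<le> (1 / real L) ^ m * norm g"
    and \<sigma>: "\<bar>\<sigma>\<bar> \<le> real N * l"
  obtains j :: int and z' where "\<bar>j\<bar> \<le> int N + 1" "z' \<in> fin_iter L b m" "g \<bullet> z + \<sigma> = of_int j * l + g \<bullet> z'"
proof -
  obtain a where a: "a \<le> g \<bullet> z" "g \<bullet> z \<le> a + l" "{a..a + l} \<subseteq> (\<lambda>z. g \<bullet> z) ` fin_iter L b m"
    using fin_iter_projection_interval[OF z _ l(2)] l(1) by auto
  \<comment> \<open>The offset of the projection of \<open>z\<close> from \<open>a\<close> lies
    between 0 and \<open>l\<close>, which is why the range of \<open>j\<close> grows from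
    \<open>N\<close> to \<open>N + 1\<close>.\<close>
  define j where "j = \<lfloor>(g \<bullet> z + \<sigma> - a) / l\<rfloor>"
  have "of_int j \<le> (g \<bullet> z + \<sigma> - a) / l" "(g \<bullet> z + \<sigma> - a) / l < of_int j + 1"
    unfolding j_def by linarith+
  then have "of_int j * l \<le> g \<bullet> z + \<sigma> - a" "g \<bullet> z + \<sigma> - a < (of_int j + 1) * l"
    using l(1) by (simp_all only: pos_le_divide_eq pos_divide_less_eq)
  then have "g \<bullet> z + \<sigma> - of_int j * l \<in> {a..a + l}"
    by (auto simp: algebra_simps)
  then obtain z' where z': "z' \<in> fin_iter L b m" "g \<bullet> z + \<sigma> - of_int j * l = g \<bullet> z'"
    using a(3) by blast
  have "- real N \<le> (g \<bullet> z + \<sigma> - a) / l" "(g \<bullet> z + \<sigma> - a) / l \<le> real N + 1"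
    using a \<sigma> l(1) by (simp_all only: pos_le_divide_eq pos_divide_le_eq) (auto simp: abs_le_iff algebra_simps)
  then have "\<bar>j\<bar> \<le> int N + 1"
    unfolding j_def by linarith
  with z' show ?thesis
    by (intro that[of j z']) auto
qed

text \<open>A single square has projections of length at least \<open>L^-m\<close> in every
  direction. The bound lets \<open>Fav (fin_iter L b m)\<close> absorb a constant when only finitely
  many \<open>m\<close> matter.\<close>

lemma Fav_fin_iter_lower:
  assumes L: "L > 0"
  shows "ennreal (pi * (1 / real L) ^ m) \<le> Fav (fin_iter L b m)"
proof -
  obtain z where z: "z \<in> fin_iter L b m"
    using fin_iter_nonempty[OF L] by blast
  have "ennreal ((1 / real L) ^ m) \<le> proj_length (fin_iter L b m) (unit_vec \<theta>)" for \<theta>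
  proof -
    have "norm (unit_vec \<theta>) = 1"
      by (simp add: unit_vec_def norm_vec_def L2_set_def sum_2)
    then have "0 \<le> (1 / real L) ^ m" "(1 / real L) ^ m \<le> (1 / real L) ^ m * norm (unit_vec \<theta>)"
      by simp_all
    from fin_iter_projection_interval[OF z this]
    obtain a where "{a..a + (1 / real L) ^ m} \<subseteq> (\<lambda>z. unit_vec \<theta> \<bullet> z) ` fin_iter L b m"
      by blast
    moreover have "compact ((\<lambda>z. unit_vec \<theta> \<bullet> z) ` fin_iter L b m)"
      by (intro compact_continuous_image continuous_intros compact_fin_iter)
    ultimately have "emeasure lborel {a..a + (1 / real L) ^ m} \<le> proj_length (fin_iter L b m) (unit_vec \<theta>)"
      unfolding proj_length_def by (intro emeasure_mono) (auto simp: borel_compact)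
    then show ?thesis
      by simp
  qed
  then have "(\<integral>\<^sup>+\<theta>\<in>{0..pi}. ennreal ((1 / real L) ^ m) \<partial>lborel) \<le> Fav (fin_iter L b m)"
    unfolding Fav_eq[OF compact_fin_iter] by (intro nn_integral_mono mult_right_mono) auto
  then show ?thesis
    by (subst (asm) nn_integral_const_interval(2)[unfolded nn_integral_completion]) auto
qed

section \<open>Images under \<open>\<Phi>\<close> compared with linear projections\<close>

context transversal_self_similar
begin

lemma V_neighbourhood:
  obtains e where "e > 0" "\<And>x. x \<in> V \<Longrightarrow> ball x e \<subseteq> U"
proof -
  obtain e where e: "e > 0" "(\<Union>x\<in>V. ball x e) \<subseteq> U"
    using compact_subset_open_imp_ball_epsilon_subset[OF compact_V open_U V_sub] .
  show ?thesis
    by (rule that[OF e(1)]) (use e(2) in blast)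
qed

text \<open>Segments between points of \<open>V\<close> may leave \<open>U\<close>, so the gradient
  bound is used only inside finitely many balls that cover \<open>V\<close>, each with an image of
  length at most \<open>2 * C * e\<close>.\<close>

lemma Fav_gen_bounded:
  obtains B where "B > 0" "\<And>n. Fav_gen {s<..<t} \<Phi> (fin_iter L b n) \<le> ennreal B"
proof -
  obtain e where e: "e > 0" "\<And>x. x \<in> V \<Longrightarrow> ball x e \<subseteq> U"
    using V_neighbourhood by blast
  obtain X where X: "X \<subseteq> V" "finite X" "V \<subseteq> (\<Union>x\<in>X. ball x e)"
    using compactE_image[OF compact_V, of V "\<lambda>x. ball x e"] e(1) by (metis UN_I centre_in_ball open_ball subsetI)
  define B where "B = (t - s) * (real (card X) * (2 * C * e)) + 1"
  have "Fav_gen {s<..<t} \<Phi> (fin_iter L b n) \<le> ennreal B" for n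
  proof -
    have pt: "emeasure lebesgue (\<Phi> \<alpha> ` fin_iter L b n) \<le> ennreal (real (card X) * (2 * C * e))" if a: "\<alpha> \<in> {s<..<t}" for \<alpha>
    proof -
      have "\<Phi> \<alpha> ` fin_iter L b n \<subseteq> (\<Union>x\<in>X. {\<Phi> \<alpha> x - C * e..\<Phi> \<alpha> x + C * e})"
      proof
        fix v assume "v \<in> \<Phi> \<alpha> ` fin_iter L b n"
        then obtain y where y: "y \<in> V" "v = \<Phi> \<alpha> y"
          using fin_iter_sub by blast
        then obtain x where x: "x \<in> X" "y \<in> ball x e"
          using X by blast
        then have "closed_segment x y \<subseteq> U"
          using e X by (meson centre_in_ball closed_segment_subset convex_ball order_trans subsetD)
        from Phi_lipschitz[OF a this] have "\<bar>\<Phi> \<alpha> y - \<Phi> \<alpha> x\<bar> \<le> C * norm (y - x)" .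
        also have "\<dots> \<le> C * e"
          using x C by (intro mult_left_mono) (auto simp: dist_norm norm_minus_commute)
        finally show "v \<in> (\<Union>x\<in>X. {\<Phi> \<alpha> x - C * e..\<Phi> \<alpha> x + C * e})"
          using x y by (intro UN_I[of x]) (auto simp: abs_le_iff)
      qed
      then have "emeasure lebesgue (\<Phi> \<alpha> ` fin_iter L b n) \<le> emeasure lebesgue (\<Union>x\<in>X. {\<Phi> \<alpha> x - C * e..\<Phi> \<alpha> x + C * e})"
        using X by (intro emeasure_mono sets.finite_UN) auto
      also have "\<dots> \<le> (\<Sum>x\<in>X. emeasure lebesgue {\<Phi> \<alpha> x - C * e..\<Phi> \<alpha> x + C * e})"
        using X by (intro emeasure_subadditive_finite) auto
      also have "\<dots> = ennreal (real (card X) * (2 * C * e))"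
        using C e by (simp add: ennreal_mult ennreal_of_nat_eq_real_of_nat mult.assoc)
      finally show ?thesis .
    qed
    have "Fav_gen {s<..<t} \<Phi> (fin_iter L b n) \<le> (\<integral>\<^sup>+\<alpha>\<in>{s<..<t}. ennreal (real (card X) * (2 * C * e)) \<partial>lebesgue)"
      unfolding Fav_gen_def using pt by (intro nn_integral_mono) (auto simp: indicator_def)
    also have "\<dots> = ennreal ((t - s) * (real (card X) * (2 * C * e)))"
      using st C e by (intro nn_integral_const_interval(1)) auto
    also have "\<dots> \<le> ennreal B"
      by (intro ennreal_leI) (simp add: B_def)
    finally show ?thesis .
  qed
  moreover have "B > 0"
    unfolding B_def using st C e by (intro add_nonneg_pos mult_nonneg_nonneg) auto
  ultimately show ?thesis
    using that by blast
qed

text \<open>After rescaling by \<open>L^k\<close>, the image of a piece is the linear projection of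
  \<open>E_m\<close> in the direction of one gradient, perturbed pointwise by at most
  \<open>N * l\<close>. A pointwise perturbation could destroy the comparison of lengths, but the
  projection consists of intervals of length at least \<open>l\<close>, so \<open>2 * N + 3\<close>
  of its translates cover the perturbed set.\<close>

lemma piece_image_bound:
  assumes e: "e > 0" "\<And>x. x \<in> V \<Longrightarrow> ball x e \<subseteq> U"
    and D: "\<And>x y. x \<in> V \<Longrightarrow> y \<in> V \<Longrightarrow> norm (x - y) \<le> D" and N: "4 * C\<^sup>2 * D\<^sup>2 \<le> real N"
    and small: "(1 / real L) ^ k * D < e" and km: "m \<le> k" and w: "w \<in> words L k"
    and z0: "z0 \<in> fin_iter L b m" and a: "\<alpha> \<in> {s<..<t}"
  shows "emeasure lebesgue (\<Phi> \<alpha> ` word_map L b w ` fin_iter L b m)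
    \<le> ennreal (real (2 * N + 3) * (1 / real L) ^ k) * proj_length (fin_iter L b m) (G \<alpha> (word_map L b w z0))"
proof -
  define \<rho> where "\<rho> = (1 / real L) ^ k"
  have \<rho>: "\<rho> > 0"
    using L_pos by (simp add: \<rho>_def)
  define x0 where "x0 = word_map L b w z0"
  define g where "g = G \<alpha> x0"
  have sub: "word_map L b w z \<in> V" if "z \<in> fin_iter L b m" for z
    using fin_iter_sub[of "k + m"] that w unfolding fin_iter_add by blast
  have x0: "x0 \<in> V"
    unfolding x0_def by (rule sub[OF z0])
  have diff: "word_map L b w z - x0 = \<rho> *\<^sub>R (z - z0)" for z
    using w by (simp add: x0_def word_map_diff words_def \<rho>_def)
  \<comment> \<open>A lower bound, valid for every gradient, for the length of the projection of a
    square of \<open>E_m\<close>.\<close>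
  define l where "l = (1 / real L) ^ m / C"
  have l: "l > 0"
    using L_pos C by (simp add: l_def)
  have "(1 / real L) ^ m * (1 / C) \<le> (1 / real L) ^ m * norm g"
    using G_norm[OF a, of x0] x0 V_sub by (intro mult_left_mono) (auto simp: g_def)
  then have lg: "l \<le> (1 / real L) ^ m * norm g"
    by (simp add: l_def)
  define K where "K = (\<lambda>z. g \<bullet> z) ` fin_iter L b m"
  have K: "compact K"
    unfolding K_def by (intro compact_continuous_image continuous_intros compact_fin_iter)
  define A where "A j = (\<lambda>y. \<rho> *\<^sub>R y + (\<Phi> \<alpha> x0 - \<rho> * (g \<bullet> z0) + \<rho> * (of_int j * l))) ` K" for j :: int
  have A: "compact (A j)" for j
    unfolding A_def by (intro compact_continuous_image continuous_intros K)
  have eA: "emeasure lebesgue (A j) = ennreal \<rho> * proj_length (fin_iter L b m) g" for j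
    unfolding A_def emeasure_lebesgue_affine using \<rho> K
    by (simp add: proj_length_def K_def[symmetric] borel_compact)
  have "\<Phi> \<alpha> ` word_map L b w ` fin_iter L b m \<subseteq> (\<Union>j\<in>{- (int N + 1)..int N + 1}. A j)"
  proof
    fix v assume "v \<in> \<Phi> \<alpha> ` word_map L b w ` fin_iter L b m"
    then obtain z where z: "z \<in> fin_iter L b m" "v = \<Phi> \<alpha> (word_map L b w z)"
      by blast
    have zz: "norm (z - z0) \<le> D"
      using D fin_iter_sub z z0 by blast
    have n: "norm (word_map L b w z - x0) \<le> \<rho> * D"
      unfolding diff using \<rho> zz by simp
    then have "word_map L b w z \<in> ball x0 e"
      using small by (simp add: \<rho>_def dist_norm norm_minus_commute)
    then have seg: "closed_segment x0 (word_map L b w z) \<subseteq> U"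
      using e x0 by (meson centre_in_ball closed_segment_subset convex_ball order_trans)
    define R where "R = v - \<Phi> \<alpha> x0 - g \<bullet> (word_map L b w z - x0)"
    have "\<bar>R\<bar> \<le> 4 * C * (norm (word_map L b w z - x0))\<^sup>2"
      unfolding R_def z(2) g_def by (rule Phi_taylor[OF a seg])
    also have "\<dots> \<le> 4 * C * (\<rho> * D)\<^sup>2"
      using n C by (intro mult_left_mono power_mono) auto
    finally have "\<bar>R\<bar> / \<rho> \<le> 4 * C * D\<^sup>2 * \<rho>"
      using \<rho> by (simp add: power2_eq_square field_simps)
    \<comment> \<open>Here \<open>m \<le> k\<close> enters: the rescaled remainder is of order
      \<open>L^-k\<close> and has to be measured in units of \<open>l\<close>, which is of order
      \<open>L^-m\<close>.\<close>
    also have "\<dots> \<le> 4 * C * D\<^sup>2 * (1 / real L) ^ m"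
      unfolding \<rho>_def using km L_pos C by (intro mult_left_mono power_decreasing) auto
    also have "\<dots> = 4 * C\<^sup>2 * D\<^sup>2 * l"
      using C by (simp add: l_def power2_eq_square)
    also have "\<dots> \<le> real N * l"
      using N l by (intro mult_right_mono) auto
    finally have "\<bar>R / \<rho>\<bar> \<le> real N * l"
      using \<rho> by simp
    then obtain j z' where j: "\<bar>j\<bar> \<le> int N + 1" "z' \<in> fin_iter L b m" "g \<bullet> z + R / \<rho> = of_int j * l + g \<bullet> z'"
      using fin_iter_projection_translate[OF z(1) l lg] by blast
    have "v = \<Phi> \<alpha> x0 + \<rho> * (g \<bullet> z - g \<bullet> z0) + R"
      by (simp add: R_def diff inner_diff_right)
    also have "\<dots> = \<rho> * (g \<bullet> z + R / \<rho>) + (\<Phi> \<alpha> x0 - \<rho> * (g \<bullet> z0))"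
      using \<rho> by (simp add: algebra_simps)
    also have "\<dots> = \<rho> *\<^sub>R (g \<bullet> z') + (\<Phi> \<alpha> x0 - \<rho> * (g \<bullet> z0) + \<rho> * (of_int j * l))"
      unfolding j(3) by (simp add: algebra_simps)
    finally have "v \<in> A j"
      using j(2) unfolding A_def K_def by blast
    then show "v \<in> (\<Union>j\<in>{- (int N + 1)..int N + 1}. A j)"
      using j(1) by (intro UN_I[of j]) auto
  qed
  then have "emeasure lebesgue (\<Phi> \<alpha> ` word_map L b w ` fin_iter L b m)
      \<le> emeasure lebesgue (\<Union>j\<in>{- (int N + 1)..int N + 1}. A j)"
    using A by (intro emeasure_mono sets.finite_UN) (auto simp: borel_compact)
  also have "\<dots> \<le> (\<Sum>j\<in>{- (int N + 1)..int N + 1}. emeasure lebesgue (A j))"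
    using A by (intro emeasure_subadditive_finite) (auto simp: borel_compact)
  also have "\<dots> = of_nat (2 * N + 3) * (ennreal \<rho> * proj_length (fin_iter L b m) g)"
    by (simp add: eA nat_add_distrib nat_mult_distrib add.commute flip: mult_2)
  also have "\<dots> = ennreal (real (2 * N + 3) * \<rho>) * proj_length (fin_iter L b m) g"
    using \<rho> by (subst ennreal_mult) (auto simp: ennreal_of_nat_eq_real_of_nat mult.assoc)
  finally show ?thesis
    by (simp only: \<rho>_def g_def x0_def)
qed

lemma Fav_gen_upper:
  obtains M where "M > 0" "\<And>n. Fav_gen {s<..<t} \<Phi> (fin_iter L b n) \<le> ennreal M * Fav (fin_iter L b (n div 2))"
proof -
  obtain e where e: "e > 0" "\<And>x. x \<in> V \<Longrightarrow> ball x e \<subseteq> U"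
    using V_neighbourhood by blast
  obtain D where D: "\<And>x y. x \<in> V \<Longrightarrow> y \<in> V \<Longrightarrow> norm (x - y) \<le> D"
    using compact_imp_bounded[OF compact_V] unfolding bounded_two_points dist_norm by blast
  obtain N where N: "4 * C\<^sup>2 * D\<^sup>2 \<le> real N"
    using real_arch_simple by blast
  obtain B where B: "B > 0" "\<And>n. Fav_gen {s<..<t} \<Phi> (fin_iter L b n) \<le> ennreal B"
    using Fav_gen_bounded by blast
  have L: "real L > 0" "real L \<ge> 3"
    using L_ge_3 by auto
  have "(\<lambda>k. (1 / real L) ^ k * D) \<longlonglongrightarrow> 0"
    using L_ge_3 by (intro tendsto_mult_left_zero LIMSEQ_realpow_zero) auto
  from order_tendstoD(2)[OF this e(1)] obtain k0 where k0: "\<And>k. k \<ge> k0 \<Longrightarrow> (1 / real L) ^ k * D < e"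
    unfolding eventually_sequentially by blast
  define Q where "Q = C ^ 4 * (C ^ 3 * (t - s) / pi + 2)"
  have Q: "Q > 0"
    unfolding Q_def using C st by (intro mult_pos_pos add_nonneg_pos) auto
  have large: "Fav_gen {s<..<t} \<Phi> (fin_iter L b (k + m)) \<le> ennreal (real (2 * N + 3) * Q) * Fav (fin_iter L b m)"
    if k: "k \<ge> k0" "m \<le> k" for k m
  proof -
    let ?F = "fin_iter L b m" and ?c = "real (2 * N + 3) * (1 / real L) ^ k"
    obtain z0 where z0: "z0 \<in> ?F"
      using fin_iter_nonempty[OF L_pos] by blast
    have x: "word_map L b w z0 \<in> U" if "w \<in> words L k" for w
      using fin_iter_sub[of "k + m"] V_sub that z0 unfolding fin_iter_add by blast
    have cont: "continuous_on {s<..<t} (\<lambda>\<alpha>. H \<alpha> x)"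
      if H: "continuous_on ({s<..<t} \<times> U) (\<lambda>(\<alpha>, x). H \<alpha> x)" and "x \<in> U" for H :: "real \<Rightarrow> real^2 \<Rightarrow> real^2" and x
    proof -
      have "continuous_on {s<..<t} (\<lambda>\<alpha>. (\<lambda>(\<alpha>, x). H \<alpha> x) (\<alpha>, x))"
        by (rule continuous_on_compose2[OF H]) (use \<open>x \<in> U\<close> in \<open>auto intro!: continuous_intros\<close>)
      then show ?thesis by simp
    qed
    have "Fav_gen {s<..<t} \<Phi> (fin_iter L b (k + m))
        \<le> (\<integral>\<^sup>+\<alpha>. (\<Sum>w\<in>words L k. ennreal ?c * (proj_length ?F (G \<alpha> (word_map L b w z0)) * indicator {s<..<t} \<alpha>)) \<partial>lborel)"
      unfolding Fav_gen_def nn_integral_completion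
    proof (intro nn_integral_mono)
      fix \<alpha>
      have "emeasure lebesgue (\<Phi> \<alpha> ` fin_iter L b (k + m))
          \<le> (\<Sum>w\<in>words L k. ennreal ?c * proj_length ?F (G \<alpha> (word_map L b w z0)))" if a: "\<alpha> \<in> {s<..<t}"
      proof -
        have pc: "compact (\<Phi> \<alpha> ` word_map L b w ` ?F)" if "w \<in> words L k" for w
          using fin_iter_sub[of "k + m"] V_sub that unfolding fin_iter_add
          by (intro compact_continuous_image continuous_Phi[OF a] continuous_intros compact_fin_iter) auto
        have "emeasure lebesgue (\<Phi> \<alpha> ` fin_iter L b (k + m)) = emeasure lebesgue (\<Union>w\<in>words L k. \<Phi> \<alpha> ` word_map L b w ` ?F)"
          unfolding fin_iter_add image_UN ..
        also have "\<dots> \<le> (\<Sum>w\<in>words L k. emeasure lebesgue (\<Phi> \<alpha> ` word_map L b w ` ?F))"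
          using pc by (intro emeasure_subadditive_finite) (auto simp: borel_compact)
        also have "\<dots> \<le> (\<Sum>w\<in>words L k. ennreal ?c * proj_length ?F (G \<alpha> (word_map L b w z0)))"
          using k by (intro sum_mono piece_image_bound[OF e D N k0 _ _ z0 a]) auto
        finally show ?thesis .
      qed
      then show "emeasure lebesgue (\<Phi> \<alpha> ` fin_iter L b (k + m)) * indicator {s<..<t} \<alpha>
          \<le> (\<Sum>w\<in>words L k. ennreal ?c * (proj_length ?F (G \<alpha> (word_map L b w z0)) * indicator {s<..<t} \<alpha>))"
        by (auto simp: indicator_def)
    qed
    also have "\<dots> = (\<Sum>w\<in>words L k. ennreal ?c * (\<integral>\<^sup>+\<alpha>\<in>{s<..<t}. proj_length ?F (G \<alpha> (word_map L b w z0)) \<partial>lborel))"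
    proof -
      have meas: "(\<lambda>\<alpha>. proj_length ?F (G \<alpha> (word_map L b w z0)) * indicator {s<..<t} \<alpha>) \<in> borel_measurable lborel"
        if "w \<in> words L k" for w
        by (intro measurable_compose_continuous_on measurable_proj_length compact_fin_iter cont[OF G_cont] x that) simp
      show ?thesis
        by (subst nn_integral_sum) (intro borel_measurable_times_ennreal borel_measurable_const meas sum.cong refl nn_integral_cmult | assumption)+
    qed
    also have "\<dots> \<le> (\<Sum>w\<in>words L k. ennreal ?c * (ennreal Q * Fav ?F))"
      unfolding Q_def
    proof (intro sum_mono mult_left_mono)
      fix w assume w: "w \<in> words L k"
      show "(\<integral>\<^sup>+\<alpha>\<in>{s<..<t}. proj_length ?F (G \<alpha> (word_map L b w z0)) \<partial>lborel)
          \<le> ennreal (C ^ 4 * (C ^ 3 * (t - s) / pi + 2)) * Fav ?F"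
        by (rule proj_length_along_curve[where g' = "\<lambda>\<alpha>. G' \<alpha> (word_map L b w z0)"])
           (intro compact_fin_iter C G_deriv G_norm det cont[OF G'_cont] x[OF w] st; assumption)+
    qed simp
    also have "\<dots> = of_nat (L ^ k) * (ennreal ?c * (ennreal Q * Fav ?F))"
      by (simp add: card_words)
    also have "\<dots> = ennreal (real (L ^ k) * (?c * Q)) * Fav ?F"
      using Q by (simp add: ennreal_mult ennreal_of_nat_eq_real_of_nat mult.assoc del: of_nat_power of_nat_add of_nat_mult)
    also have "real (L ^ k) * (?c * Q) = real (2 * N + 3) * Q"
      using L by (simp add: power_divide)
    finally show ?thesis .
  qed
  \<comment> \<open>For \<open>k < k0\<close> the pieces may be too large for the Taylor estimate.
    Then \<open>m \<le> 2 * k0\<close>, and \<open>P\<close> is chosen so that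
    \<open>B = P * L^(-2 k0)\<close> is at most \<open>P * L^-m\<close>, hence dominated through
    \<open>Fav_fin_iter_lower\<close>.\<close>
  define P where "P = B * real L ^ (2 * k0)"
  have P: "P > 0"
    using B L by (simp add: P_def)
  define M where "M = real (2 * N + 3) * Q + P"
  show ?thesis
  proof (rule that[of M])
    show "M > 0"
      unfolding M_def using Q P by (intro add_nonneg_pos mult_nonneg_nonneg) auto
    fix n :: nat
    define m k where "m = n div 2" and "k = n - n div 2"
    have km: "n = k + m" "m \<le> k"
      by (auto simp: m_def k_def)
    show "Fav_gen {s<..<t} \<Phi> (fin_iter L b n) \<le> ennreal M * Fav (fin_iter L b (n div 2))"
    proof (cases "k \<ge> k0")
      case True
      have "ennreal (real (2 * N + 3) * Q) * Fav (fin_iter L b m) \<le> ennreal M * Fav (fin_iter L b m)"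
        using P by (intro mult_right_mono ennreal_leI) (auto simp: M_def)
      then show ?thesis
        using large[OF True km(2)] km(1) unfolding m_def by (metis order_trans)
    next
      case False
      have "B = P * (1 / real L) ^ (2 * k0)"
        using L by (simp add: P_def power_divide)
      also have "\<dots> \<le> P * (1 / real L) ^ m"
        using P L False km by (intro mult_left_mono power_decreasing) auto
      also have "\<dots> \<le> M * (pi * (1 / real L) ^ m)"
      proof -
        have "P * 1 \<le> M * pi"
          using P Q pi_gt3 unfolding M_def by (intro mult_mono) auto
        then have "(P * 1) * (1 / real L) ^ m \<le> (M * pi) * (1 / real L) ^ m"
          by (intro mult_right_mono) auto
        then show ?thesis
          by (simp add: mult.assoc)
      qed
      finally have "ennreal B \<le> ennreal M * ennreal (pi * (1 / real L) ^ m)"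
        using \<open>M > 0\<close> by (simp add: ennreal_leI flip: ennreal_mult)
      also have "\<dots> \<le> ennreal M * Fav (fin_iter L b m)"
        by (intro mult_left_mono Fav_fin_iter_lower L_pos) auto
      finally show ?thesis
        using B(2)[of n] unfolding m_def by (rule order_trans[rotated])
    qed
  qed
qed

end

section \<open>Doubling majorants\<close>

text \<open>For \<open>n \<ge> 2\<close> the two estimates are chained. The index
  \<open>n = 1\<close> leads to \<open>n div 2 = 0\<close>, where nothing is known about
  \<open>g\<close> or \<open>F\<close>, and is covered by the bound \<open>B\<close>. Absolute
  values appear because the signs of \<open>C\<^sub>1\<close> and \<open>K\<close> are not
  prescribed.\<close>

lemma upper_bound_transfer:
  fixes A F :: "nat \<Rightarrow> ennreal" and g :: "nat \<Rightarrow> real"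
  assumes M: "M > 0" "\<And>n. A n \<le> ennreal M * F (n div 2)" and B: "B > 0" "\<And>n. A n \<le> ennreal B"
    and g: "\<And>n. n \<ge> 1 \<Longrightarrow> g n > 0" and K: "\<And>n. n \<ge> 2 \<Longrightarrow> g (n div 2) \<le> K * g n"
    and F: "\<And>n. n \<ge> 1 \<Longrightarrow> F n \<le> ennreal (C\<^sub>1 * g n)"
  shows "\<exists>C\<^sub>2>0. \<forall>n\<ge>1. A n \<le> ennreal (C\<^sub>2 * g n)"
proof -
  define C\<^sub>2 where "C\<^sub>2 = B / g 1 + M * (\<bar>C\<^sub>1\<bar> * \<bar>K\<bar>)"
  have pos: "B / g 1 > 0" "M * (\<bar>C\<^sub>1\<bar> * \<bar>K\<bar>) \<ge> 0"
    using B g[of 1] M by auto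
  have "A n \<le> ennreal (C\<^sub>2 * g n)" if n: "n \<ge> 1" for n
  proof (cases "n = 1")
    case True
    have "B = B / g 1 * g 1"
      using g[of 1] by simp
    also have "\<dots> \<le> C\<^sub>2 * g 1"
      using pos g[of 1] by (intro mult_right_mono) (auto simp: C\<^sub>2_def)
    finally show ?thesis
      using True B(2)[of 1] by (metis ennreal_leI order_trans)
  next
    case False
    with n have n2: "n \<ge> 2" "n div 2 \<ge> 1"
      by auto
    have "C\<^sub>1 * g (n div 2) \<le> \<bar>C\<^sub>1\<bar> * g (n div 2)"
      using g[OF n2(2)] by (intro mult_right_mono) auto
    also have "\<dots> \<le> \<bar>C\<^sub>1\<bar> * (\<bar>K\<bar> * g n)"
    proof (intro mult_left_mono)
      have "K * g n \<le> \<bar>K\<bar> * g n"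
        using g[OF n] by (intro mult_right_mono) auto
      then show "g (n div 2) \<le> \<bar>K\<bar> * g n"
        using K[OF n2(1)] by linarith
    qed simp
    finally have "M * (C\<^sub>1 * g (n div 2)) \<le> M * (\<bar>C\<^sub>1\<bar> * (\<bar>K\<bar> * g n))"
      using M by (intro mult_left_mono) auto
    also have "\<dots> = (M * (\<bar>C\<^sub>1\<bar> * \<bar>K\<bar>)) * g n"
      by simp
    also have "\<dots> \<le> C\<^sub>2 * g n"
      using pos g[OF n] by (intro mult_right_mono) (auto simp: C\<^sub>2_def)
    finally have le: "M * (C\<^sub>1 * g (n div 2)) \<le> C\<^sub>2 * g n" .
    have "A n \<le> ennreal M * F (n div 2)"
      by (rule M)
    also have "\<dots> \<le> ennreal M * ennreal (C\<^sub>1 * g (n div 2))"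
      by (intro mult_left_mono F n2) auto
    also have "\<dots> = ennreal (M * (C\<^sub>1 * g (n div 2)))"
      using M by (simp add: ennreal_mult')
    also have "\<dots> \<le> ennreal (C\<^sub>2 * g n)"
      by (rule ennreal_leI[OF le])
    finally show ?thesis .
  qed
  moreover have "C\<^sub>2 > 0"
    using pos by (simp add: C\<^sub>2_def)
  ultimately show ?thesis
    by blast
qed

text \<open>For \<open>n \<ge> 2\<close> one has \<open>n \<le> 3 * (n div 2)\<close>, with equality
  at \<open>n = 3\<close>. Subadditivity of the square root then turns the loss into the constant
  \<open>c * sqrt (ln 3)\<close> in the exponent, so the rate \<open>c\<close> itself is
  preserved.\<close>

lemma exp_sqrt_ln_doubling:
  assumes "c \<ge> 0" "n \<ge> 2"
  shows "exp (- c * sqrt (ln (real (n div 2)))) \<le> exp (c * sqrt (ln 3)) * exp (- c * sqrt (ln (real n)))"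
proof -
  define m where "m = n div 2"
  have m: "m \<ge> 1" "n \<le> 3 * m"
    using assms(2) by (auto simp: m_def)
  have "real n \<le> 3 * real m"
    using m(2) by (metis of_nat_le_iff of_nat_mult of_nat_numeral)
  then have "ln (real n) \<le> ln (3 * real m)"
    using assms(2) m by (subst ln_le_cancel_iff) auto
  also have "\<dots> = ln (real m) + ln 3"
    using m by (simp add: ln_mult add.commute)
  finally have "sqrt (ln (real n)) \<le> sqrt (ln (real m) + ln 3)"
    by (rule real_sqrt_le_mono)
  also have "\<dots> \<le> sqrt (ln (real m)) + sqrt (ln 3)"
    using m by (intro sqrt_add_le_add_sqrt) auto
  finally have "c * sqrt (ln (real n)) \<le> c * (sqrt (ln (real m)) + sqrt (ln 3))"
    using assms(1) by (intro mult_left_mono)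
  then show ?thesis
    by (simp add: m_def[symmetric] distrib_left flip: exp_add)
qed

text \<open>The exponent \<open>- 1/6 + \<epsilon>\<close> may have either sign: monotonicity
  settles \<open>p \<ge> 0\<close>, and \<open>n \<le> 3 * (n div 2)\<close> settles
  \<open>p < 0\<close>.\<close>

lemma powr_doubling:
  assumes "n \<ge> 2"
  shows "real (n div 2) powr p \<le> 3 powr \<bar>p\<bar> * real n powr p"
proof -
  define m where "m = n div 2"
  have m: "m \<ge> 1" "n \<le> 3 * m" "m \<le> n"
    using assms by (auto simp: m_def)
  have n3: "real n \<le> 3 * real m"
    using m(2) by (metis of_nat_le_iff of_nat_mult of_nat_numeral)
  show ?thesis
  proof (cases "p \<ge> 0")
    case True
    have "real m powr p \<le> 1 * real n powr p"
      using True m by (simp add: powr_mono2)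
    also have "\<dots> \<le> 3 powr \<bar>p\<bar> * real n powr p"
      by (intro mult_right_mono ge_one_powr_ge_zero) auto
    finally show ?thesis
      by (simp add: m_def)
  next
    case False
    have "real m powr p \<le> (real n / 3) powr p"
      using False n3 assms by (intro powr_mono2') auto
    also have "\<dots> = 3 powr \<bar>p\<bar> * real n powr p"
      using False by (simp add: powr_divide powr_minus field_simps)
    finally show ?thesis
      by (simp add: m_def)
  qed
qed

text \<open>The clause quantified over \<open>g\<close> makes the transfer of asymptotic upper
  bounds precise: passing from \<open>n\<close> to \<open>n div 2\<close> may enlarge the majorant
  by at most a bounded factor. The known bounds enter as premises of the last two clauses, and their
  rate \<open>c\<^sub>0\<close> and exponent are kept.\<close>

theorem theorem2p4:
  fixes L :: nat and b :: "nat \<Rightarrow> real^2" and E U V :: "(real^2) set"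
    and s t C\<^sub>0 :: real and I :: "real set" and \<Phi> :: "real \<Rightarrow> real^2 \<Rightarrow> real"
  assumes E: "self_similar_ssc L b E"
    and I: "I = {s<..<t}" "s < t"
    and U: "open U"
    and C2: "C2_on (I \<times> U) (\<lambda>(\<alpha>, x). \<Phi> \<alpha> x)"
    and C0: "C\<^sub>0 \<ge> 1"
    and grad: "\<And>\<alpha> x. \<alpha> \<in> I \<Longrightarrow> x \<in> U \<Longrightarrow>
          1 / C\<^sub>0 \<le> norm (grad (\<Phi> \<alpha>) x) \<and> norm (grad (\<Phi> \<alpha>) x) \<le> C\<^sub>0"
    and hess: "\<And>\<alpha> x i j. \<alpha> \<in> I \<Longrightarrow> x \<in> U \<Longrightarrow>
          \<bar>pderiv_at i (pderiv_at j (\<Phi> \<alpha>)) x\<bar> \<le> C\<^sub>0"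
    and det: "\<And>\<alpha> x. \<alpha> \<in> I \<Longrightarrow> x \<in> U \<Longrightarrow>
          1 / C\<^sub>0 \<le> \<bar>det (transversality_matrix \<Phi> \<alpha> x)\<bar> \<and> \<bar>det (transversality_matrix \<Phi> \<alpha> x)\<bar> \<le> C\<^sub>0"
    and V: "compact V" "V \<subseteq> U" "\<And>n. fin_iter L b n \<subseteq> V"
  shows
    "(\<exists>c C :: real. c > 0 \<and> C > 0 \<and> (\<forall>n\<ge>1.
        ennreal (c / real n) \<le> Fav_gen I \<Phi> (fin_iter L b n) \<and>
        Fav_gen I \<Phi> (fin_iter L b n) \<le> ennreal C * Fav (fin_iter L b (n div 2)))) \<and>
     (\<forall>g :: nat \<Rightarrow> real.
        (\<forall>n\<ge>1. g n > 0) \<and> (\<exists>K. \<forall>n\<ge>2. g (n div 2) \<le> K * g n) \<and>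
        (\<exists>C\<^sub>1. \<forall>n\<ge>1. Fav (fin_iter L b n) \<le> ennreal (C\<^sub>1 * g n)) \<longrightarrow>
        (\<exists>C\<^sub>2>0. \<forall>n\<ge>1. Fav_gen I \<Phi> (fin_iter L b n) \<le> ennreal (C\<^sub>2 * g n))) \<and>
     (\<forall>C\<^sub>1>0. \<forall>c\<^sub>0>0.
        (\<forall>n\<ge>1. Fav (fin_iter L b n) \<le> ennreal (C\<^sub>1 * exp (- c\<^sub>0 * sqrt (ln (real n))))) \<longrightarrow>
        (\<exists>C\<^sub>2>0. \<forall>n\<ge>1. Fav_gen I \<Phi> (fin_iter L b n)
                    \<le> ennreal (C\<^sub>2 * exp (- c\<^sub>0 * sqrt (ln (real n)))))) \<and>
     (four_corner L b \<longrightarrow>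
        (\<forall>\<epsilon>>0. \<exists>C\<^sub>1>0. \<forall>n\<ge>1. Fav (fin_iter L b n) \<le> ennreal (C\<^sub>1 * real n powr (- 1/6 + \<epsilon>))) \<longrightarrow>
        (\<forall>\<epsilon>>0. \<exists>C\<^sub>2>0. \<forall>n\<ge>1. Fav_gen I \<Phi> (fin_iter L b n)
                    \<le> ennreal (C\<^sub>2 * real n powr (- 1/6 + \<epsilon>))))"
proof -
  obtain G' where "transversal_family s t C\<^sub>0 U \<Phi> (\<lambda>\<alpha>. grad (\<Phi> \<alpha>)) G'"
    using transversal_family_of_C2[OF I(2) U C2[unfolded I(1)] C0 grad[unfolded I(1)] hess[unfolded I(1)]
        det[unfolded I(1)]] .
  then interpret transversal_self_similar L b E s t C\<^sub>0 U \<Phi> "\<lambda>\<alpha>. grad (\<Phi> \<alpha>)" G' V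
    using E V by (auto simp: transversal_self_similar_def transversal_self_similar_axioms_def self_similar_def)
  obtain c where c: "c > 0" "\<And>n. n \<ge> 1 \<Longrightarrow> ennreal (c / real n) \<le> Fav_gen I \<Phi> (fin_iter L b n)"
    unfolding I(1) by (rule Fav_gen_lower) blast
  obtain M where M: "M > 0" "\<And>n. Fav_gen I \<Phi> (fin_iter L b n) \<le> ennreal M * Fav (fin_iter L b (n div 2))"
    unfolding I(1) by (rule Fav_gen_upper) blast
  obtain B where B: "B > 0" "\<And>n. Fav_gen I \<Phi> (fin_iter L b n) \<le> ennreal B"
    unfolding I(1) by (rule Fav_gen_bounded) blast
  have transfer: "\<exists>C\<^sub>2>0. \<forall>n\<ge>1. Fav_gen I \<Phi> (fin_iter L b n) \<le> ennreal (C\<^sub>2 * g n)"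
    if "\<And>n. n \<ge> 1 \<Longrightarrow> g n > 0" "\<And>n. n \<ge> 2 \<Longrightarrow> g (n div 2) \<le> K * g n"
      "\<And>n. n \<ge> 1 \<Longrightarrow> Fav (fin_iter L b n) \<le> ennreal (C\<^sub>1 * g n)" for g K C\<^sub>1
    by (rule upper_bound_transfer[where F = "\<lambda>n. Fav (fin_iter L b n)", OF M B that])
  show ?thesis
  proof (intro conjI allI impI)
    show "\<exists>c C. c > 0 \<and> C > 0 \<and> (\<forall>n\<ge>1.
        ennreal (c / real n) \<le> Fav_gen I \<Phi> (fin_iter L b n) \<and>
        Fav_gen I \<Phi> (fin_iter L b n) \<le> ennreal C * Fav (fin_iter L b (n div 2)))"
      using c M by blast
  next
    fix g :: "nat \<Rightarrow> real"
    assume "(\<forall>n\<ge>1. g n > 0) \<and> (\<exists>K. \<forall>n\<ge>2. g (n div 2) \<le> K * g n) \<and>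
        (\<exists>C\<^sub>1. \<forall>n\<ge>1. Fav (fin_iter L b n) \<le> ennreal (C\<^sub>1 * g n))"
    then obtain K C\<^sub>1 where "\<And>n. n \<ge> 1 \<Longrightarrow> g n > 0" "\<And>n. n \<ge> 2 \<Longrightarrow> g (n div 2) \<le> K * g n"
      "\<And>n. n \<ge> 1 \<Longrightarrow> Fav (fin_iter L b n) \<le> ennreal (C\<^sub>1 * g n)"
      by auto
    then show "\<exists>C\<^sub>2>0. \<forall>n\<ge>1. Fav_gen I \<Phi> (fin_iter L b n) \<le> ennreal (C\<^sub>2 * g n)"
      by (rule transfer)
  next
    fix C\<^sub>1 c\<^sub>0 :: real
    assume "c\<^sub>0 > 0" and "\<forall>n\<ge>1. Fav (fin_iter L b n) \<le> ennreal (C\<^sub>1 * exp (- c\<^sub>0 * sqrt (ln (real n))))"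
    then show "\<exists>C\<^sub>2>0. \<forall>n\<ge>1. Fav_gen I \<Phi> (fin_iter L b n) \<le> ennreal (C\<^sub>2 * exp (- c\<^sub>0 * sqrt (ln (real n))))"
      by (intro transfer[where g = "\<lambda>n. exp (- c\<^sub>0 * sqrt (ln (real n)))" and C\<^sub>1 = C\<^sub>1
            and K = "exp (c\<^sub>0 * sqrt (ln 3))"] exp_sqrt_ln_doubling)
        simp_all
  next
    fix \<epsilon> :: real
    assume "\<forall>\<epsilon>>0. \<exists>C\<^sub>1>0. \<forall>n\<ge>1. Fav (fin_iter L b n) \<le> ennreal (C\<^sub>1 * real n powr (- 1/6 + \<epsilon>))" and "\<epsilon> > 0"
    then obtain C\<^sub>1 where "\<And>n. n \<ge> 1 \<Longrightarrow> Fav (fin_iter L b n) \<le> ennreal (C\<^sub>1 * real n powr (- 1/6 + \<epsilon>))"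
      by blast
    then show "\<exists>C\<^sub>2>0. \<forall>n\<ge>1. Fav_gen I \<Phi> (fin_iter L b n) \<le> ennreal (C\<^sub>2 * real n powr (- 1/6 + \<epsilon>))"
      by (intro transfer[where g = "\<lambda>n. real n powr (- 1/6 + \<epsilon>)" and C\<^sub>1 = C\<^sub>1
            and K = "3 powr \<bar>- 1/6 + \<epsilon>\<bar>"] powr_doubling) simp_all
  qed
qed

end
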